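(* Assume that there is a constant $\alpha>2$ with $\mathbb E(|a|^{\alpha})<1$ and $\mathbb E(|b|^{\alpha})<+\infty$, and that $\mathbb P(b\neq 0)>0$ and $\mathbb E(b)=0$. Assume moreover that at least one of the following holds: (i) $\mathbb E(a)\geq 0$ and, for all $x\in\mathbb R$ and $y>0$, $\mathbb P_x(\tau_y>1)=\mathbb P(ax+b>-y)>0$; (ii) for any $x\in\mathbb R$ and $y>0$ there exists $p_0\in(2,\alpha)$ such that for any constant $c>0$ there exists $n_0\geq 1$ with $\mathbb P_x\big((X_{n_0},y+S_{n_0})\in K_{p_0,c},\ \tau_y>n_0\big)>0$, where $K_{p_0,c}=\{(x',y')\in\mathbb R\times(0,+\infty):\ y'\geq c(1+|x'|^{p_0})\}$. Then for any $x\in\mathbb R$, $y>0$ and $t>0$, $$\mathbb P_x\left(\frac{y+S_n}{\sigma\sqrt n}\leq t\ \Big|\ \tau_y>n\right)\underset{n\to+\infty}{\longrightarrow}\mathbf\Phi^+(t),$$ where $\mathbf\Phi^+(t)=1-e^{-t^2/2}$ is the Rayleigh distribution function.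
   Context: Let $(a_i,b_i)_{i\geq1}$ be i.i.d. real random pairs on a probability space with probability $\mathbb P$ and expectation $\mathbb E$, with the same law as a generic pair $(a,b)$. For $x\in\mathbb R$, define $X_0=x$ and $X_{n+1}=a_{n+1}X_n+b_{n+1}$, $n\geq0$; $\mathbb P_x$ denotes the probability for the chain started at $X_0=x$. Set $S_0=0$, $S_n=\sum_{i=1}^nX_i$. For $y\in\mathbb R$, $\tau_y=\min\{k\geq1:\ y+S_k\leq0\}$. Under (i) or (ii), $\mathbb P_x(\tau_y>n)>0$ for all $n\geq1$, $x\in\mathbb R$, $y>0$. The constant $\sigma>0$ is given by $$\sigma^2=\frac{\mathbb E(b^2)}{1-\mathbb E(a^2)}\cdot\frac{1+\mathbb E(a)}{1-\mathbb E(a)}.$$ *)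

theory Defs
  imports "HOL-Probability.Probability"
begin

text \<open>
  The sequences \<open>A\<close>, \<open>B\<close> are the coefficients \<open>(a\<^sub>i, b\<^sub>i)\<close> with \<open>i \<ge> 1\<close>; their values at
  index \<open>0\<close> are never used. The starting point \<open>x\<close> is an explicit argument of the chain, so a
  probability under \<open>P\<^sub>x\<close> is the probability, on the space carrying the coefficients, of the
  event for the chain started at \<open>x\<close>.
\<close>

primrec affine_chain ::
  "(nat \<Rightarrow> 'w \<Rightarrow> real) \<Rightarrow> (nat \<Rightarrow> 'w \<Rightarrow> real) \<Rightarrow> real \<Rightarrow> nat \<Rightarrow> 'w \<Rightarrow> real" where
  "affine_chain A B x 0 w = x"
| "affine_chain A B x (Suc n) w = A (Suc n) w * affine_chain A B x n w + B (Suc n) w"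

definition affine_walk ::
  "(nat \<Rightarrow> 'w \<Rightarrow> real) \<Rightarrow> (nat \<Rightarrow> 'w \<Rightarrow> real) \<Rightarrow> real \<Rightarrow> nat \<Rightarrow> 'w \<Rightarrow> real" where
  "affine_walk A B x n w = (\<Sum>i=1..n. affine_chain A B x i w)"

text \<open>The infimum is taken in \<open>enat\<close>, so the exit time is \<open>\<infinity>\<close> if the walk never exits.\<close>

definition exit_time ::
  "(nat \<Rightarrow> 'w \<Rightarrow> real) \<Rightarrow> (nat \<Rightarrow> 'w \<Rightarrow> real) \<Rightarrow> real \<Rightarrow> real \<Rightarrow> 'w \<Rightarrow> enat" where
  "exit_time A B x y w = (INF k\<in>{k. 1 \<le> k \<and> y + affine_walk A B x k w \<le> 0}. enat k)"

definition iid_copies ::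
  "'w measure \<Rightarrow> ('w \<Rightarrow> real) \<Rightarrow> ('w \<Rightarrow> real) \<Rightarrow> (nat \<Rightarrow> 'w \<Rightarrow> real) \<Rightarrow> (nat \<Rightarrow> 'w \<Rightarrow> real) \<Rightarrow> bool" where
  "iid_copies M a b A B \<longleftrightarrow>
     prob_space.indep_vars M (\<lambda>_. borel) (\<lambda>i w. (A i w, B i w)) {1..} \<and>
     (\<forall>i\<ge>1. distr M borel (\<lambda>w. (A i w, B i w)) = distr M borel (\<lambda>w. (a w, b w)))"

text \<open>
  For centred \<open>b\<close> this is the limiting standard deviation of \<open>S\<^sub>n / sqrt n\<close>: the stationary variance
  \<open>E(b\<^sup>2) / (1 - E(a\<^sup>2))\<close> times \<open>1 + 2 (E(a) + E(a)\<^sup>2 + \<dots>) = (1 + E(a)) / (1 - E(a))\<close>.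
\<close>

definition affine_sigma :: "'w measure \<Rightarrow> ('w \<Rightarrow> real) \<Rightarrow> ('w \<Rightarrow> real) \<Rightarrow> real" where
  "affine_sigma M a b =
     sqrt ((\<integral>w. (b w)\<^sup>2 \<partial>M) / (1 - (\<integral>w. (a w)\<^sup>2 \<partial>M)) *
           ((1 + (\<integral>w. a w \<partial>M)) / (1 - (\<integral>w. a w \<partial>M))))"

definition K_set :: "real \<Rightarrow> real \<Rightarrow> (real \<times> real) set" where
  "K_set p c = {(x', y'). 0 < y' \<and> c * (1 + \<bar>x'\<bar> powr p) \<le> y'}"

definition rayleigh_cdf :: "real \<Rightarrow> real" where
  "rayleigh_cdf t = 1 - exp (- (t\<^sup>2) / 2)"

lemma exit_time_gt_iff:
  "enat n < exit_time A B x y w \<longleftrightarrow> (\<forall>k\<in>{1..n}. 0 < y + affine_walk A B x k w)"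
proof -
  have "enat n < exit_time A B x y w \<longleftrightarrow> enat (Suc n) \<le> exit_time A B x y w"
    by (simp add: Suc_ile_eq)
  also have "\<dots> \<longleftrightarrow> (\<forall>k. 1 \<le> k \<and> y + affine_walk A B x k w \<le> 0 \<longrightarrow> Suc n \<le> k)"
    unfolding exit_time_def le_INF_iff by simp
  also have "\<dots> \<longleftrightarrow> (\<forall>k\<in>{1..n}. 0 < y + affine_walk A B x k w)"
    by (metis atLeastAtMost_iff leD not_less not_less_eq_eq)
  finally show ?thesis .
qed

lemma prob_exit_time_gt_one:
  assumes "prob_space M" and "a \<in> borel_measurable M" and "b \<in> borel_measurable M"
    and iid: "iid_copies M a b A B"
  shows "\<P>(w in M. 1 < exit_time A B x y w) = \<P>(w in M. - y < a w * x + b w)"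
proof -
  interpret prob_space M by fact
  have AB: "(\<lambda>w. (A 1 w, B 1 w)) \<in> M \<rightarrow>\<^sub>M borel"
    using iid unfolding iid_copies_def indep_vars_def by auto
  have ab: "(\<lambda>w. (a w, b w)) \<in> M \<rightarrow>\<^sub>M borel"
    using assms by simp
  let ?E = "{p :: real \<times> real. - y < fst p * x + snd p}"
  have "open ?E" by (intro open_Collect_less continuous_intros)
  hence E: "?E \<in> sets borel" by simp
  have gt: "1 < exit_time A B x y w \<longleftrightarrow> - y < A 1 w * x + B 1 w" for w
    using exit_time_gt_iff[of 1 A B x y w] by (auto simp: one_enat_def affine_walk_def)
  have "\<P>(w in M. - y < A 1 w * x + B 1 w)
      = measure (distr M borel (\<lambda>w. (A 1 w, B 1 w))) ?E"
    by (subst measure_distr[OF AB E]) (auto intro!: arg_cong[where f = prob])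
  also have "\<dots> = measure (distr M borel (\<lambda>w. (a w, b w))) ?E"
    using iid by (simp add: iid_copies_def)
  also have "\<dots> = \<P>(w in M. - y < a w * x + b w)"
    by (subst measure_distr[OF ab E]) (auto intro!: arg_cong[where f = prob])
  finally show ?thesis by (simp only: gt)
qed

end

theory Submission
  imports Defs
begin

text \<open>
  Let \<open>Y\<^sub>n = y + S\<^sub>n\<close>, and let \<open>Z\<^sub>n = Y\<^sub>n + \<rho> X\<^sub>n\<close> with \<open>\<rho> = E a / (1 - E a)\<close>, a martingale. If \<open>u\<close> solves the
  heat equation on the line and is odd in space, then \<open>u (n - k) (Z\<^sub>k)\<close>, corrected by a multiple of
  \<open>\<partial>\<^sub>z\<^sub>z u\<close> that averages out the conditional variance of the increments, is almost a martingale. Killing it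
  at the exit time costs only \<open>E \<bar>u (n - \<tau>) (Z\<^sub>\<tau>)\<bar>\<close>, where \<open>Z\<^sub>\<tau>\<close> is at most of the order of the overshoot \<open>\<bar>X\<^sub>\<tau>\<bar>\<close>,
  and the approximation errors accumulate along surviving paths only.
  A bootstrap over dyadic times between \<open>P (\<tau> > n) \<le> C n\<^sup>-\<^sup>1\<^sup>/\<^sup>2 (1 + E (\<bar>X\<^sub>\<tau>\<bar>; \<tau> \<le> n))\<close> and
  \<open>E (\<bar>X\<^sub>\<tau>\<bar>; n < \<tau> \<le> 2 n) \<lesssim> n\<^sup>1\<^sup>/\<^sup>\<alpha> P (\<tau> > n)\<close> bounds both quantities. Expanding \<open>u\<close> at the origin then shows
  that \<open>sqrt n * E (f (Z\<^sub>n / (\<sigma> sqrt n)); \<tau> > n)\<close> tends to the slope at \<open>0\<close> of the heat evolution of \<open>f\<close> times the constant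
  \<open>V = z - E Z\<^sub>\<tau>\<close>. Smoothed indicators of half-lines, extended oddly, have slopes proportional to \<open>exp (- t\<^sup>2 / 2)\<close>, and the
  unknown constants cancel in the conditional probability. Either alternative hypothesis makes \<open>V\<close> positive: \<open>V\<close> is bounded
  below on \<open>{y \<ge> c (1 + x\<^sup>2)}\<close>, which is reached before exit with positive probability.
\<close>

section \<open>Real inequalities and Gaussian test functions\<close>

text \<open>Nothing about the decay of survival is known at the outset, so errors are carried as
  multiples of \<open>\<Sum>k<n. surv k x y\<close> and \<open>exit_abs n x y\<close>, the two
  unknowns of the bootstrap. Two choices let it close. The heat evolutions have their variance
  shifted by a multiple of h N, so that at every remaining time the i-th space derivative is
  O(N^(-i/2)) with constants uniform in the horizon N. A step then costs N^(-\<alpha>/2) on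
  survival, and once survival is of order k^(-1/2) the total N^((1-\<alpha>)/2) is o(N^(-1/2))
  because \<alpha> > 2. The same h measures the width of a window: ending in a window of relative
  width sqrt h costs at most a multiple of sqrt h times the probability of surviving half the time,
  up to errors, and for small h this is absorbed. The overshoot controls Z at exit because the walk
  was positive one step earlier: the exit position lies below the exit value of the walk, which is
  at most 0.\<close>

lemma powr_le_affine:
  fixes t :: real
  assumes "0 \<le> t" "0 < q" "q \<le> p"
  shows "t powr q \<le> (q / p) * t powr p + (1 - q / p)"
proof (cases "q = p")
  case False
  then have "q < p" using assms by simp
  define r where "r = p / q"
  have r: "r > 1" using assms \<open>q < p\<close> by (simp add: r_def)
  have "(t powr q) * 1 \<le> (t powr q) powr r / r + 1 powr (r / (r - 1)) / (r / (r - 1))"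
    by (rule Youngs_inequality) (use r in \<open>auto simp: field_simps\<close>)
  then show ?thesis using assms r
    by (simp add: powr_powr r_def field_simps)
qed (use assms in auto)

text \<open>The factor in front of \<open>s powr p\<close> can be brought arbitrarily close to 1,
  which keeps the moment of \<open>a\<close> a strict contraction once \<open>b\<close> is added.
  The threshold \<open>t \<le> d * s\<close> uses the \<open>d\<close> with (1 + d)^p = 1 +
  e.\<close>

lemma powr_add_le:
  fixes p e :: real
  assumes p: "p > 0" and e: "e > 0"
  shows "\<exists>C\<ge>0. \<forall>s\<ge>0. \<forall>t\<ge>0. (s + t) powr p \<le> (1 + e) * s powr p + C * t powr p"
proof -
  define d where "d = (1 + e) powr (1 / p) - 1"
  have d: "d > 0" using p e by (simp add: d_def)
  have dp: "(1 + d) powr p = 1 + e" using p e by (simp add: d_def powr_powr)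
  let ?C = "(1 + 1 / d) powr p"
  have "(s + t) powr p \<le> (1 + e) * s powr p + ?C * t powr p" if s: "0 \<le> s" and t: "0 \<le> t" for s t
  proof (cases "t \<le> d * s")
    case True
    have "(s + t) powr p \<le> ((1 + d) * s) powr p"
      using True s t p by (intro powr_mono2) (auto simp: algebra_simps)
    also have "\<dots> = (1 + e) * s powr p" using s d dp by (simp add: powr_mult)
    finally show ?thesis by (simp add: add_increasing2)
  next
    case False
    then have "s \<le> t / d" using d by (simp add: field_simps)
    then have "(s + t) powr p \<le> ((1 + 1 / d) * t) powr p"
      using s t p by (intro powr_mono2) (auto simp: algebra_simps)
    also have "\<dots> = ?C * t powr p" using t d by (simp add: powr_mult)
    finally show ?thesis using e by (simp add: add_increasing)
  qed
  then show ?thesis by (intro exI[of _ ?C]) auto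
qed

text \<open>Truncation at level \<open>l\<close>: below it the lower power \<open>r\<close>
  suffices, above it the excess is paid for by the highest power. The truncation levels chosen later
  enter through this inequality.\<close>

lemma powr_split_tail:
  fixes t :: real
  assumes "0 \<le> t" "0 < l" "q \<le> p" "0 \<le> r" "r \<le> q"
  shows "t powr q \<le> l powr (q - r) * t powr r + l powr (q - p) * t powr p"
proof (cases "t = 0")
  case False
  then have t: "t > 0" using assms by simp
  show ?thesis
  proof (cases "t \<le> l")
    case True
    have "t powr q = t powr (q - r) * t powr r" by (simp flip: powr_add)
    also have "\<dots> \<le> l powr (q - r) * t powr r"
      using True t assms by (intro mult_right_mono powr_mono2) auto
    finally show ?thesis by (simp add: add_increasing2)
  next
    case False
    have "t powr q = t powr (q - p) * t powr p" by (simp flip: powr_add)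
    also have "\<dots> \<le> l powr (q - p) * t powr p"
      using False t assms by (intro mult_right_mono powr_mono2') auto
    finally show ?thesis by (simp add: add_increasing)
  qed
qed auto

text \<open>Below 1 the higher integer power is the smaller one, above 1 the lower. This turns
  Taylor remainders of orders 2 and 3, and variations of orders 0 and 1, into the powers
  \<open>\<alpha>\<close> and \<open>\<alpha> - 2\<close>, for which moments are available.\<close>

lemma min_powr_interpolate:
  fixes t :: real
  assumes "0 \<le> t" "real k \<le> p" "p \<le> real k + 1" "k > 0 \<or> p > 0"
  shows "min (t ^ k) (t ^ Suc k) \<le> t powr p"
proof (cases "t = 0")
  case False
  then have t: "t > 0" using assms by simp
  show ?thesis
  proof (cases "t \<le> 1")
    case True
    have "t ^ Suc k = t powr (real (Suc k))" using t by (simp only: powr_realpow)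
    also have "\<dots> \<le> t powr p" using True t assms by (intro powr_mono') auto
    finally show ?thesis by linarith
  next
    case False
    have "t ^ k = t powr (real k)" using t by (simp only: powr_realpow)
    also have "\<dots> \<le> t powr p" using False t assms by (intro powr_mono) auto
    finally show ?thesis by linarith
  qed
qed (use assms in auto)

text \<open>Two estimates of the same remainder: the quadratic one is good for long increments, the
  cubic one for short ones. Keeping the minimum lets a moment of order between 2 and 3 control the
  expectation.\<close>

lemma Taylor_three_bound:
  fixes u0 u1 u2 u3 :: "real \<Rightarrow> real"
  assumes "\<And>z. (u0 has_real_derivative u1 z) (at z)" "\<And>z. (u1 has_real_derivative u2 z) (at z)"
    "\<And>z. (u2 has_real_derivative u3 z) (at z)"
    and "\<And>z. \<bar>u2 z\<bar> \<le> B2" "\<And>z. \<bar>u3 z\<bar> \<le> B3"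
  shows "\<bar>u0 (z + x) - u0 z - u1 z * x - u2 z / 2 * x\<^sup>2\<bar> \<le> min (B2 * x\<^sup>2) (B3 * \<bar>x\<bar> ^ 3)"
    and "\<bar>u2 (z + x) - u2 z\<bar> \<le> min (2 * B2) (B3 * \<bar>x\<bar>)"
proof -
  \<comment> \<open>The derivatives are packed into one function of the order, the form in which
    \<open>Maclaurin_bi_le\<close> takes them.\<close>
  define dv where "dv = (\<lambda>m t. [u0 (z + t), u1 (z + t), u2 (z + t), u3 (z + t)] ! m)"
  have dv: "DERIV (dv m) t :> dv (Suc m) t" if "m < 3" for m t
  proof -
    have shift: "((\<lambda>t. f (z + t)) has_real_derivative d) (at t)"
      if "(f has_real_derivative d) (at (z + t))" for f d
      using that DERIV_shift[of f d t z] by (simp add: add.commute)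
    from \<open>m < 3\<close> consider "m = 0" | "m = 1" | "m = 2" by linarith
    then show ?thesis
      by cases (auto simp: dv_def numeral_2_eq_2 intro!: shift assms)
  qed
  have B2: "B2 \<ge> 0" and B3: "B3 \<ge> 0"
    using assms(4)[of 0] assms(5)[of 0] abs_ge_zero order_trans by blast+
  obtain t where "u0 (z + x) = (\<Sum>m<3. dv m 0 / fact m * x ^ m) + dv 3 t / fact 3 * x ^ 3"
    using Maclaurin_bi_le[of dv "\<lambda>t. u0 (z + t)" 3 x] dv by (auto simp: dv_def)
  then have 3: "u0 (z + x) - u0 z - u1 z * x - u2 z / 2 * x\<^sup>2 = u3 (z + t) / 6 * x ^ 3"
    by (simp add: dv_def eval_nat_numeral)
  \<comment> \<open>Expanding to order two and subtracting the exact quadratic term leaves half a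
    difference of second derivatives, hence at most \<open>B2\<close>.\<close>
  obtain t' where "u0 (z + x) = (\<Sum>m<2. dv m 0 / fact m * x ^ m) + dv 2 t' / fact 2 * x ^ 2"
    using Maclaurin_bi_le[of dv "\<lambda>t. u0 (z + t)" 2 x] dv by (auto simp: dv_def)
  then have 2: "u0 (z + x) - u0 z - u1 z * x - u2 z / 2 * x\<^sup>2 = (u2 (z + t') - u2 z) / 2 * x\<^sup>2"
    by (simp add: dv_def eval_nat_numeral field_simps)
  have "\<bar>(u2 (z + t') - u2 z) / 2\<bar> \<le> B2"
    using assms(4)[of "z + t'"] assms(4)[of z] unfolding abs_le_iff by (simp add: field_simps)
  then have "\<bar>(u2 (z + t') - u2 z) / 2\<bar> * x\<^sup>2 \<le> B2 * x\<^sup>2" by (intro mult_right_mono) auto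
  then have A: "\<bar>u0 (z + x) - u0 z - u1 z * x - u2 z / 2 * x\<^sup>2\<bar> \<le> B2 * x\<^sup>2"
    unfolding 2 by (simp add: abs_mult)
  have "\<bar>u3 (z + t) / 6\<bar> \<le> B3" using assms(5)[of "z + t"] B3 by linarith
  then have "\<bar>u3 (z + t) / 6\<bar> * \<bar>x\<bar> ^ 3 \<le> B3 * \<bar>x\<bar> ^ 3" by (intro mult_right_mono) auto
  then have "\<bar>u0 (z + x) - u0 z - u1 z * x - u2 z / 2 * x\<^sup>2\<bar> \<le> B3 * \<bar>x\<bar> ^ 3"
    unfolding 3 by (simp only: abs_mult power_abs)
  with A show "\<bar>u0 (z + x) - u0 z - u1 z * x - u2 z / 2 * x\<^sup>2\<bar> \<le> min (B2 * x\<^sup>2) (B3 * \<bar>x\<bar> ^ 3)" by simp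
  have "\<bar>u2 (z + x) - u2 z\<bar> \<le> B3 * \<bar>x\<bar>"
    using field_differentiable_bound[of UNIV u2 u3 B3 "z + x" z] assms(3,5) by (simp add: has_field_derivative_at_within)
  moreover have "\<bar>u2 (z + x) - u2 z\<bar> \<le> 2 * B2" using assms(4)[of "z + x"] assms(4)[of z] by linarith
  ultimately show "\<bar>u2 (z + x) - u2 z\<bar> \<le> min (2 * B2) (B3 * \<bar>x\<bar>)" by simp
qed

section \<open>The unnormalised error function and its derivatives\<close>

definition gauss_prim :: "real \<Rightarrow> real" where
  "gauss_prim t = (LBINT x=0..t. exp (- x\<^sup>2 / 2))"

lemma gauss_prim_deriv: "(gauss_prim has_real_derivative exp (- t\<^sup>2 / 2)) (at t)"
proof -
  let ?a = "- \<bar>t\<bar> - 1" and ?b = "\<bar>t\<bar> + 1"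
  have "((\<lambda>u. LBINT x=0..u. exp (- x\<^sup>2 / 2)) has_vector_derivative exp (- t\<^sup>2 / 2)) (at t within {?a..?b})"
    unfolding zero_ereal_def by (rule interval_integral_FTC2) (auto intro!: continuous_intros)
  then have "(gauss_prim has_real_derivative exp (- t\<^sup>2 / 2)) (at t within {?a..?b})"
    by (simp add: has_real_derivative_iff_has_vector_derivative gauss_prim_def[abs_def])
  then show ?thesis
    by (subst (asm) at_within_interior) (auto simp: interior_atLeastAtMost_real)
qed

lemma gauss_prim_0 [simp]: "gauss_prim 0 = 0"
  by (simp add: gauss_prim_def zero_ereal_def)

lemma gauss_prim_minus: "gauss_prim (- t) = - gauss_prim t"
proof -
  have "((\<lambda>t. gauss_prim t + gauss_prim (- t)) has_real_derivative 0) (at x)" for x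
    by (rule derivative_eq_intros DERIV_chain'[OF _ gauss_prim_deriv] gauss_prim_deriv refl | simp)+
  then have "gauss_prim t + gauss_prim (- t) = gauss_prim 0 + gauss_prim (- 0)"
    by (intro DERIV_isconst_all) auto
  then show ?thesis by simp
qed

lemma gauss_prim_mono: "s \<le> t \<Longrightarrow> gauss_prim s \<le> gauss_prim t"
  by (rule DERIV_nonneg_imp_nondecreasing) (auto intro!: gauss_prim_deriv)

lemma gauss_prim_less: "s < t \<Longrightarrow> gauss_prim s < gauss_prim t"
  by (rule DERIV_pos_imp_increasing) (auto intro!: gauss_prim_deriv)

text \<open>Comparison with \<open>2 * arctan\<close>: the inequality exp s \<ge> 1 + s bounds the
  Gaussian derivative by 2 / (1 + x^2).\<close>

lemma gauss_prim_bounded: "gauss_prim t \<le> pi"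
proof (cases "t \<ge> 0")
  case True
  have "gauss_prim t - 2 * arctan t \<le> gauss_prim 0 - 2 * arctan 0"
  proof (rule DERIV_nonpos_imp_nonincreasing[OF True])
    fix x :: real
    have "1 + x\<^sup>2 / 2 \<le> exp (x\<^sup>2 / 2)" by (rule exp_ge_add_one_self)
    then have "exp (- x\<^sup>2 / 2) \<le> 1 / (1 + x\<^sup>2 / 2)" by (simp add: exp_minus field_simps add_pos_nonneg)
    also have "\<dots> \<le> 2 / (1 + x\<^sup>2)" by (simp add: field_simps add_pos_nonneg)
    finally have "exp (- x\<^sup>2 / 2) - 2 / (1 + x\<^sup>2) \<le> 0" by simp
    moreover have "((\<lambda>x. gauss_prim x - 2 * arctan x) has_real_derivative exp (- x\<^sup>2 / 2) - 2 / (1 + x\<^sup>2)) (at x)"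
      by (rule derivative_eq_intros gauss_prim_deriv refl | simp add: field_simps)+
    ultimately show "\<exists>y. ((\<lambda>x. gauss_prim x - 2 * arctan x) has_real_derivative y) (at x) \<and> y \<le> 0" by blast
  qed
  then show ?thesis using arctan_ubound[of t] by simp
next
  case False
  then have "gauss_prim t \<le> 0" using gauss_prim_mono[of t 0] by simp
  then show ?thesis using pi_gt_zero by linarith
qed

text \<open>The number sqrt (pi / 2), carried as a symbol: it normalises the smoothed indicators and
  cancels in the conditional probability.\<close>

definition gauss_sup :: real where "gauss_sup = (SUP t. gauss_prim t)"

lemma gauss_prim_le_sup: "gauss_prim t \<le> gauss_sup"
  unfolding gauss_sup_def by (rule cSUP_upper) (auto intro!: bdd_aboveI2[where M=pi] gauss_prim_bounded)

lemma gauss_sup_pos: "gauss_sup > 0"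
  using gauss_prim_le_sup[of 1] gauss_prim_less[of 0 1] by simp

lemma abs_gauss_prim_le_sup: "\<bar>gauss_prim t\<bar> \<le> gauss_sup"
  using gauss_prim_le_sup[of t] gauss_prim_le_sup[of "-t"] by (simp add: gauss_prim_minus abs_le_iff)

lemma gauss_prim_tendsto: "(gauss_prim \<longlongrightarrow> gauss_sup) at_top"
proof (rule order_tendstoI)
  fix a assume "a < gauss_sup"
  then obtain T where "a < gauss_prim T" unfolding gauss_sup_def
    by (subst (asm) less_cSUP_iff) (auto intro!: bdd_aboveI2[where M=pi] gauss_prim_bounded)
  then show "eventually (\<lambda>t. a < gauss_prim t) at_top"
    using less_le_trans[OF _ gauss_prim_mono] by (intro eventually_mono[OF eventually_ge_at_top[of T]]) blast
next
  fix a assume "gauss_sup < a"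
  then show "eventually (\<lambda>t. gauss_prim t < a) at_top"
    using gauss_prim_le_sup by (intro always_eventually) (meson le_less_trans)
qed

text \<open>
  The derivatives of \<^const>\<open>gauss_prim\<close>, given by the Hermite recurrence so that
  \<open>v powr (- j / 2) * gauss_der j (z / sqrt v)\<close> solves the heat equation.
\<close>

fun gauss_der :: "nat \<Rightarrow> real \<Rightarrow> real" where
  "gauss_der 0 t = gauss_prim t"
| "gauss_der (Suc 0) t = exp (- t\<^sup>2 / 2)"
| "gauss_der (Suc (Suc j)) t = - real j * gauss_der j t - t * gauss_der (Suc j) t"

text \<open>The recurrence is the identity g'' = - t g' of the Gaussian primitive, differentiated
  \<open>j\<close> times, so the claim passes from two consecutive orders to the next.\<close>

lemma gauss_der_deriv: "(gauss_der j has_real_derivative gauss_der (Suc j) t) (at t)"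
proof (induction j arbitrary: t rule: induct_nat_012)
  case 0
  have "gauss_der 0 = gauss_prim" by (simp add: fun_eq_iff)
  then show ?case using gauss_prim_deriv[of t] by simp
next
  case 1
  have "((\<lambda>t. exp (- t\<^sup>2 / 2)) has_real_derivative - t * exp (- t\<^sup>2 / 2)) (at t)"
    by (rule derivative_eq_intros refl | simp add: field_simps)+
  moreover have "gauss_der 1 = (\<lambda>t. exp (- t\<^sup>2 / 2))" by (simp add: fun_eq_iff)
  ultimately show ?case by simp
next
  case (ge2 n)
  have "((\<lambda>t. - real n * gauss_der n t - t * gauss_der (Suc n) t) has_real_derivative
      - real n * gauss_der (Suc n) t - (gauss_der (Suc n) t + t * gauss_der (Suc (Suc n)) t)) (at t)"
    by (rule derivative_eq_intros ge2 refl | simp)+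
  then show ?case by (simp add: fun_eq_iff algebra_simps)
qed

text \<open>A single term of the exponential series, of degree \<open>m\<close> in t^2 / 2, already
  beats the power t^(2 m), and |t|^m is at most 1 + t^(2 m).\<close>

lemma power_exp_bounded: "\<bar>t\<bar> ^ m * exp (- t\<^sup>2 / 2) \<le> 1 + 2 ^ m * fact m" for t :: real
proof -
  have e1: "exp (- t\<^sup>2 / 2) \<le> 1" by simp
  have "(t\<^sup>2 / 2) ^ m / fact m \<le> exp (t\<^sup>2 / 2)"
  proof -
    have "(t\<^sup>2 / 2) ^ m / fact m \<le> (\<Sum>n<Suc m. (t\<^sup>2 / 2) ^ n / fact n)"
      by (subst sum.lessThan_Suc) (auto intro!: sum_nonneg)
    also have "\<dots> \<le> exp (t\<^sup>2 / 2)" 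

    proof -
      have "(\<Sum>n<Suc m. (t\<^sup>2 / 2) ^ n /\<^sub>R fact n) \<le> (\<Sum>n. (t\<^sup>2 / 2) ^ n /\<^sub>R fact n)"
        by (rule sum_le_suminf[OF summable_exp_generic]) auto
      moreover have "(t\<^sup>2 / 2) ^ n /\<^sub>R fact n = (t\<^sup>2 / 2) ^ n / fact n" for n
        by (simp only: real_scaleR_def divide_inverse mult.commute)
      ultimately show ?thesis unfolding exp_def by simp
    qed
    finally show ?thesis .
  qed
  then have "(t\<^sup>2) ^ m * exp (- t\<^sup>2 / 2) \<le> 2 ^ m * fact m"
    by (simp add: exp_minus field_simps)
  moreover have "\<bar>t\<bar> ^ m \<le> 1 + (t\<^sup>2) ^ m"
  proof (cases "\<bar>t\<bar> \<le> 1")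
    case True
    then show ?thesis using power_le_one[of "\<bar>t\<bar>" m] by (simp add: add_increasing2)
  next
    case False
    then have "\<bar>t\<bar> ^ m \<le> \<bar>t\<bar> ^ (2 * m)" by (intro power_increasing) auto
    then show ?thesis by (simp add: power_mult)
  qed
  then have "\<bar>t\<bar> ^ m * exp (- t\<^sup>2 / 2) \<le> (1 + (t\<^sup>2) ^ m) * exp (- t\<^sup>2 / 2)"
    by (intro mult_right_mono) auto
  ultimately show ?thesis using e1 unfolding distrib_right mult_1 by linarith
qed

text \<open>The aim is boundedness of the derivatives, but the recurrence multiplies by
  \<open>t\<close>; the induction therefore carries an arbitrary power \<open>m\<close> and calls
  \<open>Suc m\<close> one order below.\<close>

lemma gauss_der_power_bounded: "\<exists>C. \<forall>t. \<bar>t\<bar> ^ m * \<bar>gauss_der (Suc j) t\<bar> \<le> C"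
proof (induction j arbitrary: m rule: induct_nat_012)
  case 0
  then show ?case using power_exp_bounded by auto
next
  case 1
  then show ?case using power_exp_bounded[of _ "Suc m"]
    by (auto simp: abs_mult intro!: exI[of _ "1 + 2 ^ Suc m * fact (Suc m)"])
      (metis (no_types, opaque_lifting) ab_semigroup_mult_class.mult_ac(1) mult.commute)
next
  case (ge2 n)
  obtain C1 where C1: "\<And>t. \<bar>t\<bar> ^ m * \<bar>gauss_der (Suc n) t\<bar> \<le> C1" using ge2(1) by blast
  obtain C2 where C2: "\<And>t. \<bar>t\<bar> ^ Suc m * \<bar>gauss_der (Suc (Suc n)) t\<bar> \<le> C2" using ge2(2) by blast
  have "\<bar>t\<bar> ^ m * \<bar>gauss_der (Suc (Suc (Suc n))) t\<bar> \<le> real (Suc n) * C1 + C2" for t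
  proof -
    have "\<bar>gauss_der (Suc (Suc (Suc n))) t\<bar> \<le>
        real (Suc n) * \<bar>gauss_der (Suc n) t\<bar> + \<bar>t\<bar> * \<bar>gauss_der (Suc (Suc n)) t\<bar>"
      unfolding gauss_der.simps(3)[of "Suc n"]
      by (rule order_trans[OF abs_triangle_ineq4]) (simp only: abs_mult abs_minus_cancel abs_of_nat order_refl)
    then have "\<bar>t\<bar> ^ m * \<bar>gauss_der (Suc (Suc (Suc n))) t\<bar> \<le>
        \<bar>t\<bar> ^ m * (real (Suc n) * \<bar>gauss_der (Suc n) t\<bar> + \<bar>t\<bar> * \<bar>gauss_der (Suc (Suc n)) t\<bar>)"
      by (rule mult_left_mono) simp
    also have "\<dots> = real (Suc n) * (\<bar>t\<bar> ^ m * \<bar>gauss_der (Suc n) t\<bar>) + \<bar>t\<bar> ^ Suc m * \<bar>gauss_der (Suc (Suc n)) t\<bar>"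
      by (simp only: algebra_simps power_Suc)
    also have "\<dots> \<le> real (Suc n) * C1 + C2"
      by (intro add_mono mult_left_mono C1 C2) auto
    finally show ?thesis .
  qed
  then show ?case by blast
qed

lemma gauss_der_bounded: "\<exists>C. \<forall>t. \<bar>gauss_der j t\<bar> \<le> C"
proof (cases j)
  case 0
  then show ?thesis using abs_gauss_prim_le_sup by auto
next
  case (Suc i)
  then show ?thesis using gauss_der_power_bounded[of 0 i] by simp
qed

section \<open>Heat kernels and heat families with uniform bounds\<close>

definition heat_kernel :: "nat \<Rightarrow> real \<Rightarrow> real \<Rightarrow> real" where
  "heat_kernel j v z = v powr (- (real j / 2)) * gauss_der j (z / sqrt v)"

lemma heat_kernel_deriv:
  assumes "v > 0"
  shows "((\<lambda>z. heat_kernel j v (z - c)) has_real_derivative heat_kernel (Suc j) v (z - c)) (at z)"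
proof -
  have "((\<lambda>z. gauss_der j ((z - c) / sqrt v)) has_real_derivative gauss_der (Suc j) ((z - c) / sqrt v) * (1 / sqrt v)) (at z)"
    using assms by (intro DERIV_chain2[OF gauss_der_deriv]) (auto intro!: derivative_eq_intros simp: field_simps)
  then have "((\<lambda>z. heat_kernel j v (z - c)) has_real_derivative
      v powr (- (real j / 2)) * (gauss_der (Suc j) ((z - c) / sqrt v) * (1 / sqrt v))) (at z)"
    unfolding heat_kernel_def by (rule DERIV_cmult)
  moreover have "v powr (- (real (Suc j) / 2)) = v powr (- (real j / 2)) * (1 / sqrt v)"
    using assms by (simp add: powr_half_sqrt[symmetric] powr_minus_divide[symmetric] powr_add[symmetric] add_divide_distrib algebra_simps del: powr_minus)
  ultimately show ?thesis by (simp add: heat_kernel_def algebra_simps)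
qed

text \<open>With \<open>v\<close> as variance this is the heat equation with coefficient 1/2, and it
  reduces to the recurrence of \<open>gauss_der\<close>. For \<open>j = 0\<close> the kernel is an
  error function of width sqrt v, for \<open>j = 1\<close> it is sqrt (2 pi) times the normal
  density of variance \<open>v\<close>.\<close>

lemma heat_kernel_deriv_time:
  assumes "v > 0"
  shows "((\<lambda>v. heat_kernel j v z) has_real_derivative heat_kernel (Suc (Suc j)) v z / 2) (at v)"
proof -
  have s: "((\<lambda>v. z / sqrt v) has_real_derivative - (z / sqrt v) / (2 * v)) (at v)"
    using assms by (auto intro!: derivative_eq_intros simp: field_simps power2_eq_square)
  have "((\<lambda>v. gauss_der j (z / sqrt v)) has_real_derivative gauss_der (Suc j) (z / sqrt v) * (- (z / sqrt v) / (2 * v))) (at v)"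
    by (rule DERIV_chain2[OF gauss_der_deriv s])
  moreover have "((\<lambda>v. v powr (- (real j / 2))) has_real_derivative - (real j / 2) * v powr (- (real j / 2) - 1)) (at v)"
    using assms by (rule has_real_derivative_powr)
  note DERIV_mult[OF this calculation]
  then have "((\<lambda>v. heat_kernel j v z) has_real_derivative
      (- (real j / 2) * v powr (- (real j / 2) - 1)) * gauss_der j (z / sqrt v)
      + (gauss_der (Suc j) (z / sqrt v) * (- (z / sqrt v) / (2 * v))) * v powr (- (real j / 2))) (at v)"
    unfolding heat_kernel_def .
  moreover have "v powr (- (real j / 2)) = v * v powr (- (real j / 2) - 1)"
    using assms by (simp add: powr_diff)
  moreover have "- (real (Suc (Suc j)) / 2) = - (real j / 2) - 1" by (simp add: field_simps)
  then have "v powr (- (real (Suc (Suc j)) / 2)) = v powr (- (real j / 2) - 1)" by (rule arg_cong)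
  ultimately show ?thesis using assms by (simp add: heat_kernel_def field_simps)
qed

text \<open>In \<open>u i s z\<close> the arguments are the order of the space derivative, the
  remaining time and the position. The conditions describe a solution of the discrete-time heat
  equation with variance \<open>v\<close> per step, up to N^(-2), as smooth as a profile of width
  sqrt N. Separating \<open>D\<close> from \<open>N\<close> keeps later constants uniform in the
  horizon.\<close>

definition heat_family :: "real \<Rightarrow> real \<Rightarrow> real \<Rightarrow> (nat \<Rightarrow> nat \<Rightarrow> real \<Rightarrow> real) \<Rightarrow> bool" where
  "heat_family v N D u \<longleftrightarrow>
     (\<forall>i<3. \<forall>s z. (u i s has_real_derivative u (Suc i) s z) (at z)) \<and>
     (\<forall>i\<le>3. \<forall>s z. \<bar>u i s z\<bar> \<le> D * N powr (- (real i / 2))) \<and>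
     (\<forall>s z. \<bar>u 0 (Suc s) z - u 0 s z - v / 2 * u 2 s z\<bar> \<le> D * N powr (- 2)) \<and>
     (\<forall>s z. \<bar>u 2 (Suc s) z - u 2 s z\<bar> \<le> D * N powr (- 2))"

lemma heat_family_add:
  assumes "heat_family v N D u" "heat_family v N D u'"
  shows "heat_family v N (2 * D) (\<lambda>i s z. u i s z + u' i s z)"
  unfolding heat_family_def
proof (intro conjI allI impI)
  fix i s z
  show "((\<lambda>z. u i s z + u' i s z) has_real_derivative u (Suc i) s z + u' (Suc i) s z) (at z)" if "i < 3"
    using assms that by (intro DERIV_add) (auto simp: heat_family_def)
  show "\<bar>u i s z + u' i s z\<bar> \<le> 2 * D * N powr (- (real i / 2))" if "i \<le> 3"
  proof -
    have "\<bar>u i s z\<bar> \<le> D * N powr (- (real i / 2))" "\<bar>u' i s z\<bar> \<le> D * N powr (- (real i / 2))"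
      using assms that by (auto simp: heat_family_def)
    then show ?thesis by linarith
  qed
next
  fix s z
  have "\<bar>u 0 (Suc s) z - u 0 s z - v / 2 * u 2 s z\<bar> \<le> D * N powr (- 2)"
    "\<bar>u' 0 (Suc s) z - u' 0 s z - v / 2 * u' 2 s z\<bar> \<le> D * N powr (- 2)"
    using assms by (auto simp: heat_family_def)
  then show "\<bar>u 0 (Suc s) z + u' 0 (Suc s) z - (u 0 s z + u' 0 s z) - v / 2 * (u 2 s z + u' 2 s z)\<bar> \<le> 2 * D * N powr (- 2)"
    unfolding distrib_left by linarith
  have "\<bar>u 2 (Suc s) z - u 2 s z\<bar> \<le> D * N powr (- 2)" "\<bar>u' 2 (Suc s) z - u' 2 s z\<bar> \<le> D * N powr (- 2)"
    using assms by (auto simp: heat_family_def)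
  then show "\<bar>u 2 (Suc s) z + u' 2 (Suc s) z - (u 2 s z + u' 2 s z)\<bar> \<le> 2 * D * N powr (- 2)"
    by linarith
qed

lemma heat_kernel_bound:
  assumes "c > 0" "N > 0" "V \<ge> c * N" "\<And>t. \<bar>gauss_der (j + i) t\<bar> \<le> C"
  shows "\<bar>N powr (real j / 2) * heat_kernel (j + i) V z\<bar> \<le> c powr (- (real (j + i) / 2)) * C * N powr (- (real i / 2))"
proof -
  have C: "C \<ge> 0" using assms(4)[of 0] by linarith
  have "\<bar>N powr (real j / 2) * heat_kernel (j + i) V z\<bar> \<le> N powr (real j / 2) * ((c * N) powr (- (real (j + i) / 2)) * C)"
    unfolding heat_kernel_def abs_mult abs_of_nonneg[OF powr_ge_zero]
    using assms C by (intro mult_left_mono mult_mono powr_mono2') auto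
  also have "\<dots> = c powr (- (real (j + i) / 2)) * C * N powr (real j / 2 - real (j + i) / 2)"
  proof -
    have "N powr (real j / 2 - real (j + i) / 2) = N powr (real j / 2) * N powr (- (real (j + i) / 2))"
      by (simp only: powr_add[symmetric] add_uminus_conv_diff)
    moreover have "(c * N) powr (- (real (j + i) / 2)) = c powr (- (real (j + i) / 2)) * N powr (- (real (j + i) / 2))"
      using assms(1,2) by (intro powr_mult)
    ultimately show ?thesis by (simp only: mult_ac)
  qed
  also have "real j / 2 - real (j + i) / 2 = - (real i / 2)"
    by (simp add: field_simps)
  finally show ?thesis .
qed

text \<open>The shift \<open>h * N\<close> keeps the variance above \<open>v * h * N\<close> even at
  remaining time 0, so the kernel is never singular; the prefactor N^(j/2) normalises it to size 1.
  One constant serves all \<open>N\<close> and all centres \<open>c\<close>.\<close>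

lemma heat_family_heat_kernel:
  assumes "v > 0" "h > 0"
  obtains D where "D \<ge> 0"
    "\<And>N c. N \<ge> 1 \<Longrightarrow> heat_family v N D (\<lambda>i s z. N powr (real j / 2) * heat_kernel (j + i) (v * (real s + h * N)) (z - c))"
proof -
  obtain C where C: "\<And>k t. \<bar>gauss_der k t\<bar> \<le> C k" using gauss_der_bounded by metis
  have C0: "C k \<ge> 0" for k using C[of k 0] by linarith
  \<comment> \<open>Orders up to 4 occur: the error of a time step is a second time derivative,
    hence a fourth space derivative.\<close>
  define E where "E = (\<Sum>i\<le>4. (v * h) powr (- (real (j + i) / 2)) * C (j + i))"
  \<comment> \<open>The factor dominates the three multiples of \<open>E\<close> that arise: 1, v /
    2 and v^2 / 4.\<close>
  define D where "D = E * (1 + v + v\<^sup>2)"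
  have E0: "E \<ge> 0" unfolding E_def by (intro sum_nonneg mult_nonneg_nonneg C0) auto
  have ED: "E \<le> D" "v / 2 * E \<le> D" "v\<^sup>2 / 4 * E \<le> D"
    using E0 assms(1) unfolding D_def by (auto simp: algebra_simps intro!: add_nonneg_nonneg mult_nonneg_nonneg)
  have "heat_family v N D (\<lambda>i s z. N powr (real j / 2) * heat_kernel (j + i) (v * (real s + h * N)) (z - c))"
    if N: "N \<ge> 1" for N c
  proof -
    have B: "\<bar>N powr (real j / 2) * heat_kernel (j + i) V z\<bar> \<le> E * N powr (- (real i / 2))"
      if "i \<le> 4" "V \<ge> v * h * N" for i V z
    proof -
      have "(v * h) powr (- (real (j + i) / 2)) * C (j + i) \<le> E"
        unfolding E_def using that C0 by (intro member_le_sum) auto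
      then show ?thesis
        using heat_kernel_bound[of "v * h" N V j i "C (j + i)" z] assms N that C
        by (meson mult_right_mono order_trans powr_ge_zero mult_pos_pos less_le_trans zero_less_one)
    qed
    have V: "v * h * N \<le> v * (real s + h * N)" "0 < v * (real s + h * N)" for s
      using assms N by (auto simp: algebra_simps intro!: add_nonneg_pos)
    have T: "\<exists>V'\<ge>V. V' \<le> V + v \<and> N powr (real j / 2) * heat_kernel k (V + v) z - N powr (real j / 2) * heat_kernel k V z
        = v / 2 * (N powr (real j / 2) * heat_kernel (Suc (Suc k)) V' z)" if "V > 0" for V k z
    proof -
      have "\<exists>V'. V < V' \<and> V' < V + v \<and> heat_kernel k (V + v) z - heat_kernel k V z = (V + v - V) * (heat_kernel (Suc (Suc k)) V' z / 2)"
        using assms that by (intro MVT2 heat_kernel_deriv_time) auto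
      then obtain V' where "V < V'" "V' < V + v" "heat_kernel k (V + v) z - heat_kernel k V z = v * (heat_kernel (Suc (Suc k)) V' z / 2)"
        by auto
      then show ?thesis
        by (intro exI[of _ V'] conjI, linarith, linarith) (simp only: right_diff_distrib[symmetric], simp)
    qed
    have T2: "\<bar>N powr (real j / 2) * heat_kernel (j + 2) V' z - N powr (real j / 2) * heat_kernel (j + 2) V z\<bar>
        \<le> (V' - V) / 2 * (E * N powr (- 2))" if "v * h * N \<le> V" "V \<le> V'" for V V' z
    proof (cases "V = V'")
      case False
      have Vp: "V > 0" using that assms N by (smt (verit) mult_pos_pos)
      have "\<exists>W. V < W \<and> W < V' \<and> heat_kernel (j + 2) V' z - heat_kernel (j + 2) V z = (V' - V) * (heat_kernel (Suc (Suc (j + 2))) W z / 2)"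
        using that Vp False by (intro MVT2 heat_kernel_deriv_time) auto
      then obtain W where W: "V < W" "heat_kernel (j + 2) V' z - heat_kernel (j + 2) V z = (V' - V) * (heat_kernel (j + 4) W z / 2)"
        by (auto simp: numeral_eq_Suc)
      have "\<bar>N powr (real j / 2) * heat_kernel (j + 2) V' z - N powr (real j / 2) * heat_kernel (j + 2) V z\<bar>
          = \<bar>(V' - V) / 2 * (N powr (real j / 2) * heat_kernel (j + 4) W z)\<bar>"
        unfolding right_diff_distrib[symmetric] W(2) by (simp add: algebra_simps)
      also have "\<dots> = (V' - V) / 2 * \<bar>N powr (real j / 2) * heat_kernel (j + 4) W z\<bar>"
        using that(2) unfolding abs_mult[of "(V' - V) / 2"] by simp
      also have "\<dots> \<le> (V' - V) / 2 * (E * N powr (- 2))"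
        using B[of 4 W z] that W(1) by (intro mult_left_mono) auto
      finally show ?thesis .
    qed auto
    show ?thesis unfolding heat_family_def
    proof (intro conjI allI impI)
      fix i s z
      show "((\<lambda>z. N powr (real j / 2) * heat_kernel (j + i) (v * (real s + h * N)) (z - c)) has_real_derivative
          N powr (real j / 2) * heat_kernel (j + Suc i) (v * (real s + h * N)) (z - c)) (at z)"
        using heat_kernel_deriv[OF V(2), of "j + i" s c z] by (intro DERIV_cmult) simp
      show "\<bar>N powr (real j / 2) * heat_kernel (j + i) (v * (real s + h * N)) (z - c)\<bar> \<le> D * N powr (- (real i / 2))" if "i \<le> 3"
        using order_trans[OF B[OF _ V(1), of i s "z - c"] mult_right_mono[OF ED(1) powr_ge_zero]] that by simp
    next
      fix s z
      let ?V = "v * (real s + h * N)" and ?z = "z - c"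
      have S: "v * (real (Suc s) + h * N) = ?V + v" by (simp add: algebra_simps)
      obtain V' where V': "V' \<ge> ?V" "V' \<le> ?V + v" "N powr (real j / 2) * heat_kernel j (?V + v) ?z - N powr (real j / 2) * heat_kernel j ?V ?z
        = v / 2 * (N powr (real j / 2) * heat_kernel (j + 2) V' ?z)"
        using T[OF V(2), of s j ?z] by auto
      have "\<bar>v / 2 * (N powr (real j / 2) * heat_kernel (j + 2) V' ?z) - v / 2 * (N powr (real j / 2) * heat_kernel (j + 2) ?V ?z)\<bar>
          = v / 2 * \<bar>N powr (real j / 2) * heat_kernel (j + 2) V' ?z - N powr (real j / 2) * heat_kernel (j + 2) ?V ?z\<bar>"
        using assms(1) unfolding right_diff_distrib[symmetric, of "v / 2"] abs_mult[of "v / 2"] by simp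
      also have "\<dots> \<le> v / 2 * (v / 2 * (E * N powr (- 2)))"
      proof (rule mult_left_mono)
        have "(V' - ?V) / 2 * (E * N powr (- 2)) \<le> v / 2 * (E * N powr (- 2))"
          using V' E0 by (intro mult_right_mono) auto
        then show "\<bar>N powr (real j / 2) * heat_kernel (j + 2) V' ?z - N powr (real j / 2) * heat_kernel (j + 2) ?V ?z\<bar> \<le> v / 2 * (E * N powr (- 2))"
          using T2[OF V(1) V'(1), of ?z] by linarith
      qed (use assms in auto)
      also have "\<dots> = v\<^sup>2 / 4 * E * N powr (- 2)" by (simp add: power2_eq_square)
      also have "\<dots> \<le> D * N powr (- 2)" by (intro mult_right_mono ED) auto
      finally show "\<bar>N powr (real j / 2) * heat_kernel (j + 0) (v * (real (Suc s) + h * N)) (z - c)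
          - N powr (real j / 2) * heat_kernel (j + 0) ?V (z - c)
          - v / 2 * (N powr (real j / 2) * heat_kernel (j + 2) ?V (z - c))\<bar> \<le> D * N powr (- 2)"
        using V'(3) unfolding S by simp
      have "\<bar>N powr (real j / 2) * heat_kernel (j + 2) (v * (real (Suc s) + h * N)) (z - c) -
          N powr (real j / 2) * heat_kernel (j + 2) ?V (z - c)\<bar> \<le> (?V + v - ?V) / 2 * (E * N powr (- 2))"
        unfolding S using assms by (intro T2 V) auto
      also have "\<dots> \<le> D * N powr (- 2)"
        using mult_right_mono[OF ED(2), of "N powr (- 2)"] by simp
      finally show "\<bar>N powr (real j / 2) * heat_kernel (j + 2) (v * (real (Suc s) + h * N)) (z - c) -
          N powr (real j / 2) * heat_kernel (j + 2) ?V (z - c)\<bar> \<le> D * N powr (- 2)" .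
    qed
  qed
  moreover have "D \<ge> 0" using ED(1) E0 by linarith
  ultimately show ?thesis using that by blast
qed

text \<open>Each term is at most twice the increment of the square root, so the sum
  telescopes.\<close>

lemma sum_inverse_sqrt_le: "(\<Sum>k=1..<n. real k powr (- (1 / 2))) \<le> 2 * sqrt (real n)"
proof -
  have "(\<Sum>k=1..<Suc n. real k powr (- (1 / 2))) \<le> 2 * sqrt (real n)" for n
  proof (induction n)
    case (Suc n)
    let ?u = "sqrt (real n)" and ?v = "sqrt (real (Suc n))"
    have uv: "0 \<le> ?u" "?u \<le> ?v" "0 < ?v" "?v * ?v - ?u * ?u = 1" by auto
    have "1 = (?v - ?u) * (?v + ?u)" using uv(4) by (simp only: square_diff_square_factored mult.commute)
    also have "\<dots> \<le> (?v - ?u) * (2 * ?v)" using uv by (intro mult_left_mono) auto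
    finally have "1 / ?v \<le> 2 * (?v - ?u)" using uv(3) by (simp only: pos_divide_le_eq mult_ac)
    moreover have "real (Suc n) powr (- (1 / 2)) = 1 / ?v"
      by (simp only: powr_minus_divide powr_half_sqrt of_nat_0_le_iff)
    ultimately show ?case using Suc.IH by (subst sum.atLeastLessThan_Suc) auto
  qed simp
  from this[of "n - 1"] show ?thesis
    by (cases n) (auto intro: order_trans)
qed

text \<open>The two profiles centred at \<open>c\<close> and \<open>- c\<close> add up to the odd
  extension in \<open>Z\<close> of a smoothed step at \<open>c\<close>. At distance more than
  \<open>e\<close> from the centre, a step of width e^2 has reached its limit up to its deficit at 1
  / e. For positive \<open>c\<close>, the condition 2 e \<le> c together with Y > 0 keeps
  \<open>Z\<close> away from the step at \<open>- c\<close>.\<close>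

lemma indicator_gauss_prim:
  fixes Y Z c e :: real
  assumes e: "0 < e" and c: "0 \<le> c" "c = 0 \<or> 2 * e \<le> c" and YZ: "\<bar>Z - Y\<bar> \<le> e / 2" "e < \<bar>Z - c\<bar>" and Y: "0 < Y"
  shows "\<bar>of_bool (c < Y) - (gauss_prim ((Z - c) / e\<^sup>2) + gauss_prim ((Z + c) / e\<^sup>2)) / (2 * gauss_sup)\<bar>
    \<le> 1 - gauss_prim (1 / e) / gauss_sup"
proof -
  have big: "gauss_prim (1 / e) \<le> gauss_prim (t / e\<^sup>2)" if "e \<le> t" for t
  proof (rule gauss_prim_mono)
    have "e / e\<^sup>2 \<le> t / e\<^sup>2" using that by (intro divide_right_mono) auto
    then show "1 / e \<le> t / e\<^sup>2" using e by (simp add: power2_eq_square)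
  qed
  let ?s = gauss_sup and ?g = "gauss_prim (1 / e)"
  have s: "?s > 0" by (rule gauss_sup_pos)
  show ?thesis
  proof (cases "Z > c")
    case True
    then have "c + e < Z" using YZ by auto
    then have Yc: "c < Y" using YZ e unfolding abs_le_iff by linarith
    let ?a = "gauss_prim ((Z - c) / e\<^sup>2)" and ?b = "gauss_prim ((Z + c) / e\<^sup>2)"
    have ab: "?g \<le> ?a" "?g \<le> ?b" using \<open>c + e < Z\<close> c e by (auto intro!: big)
    have "?a \<le> ?s" "?b \<le> ?s" by (rule gauss_prim_le_sup)+
    with ab have "\<bar>2 * ?s - (?a + ?b)\<bar> \<le> 2 * ?s - 2 * ?g" by linarith
    then have "\<bar>2 * ?s - (?a + ?b)\<bar> / (2 * ?s) \<le> (2 * ?s - 2 * ?g) / (2 * ?s)" using s by (intro divide_right_mono) auto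
    moreover have "\<bar>2 * ?s - (?a + ?b)\<bar> / (2 * ?s) = \<bar>1 - (?a + ?b) / (2 * ?s)\<bar>"
    proof -
      have "1 - (?a + ?b) / (2 * ?s) = (2 * ?s - (?a + ?b)) / (2 * ?s)" using s by (simp add: diff_divide_distrib)
      then show ?thesis using s by (simp only: abs_divide abs_of_pos)
    qed
    ultimately show ?thesis using Yc s by (simp add: diff_divide_distrib)
  next
    case False
    then have Z: "Z < c - e" using YZ by auto
    then have Yc: "\<not> c < Y" using YZ e unfolding abs_le_iff by linarith
    \<comment> \<open>For \<open>c = 0\<close> this case cannot occur: \<open>Z\<close> is within e
      / 2 of the positive \<open>Y\<close>, hence not below - e.\<close>
    have c2: "2 * e \<le> c"
    proof (rule ccontr)
      assume "\<not> ?thesis"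
      then have "c = 0" using c by simp
      then show False using Z YZ Y e unfolding abs_le_iff by linarith
    qed
    have m: "gauss_prim ((Z - c) / e\<^sup>2) = - gauss_prim ((c - Z) / e\<^sup>2)"
      unfolding gauss_prim_minus[symmetric] by (simp add: minus_divide_left)
    let ?a = "gauss_prim ((c - Z) / e\<^sup>2)" and ?b = "gauss_prim ((Z + c) / e\<^sup>2)"
    have zc: "e \<le> Z + c" using YZ Y c2 e unfolding abs_le_iff by linarith
    have ab: "?g \<le> ?a" "?g \<le> ?b" using Z zc by (auto intro!: big)
    have "?a \<le> ?s" "?b \<le> ?s" by (rule gauss_prim_le_sup)+
    with ab have "\<bar>?b - ?a\<bar> \<le> ?s - ?g" by linarith
    then have "\<bar>?b - ?a\<bar> / (2 * ?s) \<le> (?s - ?g) / (2 * ?s)" using s by (intro divide_right_mono) auto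
    also have "\<dots> \<le> (?s - ?g) / ?s" using s gauss_prim_le_sup[of "1 / e"] by (intro divide_left_mono) auto
    finally have "\<bar>(?b - ?a) / (2 * ?s)\<bar> \<le> 1 - ?g / ?s"
      using s by (simp only: abs_divide abs_of_pos mult_pos_pos zero_less_numeral diff_divide_distrib[of ?s] divide_self less_imp_neq[symmetric] not_False_eq_True)
    moreover have "of_bool (c < Y) - (- ?a + ?b) / (2 * ?s) = - ((?b - ?a) / (2 * ?s))" using Yc by simp
    ultimately show ?thesis unfolding m by (simp only: abs_minus_cancel)
  qed
qed

lemma gauss_prim_ratio_bound:
  "\<bar>of_bool P - (gauss_prim s + gauss_prim t) / (2 * gauss_sup)\<bar> \<le> 2"
proof -
  have "\<bar>gauss_prim s + gauss_prim t\<bar> \<le> 2 * gauss_sup"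
    using abs_gauss_prim_le_sup[of s] abs_gauss_prim_le_sup[of t] by linarith
  then have "\<bar>(gauss_prim s + gauss_prim t) / (2 * gauss_sup)\<bar> \<le> 1"
    using gauss_sup_pos by (simp add: abs_divide divide_le_eq)
  moreover have "\<bar>of_bool P - r\<bar> \<le> 2" if "\<bar>r\<bar> \<le> 1" for r :: real
    using that by (auto simp: of_bool_def abs_le_iff)
  ultimately show ?thesis by blast
qed

lemma powr_le_one_plus_power:
  fixes t :: real
  assumes "0 \<le> t" "0 < p" "p \<le> real k"
  shows "t powr p \<le> 1 + t ^ k"
proof (cases "t \<le> 1")
  case True
  then have "t powr p \<le> 1 powr p" using assms by (intro powr_mono2) auto
  then show ?thesis using assms by (simp add: add_increasing2)
next
  case False
  then have "t powr p \<le> t powr real k" using assms by (intro powr_mono) auto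
  then show ?thesis using False by (simp add: powr_realpow)
qed

section \<open>Locality and measurability of the chain and the walk\<close>

lemma affine_walk_0 [simp]: "affine_walk A B x 0 w = 0"
  by (simp add: affine_walk_def)

lemma affine_walk_Suc: "affine_walk A B x (Suc n) w = affine_walk A B x n w + affine_chain A B x (Suc n) w"
  by (simp add: affine_walk_def)

text \<open>The primed coefficients may live on another sample space, which allows the chain to be
  read as a function of the coordinates of a product space.\<close>

lemma affine_chain_cong:
  assumes "\<And>i. 1 \<le> i \<Longrightarrow> i \<le> n \<Longrightarrow> A i w = A' i w'" "\<And>i. 1 \<le> i \<Longrightarrow> i \<le> n \<Longrightarrow> B i w = B' i w'"
  shows "affine_chain A B x n w = affine_chain A' B' x n w'"
  using assms by (induction n) auto

lemma affine_walk_cong: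
  assumes "\<And>i. 1 \<le> i \<Longrightarrow> i \<le> n \<Longrightarrow> A i w = A' i w'" "\<And>i. 1 \<le> i \<Longrightarrow> i \<le> n \<Longrightarrow> B i w = B' i w'"
  shows "affine_walk A B x n w = affine_walk A' B' x n w'"
  unfolding affine_walk_def using assms by (intro sum.cong affine_chain_cong) auto

lemma affine_chain_measurable:
  assumes "\<And>i. 1 \<le> i \<Longrightarrow> i \<le> n \<Longrightarrow> A i \<in> borel_measurable N" "\<And>i. 1 \<le> i \<Longrightarrow> i \<le> n \<Longrightarrow> B i \<in> borel_measurable N"
  shows "affine_chain A B x n \<in> borel_measurable N"
  using assms
proof (induction n)
  case (Suc n)
  have "affine_chain A B x n \<in> borel_measurable N" using Suc by simp
  moreover have "A (Suc n) \<in> borel_measurable N" "B (Suc n) \<in> borel_measurable N" using Suc.prems by auto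
  ultimately show ?case by (simp add: affine_chain.simps(2)[abs_def])
qed (simp add: affine_chain.simps(1)[abs_def])

lemma affine_walk_measurable:
  assumes "\<And>i. 1 \<le> i \<Longrightarrow> i \<le> n \<Longrightarrow> A i \<in> borel_measurable N" "\<And>i. 1 \<le> i \<Longrightarrow> i \<le> n \<Longrightarrow> B i \<in> borel_measurable N"
  shows "affine_walk A B x n \<in> borel_measurable N"
  unfolding affine_walk_def[abs_def] using assms by (intro borel_measurable_sum affine_chain_measurable) auto

lemma fst_measurable_borel: "fst \<in> borel_measurable (borel :: (real \<times> real) measure)"
  by (intro borel_measurable_continuous_onI continuous_intros)

lemma snd_measurable_borel: "snd \<in> borel_measurable (borel :: (real \<times> real) measure)"
  by (intro borel_measurable_continuous_onI continuous_intros)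

section \<open>The killed transition operator\<close>

text \<open>The exponent is confined to (2, 3] so that it lies between the orders of the quadratic
  and the cubic Taylor remainder; the theorem enters with the minimum of its own exponent and 3.
  Only the law of the generic pair is fixed; the sequences \<open>A\<close>, \<open>B\<close> come
  in at the end.\<close>

locale affine_law = prob_space M for M :: "'w measure" +
  fixes a b :: "'w \<Rightarrow> real" and \<alpha> :: real
  assumes a_measurable [measurable]: "a \<in> borel_measurable M"
    and b_measurable [measurable]: "b \<in> borel_measurable M"
    and \<alpha>_gt: "2 < \<alpha>" and \<alpha>_le: "\<alpha> \<le> 3"
    and integrable_a: "integrable M (\<lambda>w. \<bar>a w\<bar> powr \<alpha>)"
    and moment_a: "(\<integral>w. \<bar>a w\<bar> powr \<alpha> \<partial>M) < 1"
    and integrable_b: "integrable M (\<lambda>w. \<bar>b w\<bar> powr \<alpha>)"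
    and b_nonzero: "\<P>(w in M. b w \<noteq> 0) > 0"
    and mean_b: "(\<integral>w. b w \<partial>M) = 0"
begin

text \<open>A growth class that is stable under one step of the chain and contains everything that
  is averaged later: |x|^\<alpha>, x^2, the martingale and bounded functions. It serves as the one
  side condition for integrability.\<close>

definition adm :: "(real \<Rightarrow> real \<Rightarrow> real) \<Rightarrow> bool" where
  "adm f \<longleftrightarrow> case_prod f \<in> borel_measurable (borel \<Otimes>\<^sub>M borel) \<and>
    (\<exists>C. \<forall>x y. \<bar>f x y\<bar> \<le> C * (1 + \<bar>x\<bar> powr \<alpha> + \<bar>y\<bar>))"

definition transit :: "(real \<Rightarrow> real \<Rightarrow> real) \<Rightarrow> real \<Rightarrow> real \<Rightarrow> real" where
  "transit f x y = (\<integral>w. f (a w * x + b w) (y + (a w * x + b w)) \<partial>M)"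

definition killed :: "(real \<Rightarrow> real \<Rightarrow> real) \<Rightarrow> real \<Rightarrow> real \<Rightarrow> real" where
  "killed f = transit (\<lambda>x y. if 0 < y then f x y else 0)"

text \<open>Placed under \<open>mean k\<close>, it yields the expectation of \<open>f\<close> at the
  exit time on the event that the exit time equals k + 1.\<close>

definition exiting :: "(real \<Rightarrow> real \<Rightarrow> real) \<Rightarrow> real \<Rightarrow> real \<Rightarrow> real" where
  "exiting f = transit (\<lambda>x y. if 0 < y then 0 else f x y)"

text \<open>
  \<open>mean n f x y\<close> is the expectation of \<open>f (X\<^sub>n) (y + S\<^sub>n)\<close> on \<open>{\<tau>\<^sub>y > n}\<close> for the chain started
  at \<open>x\<close>; see \<open>expectation_alive\<close> below.
\<close>

definition mean :: "nat \<Rightarrow> (real \<Rightarrow> real \<Rightarrow> real) \<Rightarrow> real \<Rightarrow> real \<Rightarrow> real" where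
  "mean n f = (killed ^^ n) f"

section \<open>Closure properties of the admissible class\<close>

lemma \<alpha>_pos: "0 < \<alpha>" using \<alpha>_gt by linarith

lemma adm_measurable:
  assumes "adm f" "g \<in> borel_measurable N" "h \<in> borel_measurable N"
  shows "(\<lambda>w. f (g w) (h w)) \<in> borel_measurable N"
proof -
  have "case_prod f \<in> borel_measurable (borel \<Otimes>\<^sub>M borel)" using assms(1) by (simp add: adm_def)
  from measurable_compose[OF measurable_Pair[OF assms(2,3)] this] show ?thesis by simp
qed

lemma admI:
  assumes "case_prod f \<in> borel_measurable (borel \<Otimes>\<^sub>M borel)" "\<And>x y. \<bar>f x y\<bar> \<le> C * (1 + \<bar>x\<bar> powr \<alpha> + \<bar>y\<bar>)"
  shows "adm f"
  using assms unfolding adm_def by blast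

lemma adm_bound:
  assumes "adm f"
  shows "\<exists>C\<ge>0. \<forall>x y. \<bar>f x y\<bar> \<le> C * (1 + \<bar>x\<bar> powr \<alpha> + \<bar>y\<bar>)"
proof -
  obtain C where C: "\<And>x y. \<bar>f x y\<bar> \<le> C * (1 + \<bar>x\<bar> powr \<alpha> + \<bar>y\<bar>)" using assms unfolding adm_def by blast
  have "C \<ge> 0" using C[of 0 0] \<alpha>_gt by simp
  then show ?thesis using C by blast
qed

lemma adm_dominated:
  assumes "adm g" "case_prod f \<in> borel_measurable (borel \<Otimes>\<^sub>M borel)" "\<And>x y. \<bar>f x y\<bar> \<le> \<bar>g x y\<bar>"
  shows "adm f"
proof -
  obtain C where "C \<ge> 0" "\<And>x y. \<bar>g x y\<bar> \<le> C * (1 + \<bar>x\<bar> powr \<alpha> + \<bar>y\<bar>)" using adm_bound[OF assms(1)] by blast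
  with assms(3) have "\<bar>f x y\<bar> \<le> C * (1 + \<bar>x\<bar> powr \<alpha> + \<bar>y\<bar>)" for x y by (meson order_trans)
  with assms(2) show ?thesis by (rule admI)
qed

lemma adm_add:
  assumes "adm f" "adm g" shows "adm (\<lambda>x y. f x y + g x y)"
proof -
  obtain C where C: "C \<ge> 0" "\<And>x y. \<bar>f x y\<bar> \<le> C * (1 + \<bar>x\<bar> powr \<alpha> + \<bar>y\<bar>)" using adm_bound[OF assms(1)] by blast
  obtain D where D: "D \<ge> 0" "\<And>x y. \<bar>g x y\<bar> \<le> D * (1 + \<bar>x\<bar> powr \<alpha> + \<bar>y\<bar>)" using adm_bound[OF assms(2)] by blast
  have "\<bar>f x y + g x y\<bar> \<le> (C + D) * (1 + \<bar>x\<bar> powr \<alpha> + \<bar>y\<bar>)" for x y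
    using C(2)[of x y] D(2)[of x y] unfolding distrib_right[of C D] by linarith
  moreover have "case_prod (\<lambda>x y. f x y + g x y) \<in> borel_measurable (borel \<Otimes>\<^sub>M borel)"
    unfolding case_prod_unfold by (intro borel_measurable_add adm_measurable[OF assms(1)] adm_measurable[OF assms(2)]) auto
  ultimately show ?thesis by (rule admI[rotated])
qed

lemma adm_cmult:
  assumes "adm f" shows "adm (\<lambda>x y. c * f x y)"
proof -
  obtain C where C: "C \<ge> 0" "\<And>x y. \<bar>f x y\<bar> \<le> C * (1 + \<bar>x\<bar> powr \<alpha> + \<bar>y\<bar>)" using adm_bound[OF assms(1)] by blast
  have "\<bar>c * f x y\<bar> \<le> (\<bar>c\<bar> * C) * (1 + \<bar>x\<bar> powr \<alpha> + \<bar>y\<bar>)" for x y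
    using mult_left_mono[OF C(2)[of x y], of "\<bar>c\<bar>"] by (simp add: abs_mult mult.assoc)
  moreover have "case_prod (\<lambda>x y. c * f x y) \<in> borel_measurable (borel \<Otimes>\<^sub>M borel)"
    unfolding case_prod_unfold by (intro borel_measurable_times borel_measurable_const adm_measurable[OF assms]) auto
  ultimately show ?thesis by (rule admI[rotated])
qed

lemma adm_diff: "adm f \<Longrightarrow> adm g \<Longrightarrow> adm (\<lambda>x y. f x y - g x y)"
  using adm_add[of f "\<lambda>x y. (- 1) * g x y"] adm_cmult[of g "-1"] by simp

lemma adm_if:
  assumes "adm f" "adm g" shows "adm (\<lambda>x y. if 0 < y then f x y else g x y)"
proof -
  obtain C where C: "C \<ge> 0" "\<And>x y. \<bar>f x y\<bar> \<le> C * (1 + \<bar>x\<bar> powr \<alpha> + \<bar>y\<bar>)" using adm_bound[OF assms(1)] by blast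
  obtain D where D: "D \<ge> 0" "\<And>x y. \<bar>g x y\<bar> \<le> D * (1 + \<bar>x\<bar> powr \<alpha> + \<bar>y\<bar>)" using adm_bound[OF assms(2)] by blast
  have "\<bar>if 0 < y then f x y else g x y\<bar> \<le> (C + D) * (1 + \<bar>x\<bar> powr \<alpha> + \<bar>y\<bar>)" for x y
    using C(2)[of x y] D(2)[of x y] abs_ge_zero[of "f x y"] abs_ge_zero[of "g x y"]
    unfolding distrib_right[of C D] by (auto simp del: abs_ge_zero)
  moreover have "case_prod (\<lambda>x y. if 0 < y then f x y else g x y) \<in> borel_measurable (borel \<Otimes>\<^sub>M borel)"
    unfolding case_prod_unfold by (intro measurable_If adm_measurable[OF assms(1)] adm_measurable[OF assms(2)]) auto
  ultimately show ?thesis by (rule admI[rotated])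
qed

lemma adm_const: "adm (\<lambda>x y. c)"
  by (rule admI[of _ "\<bar>c\<bar>"]) (auto simp: mult_le_cancel_left1)

lemma adm_powr: "adm (\<lambda>x y. \<bar>x\<bar> powr \<alpha>)"
  by (rule admI[of _ 1]) (auto simp: case_prod_unfold)

lemma adm_snd: "adm (\<lambda>x y. y)"
  by (rule admI[of _ 1]) (auto simp: case_prod_unfold)

lemma abs_power_le: "k \<le> 2 \<Longrightarrow> \<bar>x\<bar> ^ k \<le> 1 + \<bar>x\<bar> powr \<alpha>" for x :: real
proof (cases "\<bar>x\<bar> \<le> 1")
  case True
  then have "\<bar>x\<bar> ^ k \<le> 1" by (simp add: power_le_one)
  then show ?thesis by (simp add: add_increasing2)
next
  case False
  assume "k \<le> 2"
  then have "\<bar>x\<bar> powr real k \<le> \<bar>x\<bar> powr \<alpha>" using False \<alpha>_gt by (intro powr_mono) auto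
  then show ?thesis using False by (simp add: powr_realpow)
qed

lemma adm_abs_power: "k \<le> 2 \<Longrightarrow> adm (\<lambda>x y. \<bar>x\<bar> ^ k)"
  by (rule admI[of _ 1], (simp add: case_prod_unfold), insert abs_power_le[of k], simp add: add_increasing2)

lemma adm_abs: "adm (\<lambda>x y. \<bar>x\<bar>)" using adm_abs_power[of 1] by simp

lemma adm_square: "adm (\<lambda>x y. x\<^sup>2)" using adm_abs_power[of 2] by simp

lemma adm_fst: "adm (\<lambda>x y. x)"
  by (rule adm_dominated[OF adm_abs]) (auto simp: case_prod_unfold)

lemma adm_absval: "adm f \<Longrightarrow> adm (\<lambda>x y. \<bar>f x y\<bar>)"
proof (rule adm_dominated[of f])
  assume "adm f"
  then show "case_prod (\<lambda>x y. \<bar>f x y\<bar>) \<in> borel_measurable (borel \<Otimes>\<^sub>M borel)"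
    unfolding case_prod_unfold by (intro borel_measurable_abs adm_measurable[of f]) auto
qed auto

lemma adm_bounded:
  "case_prod f \<in> borel_measurable (borel \<Otimes>\<^sub>M borel) \<Longrightarrow> (\<And>x y. \<bar>f x y\<bar> \<le> B) \<Longrightarrow> adm f"
  by (rule adm_dominated[OF adm_const[of B]]) (assumption, meson abs_ge_self order_trans)

lemma adm_linear: "adm (\<lambda>x y. y + c * x)"
  by (intro adm_add adm_snd adm_cmult adm_fst)

lemma integrable_step_powr: "integrable M (\<lambda>w. \<bar>a w * x + b w\<bar> powr \<alpha>)"
proof -
  obtain C where C: "C \<ge> 0" "\<And>s t. 0 \<le> s \<Longrightarrow> 0 \<le> t \<Longrightarrow> (s + t) powr \<alpha> \<le> (1 + 1) * s powr \<alpha> + C * t powr \<alpha>"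
    using powr_add_le[OF \<alpha>_pos zero_less_one] by blast
  show ?thesis
  proof (rule Bochner_Integration.integrable_bound)
    show "integrable M (\<lambda>w. 2 * (\<bar>x\<bar> powr \<alpha> * \<bar>a w\<bar> powr \<alpha>) + C * \<bar>b w\<bar> powr \<alpha>)"
      using integrable_a integrable_b by simp
    show "AE w in M. norm (\<bar>a w * x + b w\<bar> powr \<alpha>) \<le> norm (2 * (\<bar>x\<bar> powr \<alpha> * \<bar>a w\<bar> powr \<alpha>) + C * \<bar>b w\<bar> powr \<alpha>)"
    proof (rule AE_I2)
      fix w
      have "\<bar>a w * x + b w\<bar> powr \<alpha> \<le> (\<bar>a w\<bar> * \<bar>x\<bar> + \<bar>b w\<bar>) powr \<alpha>"
        using \<alpha>_gt by (intro powr_mono2) (auto simp: abs_mult[symmetric])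
      also have "\<dots> \<le> 2 * (\<bar>x\<bar> powr \<alpha> * \<bar>a w\<bar> powr \<alpha>) + C * \<bar>b w\<bar> powr \<alpha>"
        using C(2)[of "\<bar>a w\<bar> * \<bar>x\<bar>" "\<bar>b w\<bar>"] by (simp add: powr_mult mult.commute)
      finally show "norm (\<bar>a w * x + b w\<bar> powr \<alpha>) \<le> norm (2 * (\<bar>x\<bar> powr \<alpha> * \<bar>a w\<bar> powr \<alpha>) + C * \<bar>b w\<bar> powr \<alpha>)"
        using C(1) by simp
    qed
  qed simp
qed

text \<open>A drift condition for |x|^\<alpha>: the moment assumption on \<open>a\<close> gives the
  factor below 1, and the contribution of \<open>b\<close> goes into the constant.\<close>

lemma contraction:
  "\<exists>r C. 0 \<le> r \<and> r < 1 \<and> 0 \<le> C \<and>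
    (\<forall>x. (\<integral>w. \<bar>a w * x + b w\<bar> powr \<alpha> \<partial>M) \<le> r * \<bar>x\<bar> powr \<alpha> + C)"
proof -
  define m where "m = (\<integral>w. \<bar>a w\<bar> powr \<alpha> \<partial>M)"
  have m: "0 \<le> m" "m < 1" using moment_a by (auto simp: m_def intro!: integral_nonneg_AE)
  \<comment> \<open>With this choice 1 - (1 + e) m = (1 - m) (1 - m / 2), which is positive.\<close>
  define e where "e = (1 - m) / 2"
  have e: "e > 0" "(1 + e) * m < 1"
  proof -
    have "1 - (1 + e) * m = (1 - m) * (1 - m / 2)" by (simp add: e_def field_simps)
    moreover have "\<dots> > 0" using m by (intro mult_pos_pos) auto
    ultimately have "(1 + e) * m < 1" by linarith
    then show "e > 0" "(1 + e) * m < 1" using m by (auto simp: e_def)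
  qed
  obtain C where C: "C \<ge> 0" "\<And>s t. 0 \<le> s \<Longrightarrow> 0 \<le> t \<Longrightarrow> (s + t) powr \<alpha> \<le> (1 + e) * s powr \<alpha> + C * t powr \<alpha>"
    using powr_add_le[OF \<alpha>_pos e(1)] by blast
  have "(\<integral>w. \<bar>a w * x + b w\<bar> powr \<alpha> \<partial>M) \<le> (1 + e) * m * \<bar>x\<bar> powr \<alpha> + C * (\<integral>w. \<bar>b w\<bar> powr \<alpha> \<partial>M)" for x
  proof -
    have "(\<integral>w. \<bar>a w * x + b w\<bar> powr \<alpha> \<partial>M) \<le> (\<integral>w. (1 + e) * \<bar>x\<bar> powr \<alpha> * \<bar>a w\<bar> powr \<alpha> + C * \<bar>b w\<bar> powr \<alpha> \<partial>M)"
    proof (rule integral_mono[OF integrable_step_powr])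
      show "integrable M (\<lambda>w. (1 + e) * \<bar>x\<bar> powr \<alpha> * \<bar>a w\<bar> powr \<alpha> + C * \<bar>b w\<bar> powr \<alpha>)"
        using integrable_a integrable_b by (intro Bochner_Integration.integrable_add integrable_mult_right) auto
      fix w
      have "\<bar>a w * x + b w\<bar> powr \<alpha> \<le> (\<bar>a w\<bar> * \<bar>x\<bar> + \<bar>b w\<bar>) powr \<alpha>"
        using \<alpha>_gt by (intro powr_mono2) (auto simp: abs_mult[symmetric])
      also have "\<dots> \<le> (1 + e) * \<bar>x\<bar> powr \<alpha> * \<bar>a w\<bar> powr \<alpha> + C * \<bar>b w\<bar> powr \<alpha>"
        using C(2)[of "\<bar>a w\<bar> * \<bar>x\<bar>" "\<bar>b w\<bar>"] by (simp add: powr_mult mult_ac)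
      finally show "\<bar>a w * x + b w\<bar> powr \<alpha> \<le> (1 + e) * \<bar>x\<bar> powr \<alpha> * \<bar>a w\<bar> powr \<alpha> + C * \<bar>b w\<bar> powr \<alpha>" .
    qed
    also have "\<dots> = (1 + e) * \<bar>x\<bar> powr \<alpha> * m + C * (\<integral>w. \<bar>b w\<bar> powr \<alpha> \<partial>M)"
      using integrable_a integrable_b by (simp add: m_def)
    finally show ?thesis by (simp add: mult_ac)
  qed
  then show ?thesis using m e C
    by (intro exI[of _ "(1 + e) * m"] exI[of _ "C * (\<integral>w. \<bar>b w\<bar> powr \<alpha> \<partial>M)"])
      (auto intro!: mult_nonneg_nonneg integral_nonneg_AE)
qed

lemma integrable_step:
  assumes "adm f"
  shows "integrable M (\<lambda>w. f (a w * x + b w) (y + (a w * x + b w)))"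
proof -
  obtain C where C: "C \<ge> 0" "\<And>x y. \<bar>f x y\<bar> \<le> C * (1 + \<bar>x\<bar> powr \<alpha> + \<bar>y\<bar>)" using adm_bound[OF assms] by blast
  show ?thesis
  proof (rule Bochner_Integration.integrable_bound)
    show "integrable M (\<lambda>w. C * (2 + \<bar>y\<bar> + 2 * \<bar>a w * x + b w\<bar> powr \<alpha>))"
      using integrable_step_powr[of x] by simp
    show "AE w in M. norm (f (a w * x + b w) (y + (a w * x + b w))) \<le> norm (C * (2 + \<bar>y\<bar> + 2 * \<bar>a w * x + b w\<bar> powr \<alpha>))"
    proof (rule AE_I2)
      fix w
      let ?x = "a w * x + b w"
      have "\<bar>f ?x (y + ?x)\<bar> \<le> C * (1 + \<bar>?x\<bar> powr \<alpha> + \<bar>y + ?x\<bar>)" by (rule C)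
      also have "\<dots> \<le> C * (2 + \<bar>y\<bar> + 2 * \<bar>?x\<bar> powr \<alpha>)"
        using abs_power_le[of 1 ?x] abs_triangle_ineq[of y ?x] by (intro mult_left_mono C) auto
      finally show "norm (f ?x (y + ?x)) \<le> norm (C * (2 + \<bar>y\<bar> + 2 * \<bar>?x\<bar> powr \<alpha>))"
        using C(1) by (simp add: abs_mult)
    qed
  qed (intro adm_measurable[OF assms]; simp)
qed

text \<open>The drift bound controls the part |x|^\<alpha> of the growth, and the new value of the
  walk adds at most the new position, itself below 1 plus its \<alpha>-th power.\<close>

lemma adm_transit:
  assumes "adm f" shows "adm (transit f)"
proof -
  obtain r C where rC: "0 \<le> r" "r < 1" "C \<ge> 0" "\<And>x. (\<integral>w. \<bar>a w * x + b w\<bar> powr \<alpha> \<partial>M) \<le> r * \<bar>x\<bar> powr \<alpha> + C"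
    using contraction by blast
  obtain D where D: "D \<ge> 0" "\<And>x y. \<bar>f x y\<bar> \<le> D * (1 + \<bar>x\<bar> powr \<alpha> + \<bar>y\<bar>)" using adm_bound[OF assms] by blast
  have "\<bar>transit f x y\<bar> \<le> D * (2 + 2 * C) * (1 + \<bar>x\<bar> powr \<alpha> + \<bar>y\<bar>)" for x y
  proof -
    have "\<bar>transit f x y\<bar> \<le> (\<integral>w. \<bar>f (a w * x + b w) (y + (a w * x + b w))\<bar> \<partial>M)"
      unfolding transit_def by (rule integral_abs_bound)
    also have "\<dots> \<le> (\<integral>w. D * (2 + \<bar>y\<bar> + 2 * \<bar>a w * x + b w\<bar> powr \<alpha>) \<partial>M)"
    proof (rule integral_mono)
      show "integrable M (\<lambda>w. \<bar>f (a w * x + b w) (y + (a w * x + b w))\<bar>)"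
        using integrable_step[OF adm_absval[OF assms]] .
      show "integrable M (\<lambda>w. D * (2 + \<bar>y\<bar> + 2 * \<bar>a w * x + b w\<bar> powr \<alpha>))"
        using integrable_step_powr[of x] by simp
      fix w
      let ?x = "a w * x + b w"
      have "\<bar>f ?x (y + ?x)\<bar> \<le> D * (1 + \<bar>?x\<bar> powr \<alpha> + \<bar>y + ?x\<bar>)" by (rule D)
      also have "\<dots> \<le> D * (2 + \<bar>y\<bar> + 2 * \<bar>?x\<bar> powr \<alpha>)"
        using abs_power_le[of 1 ?x] abs_triangle_ineq[of y ?x] by (intro mult_left_mono D) auto
      finally show "\<bar>f ?x (y + ?x)\<bar> \<le> D * (2 + \<bar>y\<bar> + 2 * \<bar>?x\<bar> powr \<alpha>)" .
    qed
    also have "\<dots> = D * (2 + \<bar>y\<bar> + 2 * (\<integral>w. \<bar>a w * x + b w\<bar> powr \<alpha> \<partial>M))"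
      using integrable_step_powr[of x] by (simp add: prob_space)
    also have "\<dots> \<le> D * ((2 + 2 * C) * (1 + \<bar>x\<bar> powr \<alpha> + \<bar>y\<bar>))"
    proof (rule mult_left_mono[OF _ D(1)])
      have "r * \<bar>x\<bar> powr \<alpha> \<le> 1 * \<bar>x\<bar> powr \<alpha>" using rC by (intro mult_right_mono) auto
      moreover have "0 \<le> C * \<bar>x\<bar> powr \<alpha>" "0 \<le> C * \<bar>y\<bar>" using rC by auto
      ultimately show "2 + \<bar>y\<bar> + 2 * (\<integral>w. \<bar>a w * x + b w\<bar> powr \<alpha> \<partial>M) \<le> (2 + 2 * C) * (1 + \<bar>x\<bar> powr \<alpha> + \<bar>y\<bar>)"
        using rC(4)[of x] by (simp add: algebra_simps)
    qed
    finally show ?thesis by (simp only: mult.assoc)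
  qed
  moreover have "case_prod (transit f) \<in> borel_measurable (borel \<Otimes>\<^sub>M borel)"
    unfolding transit_def case_prod_unfold
    by (intro borel_measurable_lebesgue_integral, unfold case_prod_unfold, intro adm_measurable[OF assms]) measurable
  ultimately show ?thesis by (rule admI[rotated])
qed

lemma adm_killed: "adm f \<Longrightarrow> adm (killed f)"
  unfolding killed_def by (intro adm_transit adm_if adm_const)

lemma adm_exiting: "adm f \<Longrightarrow> adm (exiting f)"
  unfolding exiting_def by (intro adm_transit adm_if adm_const)

lemma transit_linear:
  assumes "adm f" "adm g"
  shows "transit (\<lambda>x y. c * f x y + d * g x y) = (\<lambda>x y. c * transit f x y + d * transit g x y)"
  by (rule ext)+ (simp add: transit_def integrable_step[OF assms(1)] integrable_step[OF assms(2)])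

lemma transit_mono:
  assumes "adm f" "adm g" "\<And>w. w \<in> space M \<Longrightarrow> f (a w * x + b w) (y + (a w * x + b w)) \<le> g (a w * x + b w) (y + (a w * x + b w))"
  shows "transit f x y \<le> transit g x y"
  unfolding transit_def by (intro integral_mono integrable_step assms) auto

lemma killed_linear:
  assumes "adm f" "adm g"
  shows "killed (\<lambda>x y. c * f x y + d * g x y) = (\<lambda>x y. c * killed f x y + d * killed g x y)"
  unfolding killed_def
  by (subst transit_linear[symmetric])
    (intro adm_if adm_const assms | rule arg_cong[where f = transit], auto simp: fun_eq_iff)+

lemma exiting_linear:
  assumes "adm f" "adm g"
  shows "exiting (\<lambda>x y. c * f x y + d * g x y) = (\<lambda>x y. c * exiting f x y + d * exiting g x y)"
  unfolding exiting_def
  by (subst transit_linear[symmetric])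
    (intro adm_if adm_const assms | rule arg_cong[where f = transit], auto simp: fun_eq_iff)+

lemma transit_split:
  assumes "adm f" shows "transit f x y = killed f x y + exiting f x y"
proof -
  have "transit f = transit (\<lambda>x y. 1 * (if 0 < y then f x y else 0) + 1 * (if 0 < y then 0 else f x y))"
    by (rule arg_cong[where f = transit]) (auto simp: fun_eq_iff)
  also have "\<dots> = (\<lambda>x y. 1 * killed f x y + 1 * exiting f x y)"
    unfolding killed_def exiting_def by (intro transit_linear adm_if adm_const assms)
  finally show ?thesis by simp
qed

lemma killed_mono:
  assumes "adm f" "adm g" "\<And>x y. 0 < y \<Longrightarrow> f x y \<le> g x y"
  shows "killed f x y \<le> killed g x y"
  unfolding killed_def by (intro transit_mono adm_if adm_const assms(1,2)) (use assms(3) in auto)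

text \<open>The comparison is required only where x \<le> y \<le> 0: the walk was positive before
  the step, so a nonpositive new value \<open>y\<close> exceeds the step \<open>x\<close> that led
  to it. Every bound of the exit value by the last position rests on this.\<close>

lemma exiting_mono:
  assumes "adm f" "adm g" "0 < y" "\<And>x y. y \<le> 0 \<Longrightarrow> x \<le> y \<Longrightarrow> f x y \<le> g x y"
  shows "exiting f x y \<le> exiting g x y"
  unfolding exiting_def by (intro transit_mono adm_if adm_const assms(1,2)) (use assms(3,4) in auto)

lemma mean_0 [simp]: "mean 0 f = f" by (simp add: mean_def)

text \<open>Powers of an operator commute with it: this form splits off the last transition,
  \<open>mean_Suc'\<close> the first. Telescoping in time uses the former, inductions that vary the
  starting point the latter.\<close>

lemma mean_Suc: "mean (Suc n) f = mean n (killed f)"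
  by (simp add: mean_def funpow_swap1)

lemma mean_Suc': "mean (Suc n) f = killed (mean n f)"
  by (simp add: mean_def)

lemma mean_add: "mean (m + n) f = mean m (mean n f)"
  by (simp add: mean_def funpow_add)

lemma adm_mean: "adm f \<Longrightarrow> adm (mean n f)"
  by (induction n) (auto simp: mean_Suc' intro: adm_killed)

lemma mean_linear:
  assumes "adm f" "adm g"
  shows "mean n (\<lambda>x y. c * f x y + d * g x y) = (\<lambda>x y. c * mean n f x y + d * mean n g x y)"
  by (induction n) (auto simp: mean_Suc' killed_linear adm_mean assms)

lemma mean_plus: "adm f \<Longrightarrow> adm g \<Longrightarrow> mean n (\<lambda>x y. f x y + g x y) x y = mean n f x y + mean n g x y"
  using mean_linear[of f g n 1 1] by (auto simp: fun_eq_iff)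

lemma mean_minus: "adm f \<Longrightarrow> adm g \<Longrightarrow> mean n (\<lambda>x y. f x y - g x y) x y = mean n f x y - mean n g x y"
  using mean_linear[of f g n 1 "-1"] by (auto simp: fun_eq_iff)

lemma mean_cmult: "adm f \<Longrightarrow> mean n (\<lambda>x y. c * f x y) x y = c * mean n f x y"
  using mean_linear[of f f n c 0] by (auto simp: fun_eq_iff)

lemma exiting_plus: "adm f \<Longrightarrow> adm g \<Longrightarrow> exiting (\<lambda>x y. f x y + g x y) x y = exiting f x y + exiting g x y"
  using exiting_linear[of f g 1 1] by (auto simp: fun_eq_iff)

lemma exiting_cmult: "adm f \<Longrightarrow> exiting (\<lambda>x y. c * f x y) x y = c * exiting f x y"
  using exiting_linear[of f f c 0] by (auto simp: fun_eq_iff)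

lemma mean_mono:
  assumes "adm f" "adm g" "\<And>x y. 0 < y \<Longrightarrow> f x y \<le> g x y" "0 < y"
  shows "mean n f x y \<le> mean n g x y"
  using assms(4)
proof (induction n arbitrary: x y)
  case (Suc n)
  show ?case unfolding mean_Suc' by (intro killed_mono adm_mean assms Suc)
qed (use assms in simp)

lemma mean_nonneg: "adm f \<Longrightarrow> (\<And>x y. 0 < y \<Longrightarrow> 0 \<le> f x y) \<Longrightarrow> 0 < y \<Longrightarrow> 0 \<le> mean n f x y"
  using mean_mono[of "\<lambda>x y. 0" f y n x] mean_cmult[of "\<lambda>x y. 0" n 0] adm_const[of 0] by simp

lemma mean_abs: "adm f \<Longrightarrow> 0 < y \<Longrightarrow> \<bar>mean n f x y\<bar> \<le> mean n (\<lambda>x y. \<bar>f x y\<bar>) x y"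
proof -
  assume f: "adm f" and y: "0 < y"
  have "mean n f x y \<le> mean n (\<lambda>x y. \<bar>f x y\<bar>) x y"
    by (intro mean_mono f adm_absval y) auto
  moreover have "mean n (\<lambda>x y. (- 1) * f x y) x y \<le> mean n (\<lambda>x y. \<bar>f x y\<bar>) x y"
    by (intro mean_mono f adm_absval adm_cmult y) auto
  ultimately show ?thesis using mean_cmult[OF f, of n "-1" x y] by (simp add: abs_le_iff)
qed

lemma mean_abs_le:
  assumes "adm f" "adm g" "\<And>x y. 0 < y \<Longrightarrow> \<bar>f x y\<bar> \<le> g x y" "0 < y"
  shows "\<bar>mean n f x y\<bar> \<le> mean n g x y"
  using mean_abs[OF assms(1,4)] mean_mono[OF adm_absval[OF assms(1)] assms(2,3,4)] by (meson order_trans)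

text \<open>One more step without killing leads either to the survivors of n + 1 steps or to the
  paths that exit at time n + 1. Optional stopping identities come from here.\<close>

lemma mean_transit:
  "adm f \<Longrightarrow> mean n (transit f) x y = mean (Suc n) f x y + mean n (exiting f) x y"
proof -
  assume f: "adm f"
  have "transit f = (\<lambda>x y. killed f x y + exiting f x y)" using transit_split[OF f] by blast
  then show ?thesis using mean_plus[OF adm_killed[OF f] adm_exiting[OF f]] by (simp add: mean_Suc)
qed

lemma transit_const [simp]: "transit (\<lambda>x y. c) = (\<lambda>x y. c)"
  by (simp add: transit_def prob_space fun_eq_iff)

section \<open>Moments on survival\<close>

definition surv :: "nat \<Rightarrow> real \<Rightarrow> real \<Rightarrow> real" where
  "surv n = mean n (\<lambda>x y. 1)"

definition moment :: "nat \<Rightarrow> real \<Rightarrow> real \<Rightarrow> real" where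
  "moment n = mean n (\<lambda>x y. \<bar>x\<bar> powr \<alpha>)"

text \<open>\<open>exit_abs n x y\<close> is the expectation of \<open>\<bar>X\<^sub>\<tau>\<bar>\<close> on \<open>{\<tau>\<^sub>y \<le> n}\<close>.\<close>

definition exit_abs :: "nat \<Rightarrow> real \<Rightarrow> real \<Rightarrow> real" where
  "exit_abs n x y = (\<Sum>k<n. mean k (exiting (\<lambda>x y. \<bar>x\<bar>)) x y)"

lemma exiting_nonneg: "adm f \<Longrightarrow> (\<And>x y. 0 \<le> f x y) \<Longrightarrow> 0 \<le> exiting f x y"
  unfolding exiting_def transit_def by (intro integral_nonneg_AE) auto

lemma killed_le_transit: "adm f \<Longrightarrow> (\<And>x y. 0 \<le> f x y) \<Longrightarrow> killed f x y \<le> transit f x y"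
  using transit_split[of f x y] exiting_nonneg[of f x y] by simp

lemma exiting_le_transit: "adm f \<Longrightarrow> (\<And>x y. 0 \<le> f x y) \<Longrightarrow> exiting f x y \<le> transit f x y"
  unfolding exiting_def by (intro transit_mono adm_if adm_const) auto

lemma surv_0 [simp]: "surv 0 x y = 1" by (simp add: surv_def)

lemma surv_nonneg: "0 < y \<Longrightarrow> 0 \<le> surv n x y"
  unfolding surv_def by (intro mean_nonneg adm_const) auto

lemma moment_nonneg: "0 < y \<Longrightarrow> 0 \<le> moment n x y"
  unfolding moment_def by (intro mean_nonneg adm_powr) auto

lemma surv_Suc: "mean n (exiting (\<lambda>x y. 1)) x y = surv n x y - surv (Suc n) x y"
  using mean_transit[OF adm_const, of n 1 x y] by (simp add: surv_def)

lemma mean_exiting_nonneg: "adm f \<Longrightarrow> (\<And>x y. 0 \<le> f x y) \<Longrightarrow> 0 < y \<Longrightarrow> 0 \<le> mean n (exiting f) x y"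
  by (intro mean_nonneg adm_exiting exiting_nonneg) auto

lemma surv_Suc_le: "0 < y \<Longrightarrow> surv (Suc n) x y \<le> surv n x y"
  using surv_Suc[of n x y] mean_exiting_nonneg[OF adm_const, of 1 y n x] by simp

lemma surv_antimono: "m \<le> n \<Longrightarrow> 0 < y \<Longrightarrow> surv n x y \<le> surv m x y"
  by (rule lift_Suc_antimono_le[of "\<lambda>n. surv n x y"]) (auto intro: surv_Suc_le)

lemma surv_le_one: "0 < y \<Longrightarrow> surv n x y \<le> 1"
  using surv_antimono[of 0 n y x] by simp

lemma exit_abs_Suc: "exit_abs (Suc n) x y = exit_abs n x y + mean n (exiting (\<lambda>x y. \<bar>x\<bar>)) x y"
  by (simp add: exit_abs_def)

lemma exit_abs_mono: "m \<le> n \<Longrightarrow> 0 < y \<Longrightarrow> exit_abs m x y \<le> exit_abs n x y"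
  by (rule lift_Suc_mono_le[of "\<lambda>n. exit_abs n x y"])
    (auto simp: exit_abs_Suc intro!: mean_exiting_nonneg adm_abs)

lemma exit_abs_nonneg: "0 < y \<Longrightarrow> 0 \<le> exit_abs n x y"
  using exit_abs_mono[of 0 n y x] by (simp add: exit_abs_def)

text \<open>All three bounds iterate the drift condition along surviving paths. The second and third
  say that, over a time window, the moments on survival and at exit cost no more than the integrated
  survival probability plus the initial weight; this is much better than summing the uniform bound
  when survival is small.\<close>

lemma moment_bounds:
  "\<exists>C\<ge>0. \<forall>x y. 0 < y \<longrightarrow>
    (\<forall>n. moment n x y \<le> C * (1 + \<bar>x\<bar> powr \<alpha>)) \<and>
    (\<forall>m n. (\<Sum>k=m..<n. moment k x y + surv k x y) \<le> C * (1 + \<bar>x\<bar> powr \<alpha> + (\<Sum>k=m..<n. surv k x y))) \<and>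
    (\<forall>m n. (\<Sum>k=m..<n. mean k (exiting (\<lambda>x y. \<bar>x\<bar> powr \<alpha>)) x y) \<le> C * (1 + \<bar>x\<bar> powr \<alpha> + (\<Sum>k=m..<n. surv k x y)))"
proof -
  obtain r C where rC: "0 \<le> r" "r < 1" "0 \<le> C"
    and c: "\<forall>x. (\<integral>w. \<bar>a w * x + b w\<bar> powr \<alpha> \<partial>M) \<le> r * \<bar>x\<bar> powr \<alpha> + C"
    using contraction by blast
  \<comment> \<open>Chosen so that r * C1 + C \<le> C1; the bound in \<open>A\<close> then
    reproduces itself from one step to the next.\<close>
  define C1 where "C1 = 1 + C / (1 - r)"
  define C2 where "C2 = (C1 + C) / (1 - r) + 1"
  have "(1 - r) * C1 = (1 - r) + C" using rC by (simp add: C1_def distrib_left)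
  then have "r * C1 + C \<le> C1" using rC unfolding left_diff_distrib by linarith
  moreover have "C1 \<ge> 1" using rC by (simp add: C1_def)
  ultimately have C1: "C1 \<ge> 1" "r * C1 + C \<le> C1" by auto
  have C2: "C2 \<ge> (C1 + C) / (1 - r) + 1" "C2 \<ge> C1"
  proof -
    have "C1 * (1 - r) \<le> C1 * 1" using rC C1 by (intro mult_left_mono) auto
    then have "C1 \<le> (C1 + C) / (1 - r)" using rC by (simp add: field_simps)
    then show "C2 \<ge> (C1 + C) / (1 - r) + 1" "C2 \<ge> C1" by (auto simp: C2_def)
  qed
  define C3 where "C3 = C2 + (C + 1) * C2"
  have C3: "C3 \<ge> C2" using rC C1 C2 by (auto simp: C3_def)
  have T: "mean n (transit (\<lambda>x y. \<bar>x\<bar> powr \<alpha>)) x y \<le> r * moment n x y + C * surv n x y" if y: "0 < y" for n x y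
  proof -
    have "mean n (transit (\<lambda>x y. \<bar>x\<bar> powr \<alpha>)) x y \<le> mean n (\<lambda>x y. r * (\<bar>x\<bar> powr \<alpha>) + C * 1) x y"
    proof (rule mean_mono[OF _ _ _ y])
      show "adm (transit (\<lambda>x y. \<bar>x\<bar> powr \<alpha>))" by (intro adm_transit adm_powr)
      show "adm (\<lambda>x y. r * (\<bar>x\<bar> powr \<alpha>) + C * 1)" by (intro adm_add adm_cmult adm_powr adm_const)
    qed (use c in \<open>simp add: transit_def\<close>)
    also have "\<dots> = r * moment n x y + C * surv n x y"
      using mean_linear[OF adm_powr adm_const, of n r C 1] by (simp add: fun_eq_iff moment_def surv_def)
    finally show ?thesis .
  qed
  have mstep: "moment (Suc n) x y \<le> r * moment n x y + C * surv n x y" if y: "0 < y" for n x y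
  proof -
    have "moment (Suc n) x y \<le> mean n (transit (\<lambda>x y. \<bar>x\<bar> powr \<alpha>)) x y"
      unfolding moment_def mean_Suc
      by (intro mean_mono adm_killed adm_transit adm_powr killed_le_transit y) auto
    with T[OF y] show ?thesis by (meson order_trans)
  qed
  have A: "moment n x y \<le> C1 * (1 + \<bar>x\<bar> powr \<alpha>)" if y: "0 < y" for n x y
  proof (induction n)
    case 0
    have "1 * (1 + \<bar>x\<bar> powr \<alpha>) \<le> C1 * (1 + \<bar>x\<bar> powr \<alpha>)" using C1 by (intro mult_right_mono) auto
    then show ?case by (simp add: moment_def)
  next
    case (Suc n)
    have "moment (Suc n) x y \<le> r * (C1 * (1 + \<bar>x\<bar> powr \<alpha>)) + C * 1"
      using rC surv_le_one[OF y, of n x] Suc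
      by (intro order_trans[OF mstep[OF y]] add_mono mult_left_mono) auto
    also have "\<dots> \<le> r * (C1 * (1 + \<bar>x\<bar> powr \<alpha>)) + C * (1 + \<bar>x\<bar> powr \<alpha>)"
      using rC C1 by (intro add_mono mult_left_mono) auto
    also have "\<dots> = (r * C1 + C) * (1 + \<bar>x\<bar> powr \<alpha>)" by (simp add: algebra_simps)
    also have "\<dots> \<le> C1 * (1 + \<bar>x\<bar> powr \<alpha>)" using C1 by (intro mult_right_mono) auto
    finally show ?case .
  qed
  \<comment> \<open>The drift inequality summed over the window: the moments telescope up to a
    fraction 1 - r, and the moment at the left end is bounded by \<open>A\<close> for every
    \<open>m\<close>.\<close>
  have B: "(1 - r) * (\<Sum>k=m..<n. moment k x y) \<le> C1 * (1 + \<bar>x\<bar> powr \<alpha>) + C * (\<Sum>k=m..<n. surv k x y)"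
    if y: "0 < y" for m n x y
  proof (cases "m \<le> n")
    case True
    then have "(1 - r) * (\<Sum>k=m..<n. moment k x y) + moment n x y \<le> moment m x y + C * (\<Sum>k=m..<n. surv k x y)"
    proof (induction n rule: dec_induct)
      case (step n)
      have "(1 - r) * (\<Sum>k=m..<Suc n. moment k x y) = (1 - r) * (\<Sum>k=m..<n. moment k x y) + (moment n x y - r * moment n x y)"
        "C * (\<Sum>k=m..<Suc n. surv k x y) = C * (\<Sum>k=m..<n. surv k x y) + C * surv n x y"
        using step(1) by (simp_all only: sum.atLeastLessThan_Suc distrib_left left_diff_distrib mult_1)
      then show ?case using step(3) mstep[OF y, of n x] by linarith
    qed simp
    then show ?thesis using A[OF y, of m x] moment_nonneg[OF y, of n x] by linarith
  next
    case False
    then show ?thesis using C1 rC by (simp add: add_nonneg_nonneg)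
  qed
  have S: "(\<Sum>k=m..<n. moment k x y + surv k x y) \<le> C2 * (1 + \<bar>x\<bar> powr \<alpha> + (\<Sum>k=m..<n. surv k x y))"
    if y: "0 < y" for m n x y
  proof -
    let ?A = "1 + \<bar>x\<bar> powr \<alpha>" and ?P = "\<Sum>k=m..<n. surv k x y"
    have P: "?P \<ge> 0" by (intro sum_nonneg surv_nonneg y)
    have "0 \<le> C1 * ?P" "0 \<le> C * ?A" using C1 rC P by (intro mult_nonneg_nonneg; simp)+
    moreover have "(C1 + C) * (?A + ?P) = C1 * ?A + C1 * ?P + (C * ?A + C * ?P)"
      by (simp only: distrib_left distrib_right)
    ultimately have "(1 - r) * (\<Sum>k=m..<n. moment k x y) \<le> (C1 + C) * (?A + ?P)"
      using B[OF y, of x m n] by linarith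
    then have "(\<Sum>k=m..<n. moment k x y) \<le> (C1 + C) * (?A + ?P) / (1 - r)"
      using rC by (simp only: pos_le_divide_eq diff_gt_0_iff_gt mult.commute)
    then have "(\<Sum>k=m..<n. moment k x y) \<le> (C1 + C) / (1 - r) * (?A + ?P)"
      by (simp only: times_divide_eq_left)
    then have "(\<Sum>k=m..<n. moment k x y + surv k x y) \<le> ((C1 + C) / (1 - r) + 1) * (?A + ?P)"
    proof -
      have "((C1 + C) / (1 - r) + 1) * (?A + ?P) = (C1 + C) / (1 - r) * (?A + ?P) + (?A + ?P)"
        by (simp only: distrib_right mult_1)
      moreover have "0 \<le> ?A" by simp
      moreover assume "(\<Sum>k=m..<n. moment k x y) \<le> (C1 + C) / (1 - r) * (?A + ?P)"
      ultimately show ?thesis unfolding sum.distrib by linarith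
    qed
    also have "\<dots> \<le> C2 * (?A + ?P)" using C2 P by (intro mult_right_mono) auto
    finally show ?thesis .
  qed
  have X: "(\<Sum>k=m..<n. mean k (exiting (\<lambda>x y. \<bar>x\<bar> powr \<alpha>)) x y) \<le> C3 * (1 + \<bar>x\<bar> powr \<alpha> + (\<Sum>k=m..<n. surv k x y))"
    if y: "0 < y" for m n x y
  proof -
    let ?A = "1 + \<bar>x\<bar> powr \<alpha>" and ?P = "\<Sum>k=m..<n. surv k x y"
    have P: "?P \<ge> 0" by (intro sum_nonneg surv_nonneg y)
    have "(\<Sum>k=m..<n. mean k (exiting (\<lambda>x y. \<bar>x\<bar> powr \<alpha>)) x y)
        \<le> (\<Sum>k=m..<n. (C + 1) * (moment k x y + surv k x y))"
    proof (rule sum_mono)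
      fix k
      have "mean k (exiting (\<lambda>x y. \<bar>x\<bar> powr \<alpha>)) x y \<le> mean k (transit (\<lambda>x y. \<bar>x\<bar> powr \<alpha>)) x y"
        by (intro mean_mono adm_exiting adm_transit adm_powr exiting_le_transit y) auto
      also have "\<dots> \<le> r * moment k x y + C * surv k x y" by (rule T[OF y])
      also have "\<dots> \<le> (C + 1) * moment k x y + (C + 1) * surv k x y"
        using rC by (intro add_mono mult_right_mono moment_nonneg surv_nonneg y) auto
      finally show "mean k (exiting (\<lambda>x y. \<bar>x\<bar> powr \<alpha>)) x y \<le> (C + 1) * (moment k x y + surv k x y)"
        by (simp only: distrib_left)
    qed
    also have "\<dots> \<le> (C + 1) * (C2 * (?A + ?P))"
      unfolding sum_distrib_left[symmetric] using rC by (intro mult_left_mono S[OF y]) auto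
    also have "\<dots> \<le> C3 * (?A + ?P)"
    proof -
      have "0 \<le> C2 * (?A + ?P)" using C1 C2 P by (intro mult_nonneg_nonneg) auto
      moreover have "C3 * (?A + ?P) = C2 * (?A + ?P) + (C + 1) * (C2 * (?A + ?P))"
        by (simp only: C3_def distrib_right mult.assoc)
      ultimately show ?thesis by linarith
    qed
    finally show ?thesis .
  qed
  have "moment n x y \<le> C3 * (1 + \<bar>x\<bar> powr \<alpha>)" if "0 < y" for n x y
    using C2 C3 by (intro order_trans[OF A[OF that]] mult_right_mono) auto
  moreover have "(\<Sum>k=m..<n. moment k x y + surv k x y) \<le> C3 * (1 + \<bar>x\<bar> powr \<alpha> + (\<Sum>k=m..<n. surv k x y))"
    if "0 < y" for m n x y
    using C3 that by (intro order_trans[OF S[OF that]] mult_right_mono) (auto intro!: add_nonneg_nonneg sum_nonneg surv_nonneg)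
  moreover have "C3 \<ge> 0" using C1 C2 C3 by linarith
  ultimately show ?thesis using X by blast
qed

lemma sum_exiting_one: "0 < y \<Longrightarrow> (\<Sum>k=m..<n. mean k (exiting (\<lambda>x y. 1)) x y) \<le> surv m x y"
proof (cases "m \<le> n")
  case True
  assume y: "0 < y"
  from True have "(\<Sum>k=m..<n. mean k (exiting (\<lambda>x y. 1)) x y) = surv m x y - surv n x y"
    by (induction n rule: dec_induct) (auto simp: surv_Suc)
  then show ?thesis using surv_nonneg[OF y, of n x] by simp
qed (simp add: surv_nonneg)

text \<open>Exit positions below the level \<open>l\<close> cost at most \<open>l\<close> times the
  probability of surviving to \<open>m\<close>; the larger ones are paid for by their \<alpha>-th
  moments. With a balanced \<open>l\<close> this becomes the second half of the bootstrap.\<close>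

lemma exit_abs_increment:
  "\<exists>C\<ge>0. \<forall>x y l m n. 0 < y \<longrightarrow> 0 < l \<longrightarrow> m \<le> n \<longrightarrow>
    exit_abs n x y \<le> exit_abs m x y + l * surv m x y
      + l powr (1 - \<alpha>) * (C * (1 + \<bar>x\<bar> powr \<alpha> + (\<Sum>k=m..<n. surv k x y)))"
proof -
  obtain C where C: "C \<ge> 0" "\<forall>x y. 0 < y \<longrightarrow> (\<forall>m n. (\<Sum>k=m..<n. mean k (exiting (\<lambda>x y. \<bar>x\<bar> powr \<alpha>)) x y)
      \<le> C * (1 + \<bar>x\<bar> powr \<alpha> + (\<Sum>k=m..<n. surv k x y)))"
    using moment_bounds by blast
  have "exit_abs n x y \<le> exit_abs m x y + l * surv m x y
      + l powr (1 - \<alpha>) * (C * (1 + \<bar>x\<bar> powr \<alpha> + (\<Sum>k=m..<n. surv k x y)))"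
    if y: "0 < y" and l: "0 < l" and mn: "m \<le> n" for x y l m n
  proof -
    have eq: "exit_abs n x y = exit_abs m x y + (\<Sum>k=m..<n. mean k (exiting (\<lambda>x y. \<bar>x\<bar>)) x y)"
      unfolding exit_abs_def lessThan_atLeast0 using mn by (simp add: sum.atLeastLessThan_concat)
    have "(\<Sum>k=m..<n. mean k (exiting (\<lambda>x y. \<bar>x\<bar>)) x y) \<le>
        (\<Sum>k=m..<n. l * mean k (exiting (\<lambda>x y. 1)) x y + l powr (1 - \<alpha>) * mean k (exiting (\<lambda>x y. \<bar>x\<bar> powr \<alpha>)) x y)"
    proof (rule sum_mono)
      fix k
      have e: "exiting (\<lambda>x y. l * 1 + l powr (1 - \<alpha>) * \<bar>x\<bar> powr \<alpha>)
          = (\<lambda>x y. l * exiting (\<lambda>x y. 1) x y + l powr (1 - \<alpha>) * exiting (\<lambda>x y. \<bar>x\<bar> powr \<alpha>) x y)"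
        by (rule exiting_linear[OF adm_const adm_powr])
      have "mean k (exiting (\<lambda>x y. \<bar>x\<bar>)) x y \<le> mean k (exiting (\<lambda>x y. l * 1 + l powr (1 - \<alpha>) * \<bar>x\<bar> powr \<alpha>)) x y"
      proof (intro mean_mono adm_exiting exiting_mono adm_add adm_cmult adm_const adm_powr adm_abs y)
        fix x :: real
        have "\<bar>x\<bar> \<le> l * \<bar>x\<bar> powr 0 + l powr (1 - \<alpha>) * \<bar>x\<bar> powr \<alpha>"
          using powr_split_tail[of "\<bar>x\<bar>" l 1 \<alpha> 0] l \<alpha>_gt by simp
        also have "\<dots> \<le> l * 1 + l powr (1 - \<alpha>) * \<bar>x\<bar> powr \<alpha>"
          using l by (intro add_mono mult_left_mono) auto
        finally show "\<bar>x\<bar> \<le> l * 1 + l powr (1 - \<alpha>) * \<bar>x\<bar> powr \<alpha>" .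
      qed
      then show "mean k (exiting (\<lambda>x y. \<bar>x\<bar>)) x y \<le> l * mean k (exiting (\<lambda>x y. 1)) x y
          + l powr (1 - \<alpha>) * mean k (exiting (\<lambda>x y. \<bar>x\<bar> powr \<alpha>)) x y"
        unfolding e by (subst (asm) mean_linear) (auto intro!: adm_exiting adm_const adm_powr)
    qed
    also have "\<dots> = l * (\<Sum>k=m..<n. mean k (exiting (\<lambda>x y. 1)) x y)
        + l powr (1 - \<alpha>) * (\<Sum>k=m..<n. mean k (exiting (\<lambda>x y. \<bar>x\<bar> powr \<alpha>)) x y)"
      by (simp add: sum.distrib sum_distrib_left)
    also have "\<dots> \<le> l * surv m x y + l powr (1 - \<alpha>) * (C * (1 + \<bar>x\<bar> powr \<alpha> + (\<Sum>k=m..<n. surv k x y)))"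
      using C l y by (intro add_mono mult_left_mono sum_exiting_one) auto
    finally show ?thesis using eq by linarith
  qed
  with C(1) show ?thesis by blast
qed

text \<open>Squares of the exit position arise where the corrector or a second-order expansion is
  evaluated at exit. Truncation trades them for the first moment with weight \<open>l\<close> and
  the \<alpha>-th moment with weight l^(2 - \<alpha>).\<close>

lemma exit_square_sum:
  "\<exists>C\<ge>0. \<forall>x y l. \<forall>n::nat. 0 < y \<longrightarrow> 0 < l \<longrightarrow>
    (\<Sum>k<n. mean k (exiting (\<lambda>x y. 1 + x\<^sup>2)) x y) \<le> 1 + l * exit_abs n x y
      + l powr (2 - \<alpha>) * (C * (1 + \<bar>x\<bar> powr \<alpha> + (\<Sum>k<n. surv k x y)))"
proof -
  obtain C where C: "C \<ge> 0" "\<forall>x y. 0 < y \<longrightarrow> (\<forall>m n. (\<Sum>k=m..<n. mean k (exiting (\<lambda>x y. \<bar>x\<bar> powr \<alpha>)) x y)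
      \<le> C * (1 + \<bar>x\<bar> powr \<alpha> + (\<Sum>k=m..<n. surv k x y)))"
    using moment_bounds by blast
  have "(\<Sum>k<n. mean k (exiting (\<lambda>x y. 1 + x\<^sup>2)) x y) \<le> 1 + l * exit_abs n x y
      + l powr (2 - \<alpha>) * (C * (1 + \<bar>x\<bar> powr \<alpha> + (\<Sum>k<n. surv k x y)))"
    if y: "0 < y" and l: "0 < l" for x y l :: real and n :: nat
  proof -
    have adm1: "adm (\<lambda>x y. l * \<bar>x\<bar> + l powr (2 - \<alpha>) * \<bar>x\<bar> powr \<alpha>)"
      by (intro adm_add adm_cmult adm_powr adm_abs)
    \<comment> \<open>The factors 1 bring the sum into the shape of
      \<open>exiting_linear\<close>.\<close>
    have e: "exiting (\<lambda>x y. 1 * 1 + 1 * (l * \<bar>x\<bar> + l powr (2 - \<alpha>) * \<bar>x\<bar> powr \<alpha>))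
        = (\<lambda>x y. 1 * exiting (\<lambda>x y. 1) x y + 1 * (l * exiting (\<lambda>x y. \<bar>x\<bar>) x y + l powr (2 - \<alpha>) * exiting (\<lambda>x y. \<bar>x\<bar> powr \<alpha>) x y))"
      by (subst exiting_linear[OF adm_const adm1], subst exiting_linear[OF adm_abs adm_powr]) simp
    have "(\<Sum>k<n. mean k (exiting (\<lambda>x y. 1 + x\<^sup>2)) x y) \<le>
        (\<Sum>k<n. mean k (exiting (\<lambda>x y. 1)) x y + (l * mean k (exiting (\<lambda>x y. \<bar>x\<bar>)) x y
          + l powr (2 - \<alpha>) * mean k (exiting (\<lambda>x y. \<bar>x\<bar> powr \<alpha>)) x y))"
    proof (rule sum_mono)
      fix k
      have "mean k (exiting (\<lambda>x y. 1 + x\<^sup>2)) x y \<le> mean k (exiting (\<lambda>x y. 1 * 1 + 1 * (l * \<bar>x\<bar> + l powr (2 - \<alpha>) * \<bar>x\<bar> powr \<alpha>))) x y"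
      proof (intro mean_mono adm_exiting exiting_mono adm_add adm_cmult adm_const adm_powr adm_abs adm_square y)
        fix x :: real
        have "\<bar>x\<bar> powr 2 \<le> l powr 1 * \<bar>x\<bar> powr 1 + l powr (2 - \<alpha>) * \<bar>x\<bar> powr \<alpha>"
          using powr_split_tail[of "\<bar>x\<bar>" l 2 \<alpha> 1] l \<alpha>_gt by simp
        then show "1 + x\<^sup>2 \<le> 1 * 1 + 1 * (l * \<bar>x\<bar> + l powr (2 - \<alpha>) * \<bar>x\<bar> powr \<alpha>)" using l by simp
      qed
      then show "mean k (exiting (\<lambda>x y. 1 + x\<^sup>2)) x y \<le> mean k (exiting (\<lambda>x y. 1)) x y + (l * mean k (exiting (\<lambda>x y. \<bar>x\<bar>)) x y
          + l powr (2 - \<alpha>) * mean k (exiting (\<lambda>x y. \<bar>x\<bar> powr \<alpha>)) x y)"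
        unfolding e
        by (subst (asm) mean_linear, (intro adm_exiting adm_const adm_powr adm_abs adm_add adm_cmult)+,
            subst (asm) mean_linear) (auto intro!: adm_exiting adm_const adm_powr adm_abs)
    qed
    also have "\<dots> = (\<Sum>k=0..<n. mean k (exiting (\<lambda>x y. 1)) x y) + (l * exit_abs n x y
          + l powr (2 - \<alpha>) * (\<Sum>k=0..<n. mean k (exiting (\<lambda>x y. \<bar>x\<bar> powr \<alpha>)) x y))"
      by (simp add: sum.distrib sum_distrib_left exit_abs_def lessThan_atLeast0)
    also have "\<dots> \<le> 1 + (l * exit_abs n x y + l powr (2 - \<alpha>) * (C * (1 + \<bar>x\<bar> powr \<alpha> + (\<Sum>k=0..<n. surv k x y))))"
      using C l y sum_exiting_one[OF y, of x 0 n] by (intro add_mono mult_left_mono) auto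
    finally show ?thesis by (simp add: lessThan_atLeast0)
  qed
  with C(1) show ?thesis by blast
qed

section \<open>The martingale and its corrector\<close>

definition a_mean :: real where "a_mean = (\<integral>w. a w \<partial>M)"
definition a_sq :: real where "a_sq = (\<integral>w. (a w)\<^sup>2 \<partial>M)"
definition b_sq :: real where "b_sq = (\<integral>w. (b w)\<^sup>2 \<partial>M)"
definition ab_mean :: real where "ab_mean = (\<integral>w. a w * b w \<partial>M)"

text \<open>\<open>y + S\<^sub>n + \<rho> X\<^sub>n\<close> is a martingale.\<close>

definition \<rho> :: real where "\<rho> = a_mean / (1 - a_mean)"

definition sig2 :: real where
  "sig2 = b_sq / (1 - a_sq) * ((1 + a_mean) / (1 - a_mean))"

text \<open>
  The conditional variance of the martingale increment is a quadratic polynomial in the current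
  position; \<open>corr\<close> solves the Poisson equation for it, see \<open>corr_poisson\<close>.
\<close>

definition corr1 :: real where "corr1 = (1 + \<rho>)\<^sup>2 * (a_sq - a_mean\<^sup>2) / (1 - a_sq)"
definition corr2 :: real where "corr2 = 2 * ab_mean * (corr1 + (1 + \<rho>)\<^sup>2) / (1 - a_mean)"
definition corr :: "real \<Rightarrow> real" where "corr x = corr1 * x\<^sup>2 + corr2 * x"

text \<open>The one-step increment of the martingale Z from position \<open>x\<close>, already
  centred; it depends on \<open>x\<close> because the coefficient \<open>a\<close> is
  random.\<close>

definition incr :: "real \<Rightarrow> 'w \<Rightarrow> real" where
  "incr x w = (1 + \<rho>) * ((a w - a_mean) * x + b w)"

lemma integrable_power_le:
  assumes [measurable]: "f \<in> borel_measurable M" and "integrable M (\<lambda>w. \<bar>f w\<bar> powr \<alpha>)" "k \<le> 2"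
  shows "integrable M (\<lambda>w. f w ^ k)"
proof (rule Bochner_Integration.integrable_bound[of _ "\<lambda>w. 1 + \<bar>f w\<bar> powr \<alpha>"])
  show "integrable M (\<lambda>w. 1 + \<bar>f w\<bar> powr \<alpha>)" using assms by simp
  show "AE w in M. norm (f w ^ k) \<le> norm (1 + \<bar>f w\<bar> powr \<alpha>)"
    using abs_power_le[OF assms(3)] by (intro AE_I2) (simp add: power_abs)
qed measurable

lemma integrable_a1: "integrable M a" using integrable_power_le[of a 1] integrable_a by simp
lemma integrable_a2: "integrable M (\<lambda>w. (a w)\<^sup>2)" using integrable_power_le[of a 2] integrable_a by simp
lemma integrable_b1: "integrable M b" using integrable_power_le[of b 1] integrable_b by simp
lemma integrable_b2: "integrable M (\<lambda>w. (b w)\<^sup>2)" using integrable_power_le[of b 2] integrable_b by simp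

lemma integrable_ab: "integrable M (\<lambda>w. a w * b w)"
proof (rule Bochner_Integration.integrable_bound[of _ "\<lambda>w. (a w)\<^sup>2 + (b w)\<^sup>2"])
  show "integrable M (\<lambda>w. (a w)\<^sup>2 + (b w)\<^sup>2)" using integrable_a2 integrable_b2 by simp
  have "\<bar>s * t\<bar> \<le> s\<^sup>2 + t\<^sup>2" for s t :: real
  proof -
    have "2 * \<bar>s * t\<bar> \<le> s\<^sup>2 + t\<^sup>2"
      using sum_squares_bound[of "\<bar>s\<bar>" "\<bar>t\<bar>"] by (simp add: abs_mult mult.assoc)
    then show ?thesis using abs_ge_zero[of "s * t"] by linarith
  qed
  then show "AE w in M. norm (a w * b w) \<le> norm ((a w)\<^sup>2 + (b w)\<^sup>2)"
    by (intro AE_I2) simp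
qed measurable

lemma a_sq_less: "a_sq < 1"
proof -
  \<comment> \<open>The coefficients 2 / \<alpha> and 1 - 2 / \<alpha> sum to 1, so an \<alpha>-th
    moment below 1 forces a second moment below 1.\<close>
  have "a_sq \<le> (\<integral>w. 2 / \<alpha> * \<bar>a w\<bar> powr \<alpha> + (1 - 2 / \<alpha>) \<partial>M)"
    unfolding a_sq_def
  proof (rule integral_mono[OF integrable_a2])
    show "integrable M (\<lambda>w. 2 / \<alpha> * \<bar>a w\<bar> powr \<alpha> + (1 - 2 / \<alpha>))" using integrable_a by simp
    show "(a w)\<^sup>2 \<le> 2 / \<alpha> * \<bar>a w\<bar> powr \<alpha> + (1 - 2 / \<alpha>)" for w
      using powr_le_affine[of "\<bar>a w\<bar>" 2 \<alpha>] \<alpha>_gt by simp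
  qed
  also have "\<dots> = 2 / \<alpha> * (\<integral>w. \<bar>a w\<bar> powr \<alpha> \<partial>M) + (1 - 2 / \<alpha>)"
    using integrable_a by (simp add: prob_space)
  also have "\<dots> < 2 / \<alpha> * 1 + (1 - 2 / \<alpha>)"
    using moment_a \<alpha>_pos by (intro add_strict_right_mono mult_strict_left_mono) auto
  finally show ?thesis by simp
qed

lemma a_mean_abs_less: "\<bar>a_mean\<bar> < 1"
proof -
  have "\<bar>a_mean\<bar> \<le> (\<integral>w. \<bar>a w\<bar> \<partial>M)" unfolding a_mean_def by (rule integral_abs_bound)
  also have "\<dots> \<le> (\<integral>w. (1 + (a w)\<^sup>2) / 2 \<partial>M)"
  proof (rule integral_mono)
    show "\<bar>a w\<bar> \<le> (1 + (a w)\<^sup>2) / 2" for w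
      using sum_squares_bound[of "\<bar>a w\<bar>" 1] by simp
  qed (use integrable_a1 integrable_a2 in auto)
  also have "\<dots> = (1 + a_sq) / 2"
    using integrable_a2 by (simp add: a_sq_def prob_space)
  also have "\<dots> < 1" using a_sq_less by simp
  finally show ?thesis .
qed

lemma b_sq_pos: "b_sq > 0"
proof -
  have "b_sq \<ge> 0" unfolding b_sq_def by (intro integral_nonneg_AE) auto
  moreover have "b_sq \<noteq> 0"
  proof
    assume "b_sq = 0"
    then have "AE w in M. (b w)\<^sup>2 = 0"
      using integral_nonneg_eq_0_iff_AE[OF integrable_b2] by (simp add: b_sq_def)
    then have "AE w in M. b w = 0" by simp
    then have "\<P>(w in M. b w \<noteq> 0) = 0"
      by (intro prob_eq_0_AE) auto
    with b_nonzero show False by simp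
  qed
  ultimately show ?thesis by simp
qed

lemma one_plus_\<rho>: "1 + \<rho> = 1 / (1 - a_mean)"
  using a_mean_abs_less by (simp add: \<rho>_def field_simps)

lemma one_plus_\<rho>_pos: "1 + \<rho> > 0"
  using a_mean_abs_less by (simp add: one_plus_\<rho>)

lemma \<rho>_eq: "(1 + \<rho>) * a_mean = \<rho>"
  by (simp only: one_plus_\<rho>) (simp add: \<rho>_def)

text \<open>The right-hand side is the constant left over in the Poisson equation of the corrector;
  this identifies it with the closed formula for the square of \<sigma>.\<close>

lemma sig2_eq: "sig2 = (corr1 + (1 + \<rho>)\<^sup>2) * b_sq"
proof -
  have n: "1 - a_sq \<noteq> 0" "1 - a_mean \<noteq> 0" using a_sq_less a_mean_abs_less by auto
  have "corr1 + (1 + \<rho>)\<^sup>2 = (1 + \<rho>)\<^sup>2 * (1 - a_mean\<^sup>2) / (1 - a_sq)"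
    using n(1) by (simp add: corr1_def field_simps)
  also have "\<dots> = (1 + a_mean) / (1 - a_mean) / (1 - a_sq)"
    using n by (simp add: one_plus_\<rho> power2_eq_square divide_simps) (simp add: algebra_simps)
  finally show ?thesis by (simp add: sig2_def mult_ac)
qed

lemma sig2_pos: "sig2 > 0"
  using a_sq_less a_mean_abs_less b_sq_pos by (auto simp: sig2_def intro!: mult_pos_pos divide_pos_pos)

lemma incr_shift: "y + (a w * x + b w) + \<rho> * (a w * x + b w) = y + \<rho> * x + incr x w"
proof -
  have "incr x w = (1 + \<rho>) * (a w * x + b w) - ((1 + \<rho>) * a_mean) * x"
    by (simp add: incr_def algebra_simps)
  then show ?thesis unfolding \<rho>_eq by (simp add: algebra_simps)
qed

lemma incr_measurable [measurable]: "incr x \<in> borel_measurable M"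
  unfolding incr_def by measurable

lemma integrable_incr: "integrable M (incr x)"
  unfolding incr_def using integrable_a1 integrable_b1 by simp

lemma mean_incr: "(\<integral>w. incr x w \<partial>M) = 0"
  unfolding incr_def using integrable_a1 integrable_b1 mean_b by (simp add: a_mean_def prob_space)

lemma transit_martingale: "transit (\<lambda>x y. y + \<rho> * x) x y = y + \<rho> * x"
proof -
  have "transit (\<lambda>x y. y + \<rho> * x) x y = (\<integral>w. (y + \<rho> * x) + incr x w \<partial>M)"
    unfolding transit_def incr_shift ..
  also have "\<dots> = y + \<rho> * x"
    using integrable_incr[of x] by (simp add: mean_incr prob_space)
  finally show ?thesis .
qed

lemma incr_sq_corr:
  "(incr x w)\<^sup>2 + corr (a w * x + b w) =
    ((1 + \<rho>)\<^sup>2 + corr1) * x\<^sup>2 * (a w)\<^sup>2 + 2 * ((1 + \<rho>)\<^sup>2 + corr1) * x * (a w * b w) + ((1 + \<rho>)\<^sup>2 + corr1) * (b w)\<^sup>2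
    + (corr2 * x - 2 * (1 + \<rho>)\<^sup>2 * a_mean * x\<^sup>2) * a w + (corr2 - 2 * (1 + \<rho>)\<^sup>2 * a_mean * x) * b w
    + (1 + \<rho>)\<^sup>2 * a_mean\<^sup>2 * x\<^sup>2"
  by (simp add: incr_def corr_def power2_eq_square algebra_simps)

text \<open>Comparison of coefficients: the terms in x^2 determine \<open>corr1\<close>, the terms
  linear in x determine \<open>corr2\<close>, and the constant is \<open>sig2\<close>.\<close>

lemma corr_poisson:
  "integrable M (\<lambda>w. (incr x w)\<^sup>2 + corr (a w * x + b w))"
  "(\<integral>w. (incr x w)\<^sup>2 + corr (a w * x + b w) \<partial>M) = sig2 + corr x"
proof -
  note int = integrable_a1 integrable_a2 integrable_b1 integrable_b2 integrable_ab
  show "integrable M (\<lambda>w. (incr x w)\<^sup>2 + corr (a w * x + b w))"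
    unfolding incr_sq_corr using int by simp
  let ?q = "(1 + \<rho>)\<^sup>2"
  have n: "1 - a_sq \<noteq> 0" "1 - a_mean \<noteq> 0" using a_sq_less a_mean_abs_less by auto
  have 1: "?q * (a_sq - a_mean\<^sup>2) = corr1 - corr1 * a_sq"
  proof -
    have "corr1 * (1 - a_sq) = ?q * (a_sq - a_mean\<^sup>2)" using n(1) unfolding corr1_def by simp
    then show ?thesis unfolding right_diff_distrib[of corr1] by simp
  qed
  have 2: "2 * ab_mean * (corr1 + ?q) = corr2 - corr2 * a_mean"
  proof -
    have "corr2 * (1 - a_mean) = 2 * ab_mean * (corr1 + ?q)" using n(2) unfolding corr2_def by simp
    then show ?thesis unfolding right_diff_distrib[of corr2] by simp
  qed
  have "(\<integral>w. (incr x w)\<^sup>2 + corr (a w * x + b w) \<partial>M) =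
    (?q + corr1) * x\<^sup>2 * a_sq + 2 * (?q + corr1) * x * ab_mean + (?q + corr1) * b_sq
    + (corr2 * x - 2 * ?q * a_mean * x\<^sup>2) * a_mean + ?q * a_mean\<^sup>2 * x\<^sup>2"
    unfolding incr_sq_corr using int mean_b
    by (simp add: prob_space a_sq_def b_sq_def ab_mean_def a_mean_def)
  also have "\<dots> = (?q * (a_sq - a_mean\<^sup>2) + corr1 * a_sq) * x\<^sup>2 + (2 * ab_mean * (corr1 + ?q) + corr2 * a_mean) * x + sig2"
    unfolding sig2_eq by (simp add: power2_eq_square algebra_simps)
  also have "\<dots> = sig2 + corr x"
    unfolding 1 2 by (simp add: corr_def)
  finally show "(\<integral>w. (incr x w)\<^sup>2 + corr (a w * x + b w) \<partial>M) = sig2 + corr x" .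
qed

lemma corr_bound: "\<bar>corr x\<bar> \<le> (\<bar>corr1\<bar> + \<bar>corr2\<bar>) * (1 + x\<^sup>2)"
proof -
  have "\<bar>x\<bar> \<le> 1 + x\<^sup>2" using sum_squares_bound[of "\<bar>x\<bar>" 1] by simp
  then have "\<bar>corr2\<bar> * \<bar>x\<bar> \<le> \<bar>corr2\<bar> * (1 + x\<^sup>2)" by (intro mult_left_mono) auto
  moreover have "\<bar>corr1\<bar> * x\<^sup>2 \<le> \<bar>corr1\<bar> * (1 + x\<^sup>2)" by (intro mult_left_mono) auto
  moreover have "\<bar>corr x\<bar> \<le> \<bar>corr1\<bar> * x\<^sup>2 + \<bar>corr2\<bar> * \<bar>x\<bar>"
    unfolding corr_def by (rule order_trans[OF abs_triangle_ineq]) (simp add: abs_mult)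
  ultimately show ?thesis unfolding distrib_right by linarith
qed

lemma square_le_powr: "x\<^sup>2 \<le> 1 + \<bar>x\<bar> powr \<alpha>" for x :: real
  using abs_power_le[of 2 x] by simp

lemma incr_powr_bound: "\<exists>C\<ge>0. \<forall>x w. \<bar>incr x w\<bar> powr \<alpha> \<le> C * (\<bar>a w * x + b w\<bar> powr \<alpha> + \<bar>x\<bar> powr \<alpha>)"
proof -
  obtain C where C: "C \<ge> 0" "\<forall>s\<ge>0. \<forall>t\<ge>0. (s + t) powr \<alpha> \<le> (1 + 1) * s powr \<alpha> + C * t powr \<alpha>"
    using powr_add_le[OF \<alpha>_pos zero_less_one] by blast
  have "\<bar>incr x w\<bar> powr \<alpha> \<le> (1 + \<rho>) powr \<alpha> * (2 + C) * (\<bar>a w * x + b w\<bar> powr \<alpha> + \<bar>x\<bar> powr \<alpha>)" for x w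
  proof -
    have "incr x w = (1 + \<rho>) * ((a w * x + b w) - a_mean * x)" by (simp add: incr_def algebra_simps)
    then have "\<bar>incr x w\<bar> = (1 + \<rho>) * \<bar>(a w * x + b w) - a_mean * x\<bar>"
      using one_plus_\<rho>_pos by (simp only: abs_mult abs_of_pos)
    also have "\<dots> \<le> (1 + \<rho>) * (\<bar>a w * x + b w\<bar> + \<bar>x\<bar>)"
    proof (rule mult_left_mono)
      have "\<bar>a_mean * x\<bar> \<le> 1 * \<bar>x\<bar>" using a_mean_abs_less unfolding abs_mult by (intro mult_right_mono) auto
      then show "\<bar>(a w * x + b w) - a_mean * x\<bar> \<le> \<bar>a w * x + b w\<bar> + \<bar>x\<bar>" by linarith
    qed (use one_plus_\<rho>_pos in simp)
    finally have "\<bar>incr x w\<bar> powr \<alpha> \<le> ((1 + \<rho>) * (\<bar>a w * x + b w\<bar> + \<bar>x\<bar>)) powr \<alpha>"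
      using \<alpha>_pos by (intro powr_mono2) auto
    also have "\<dots> = (1 + \<rho>) powr \<alpha> * (\<bar>a w * x + b w\<bar> + \<bar>x\<bar>) powr \<alpha>"
      using one_plus_\<rho>_pos by (intro powr_mult)
    also have "\<dots> \<le> (1 + \<rho>) powr \<alpha> * ((2 + C) * (\<bar>a w * x + b w\<bar> powr \<alpha> + \<bar>x\<bar> powr \<alpha>))"
    proof (rule mult_left_mono)
      have "(\<bar>a w * x + b w\<bar> + \<bar>x\<bar>) powr \<alpha> \<le> 2 * \<bar>a w * x + b w\<bar> powr \<alpha> + C * \<bar>x\<bar> powr \<alpha>"
        using C(2) by simp
      also have "\<dots> \<le> (2 + C) * \<bar>a w * x + b w\<bar> powr \<alpha> + (2 + C) * \<bar>x\<bar> powr \<alpha>"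
        using C(1) by (intro add_mono mult_right_mono) auto
      finally show "(\<bar>a w * x + b w\<bar> + \<bar>x\<bar>) powr \<alpha> \<le> (2 + C) * (\<bar>a w * x + b w\<bar> powr \<alpha> + \<bar>x\<bar> powr \<alpha>)"
        by (simp only: distrib_left)
    qed simp
    finally show ?thesis by (simp only: mult.assoc)
  qed
  moreover have "(1 + \<rho>) powr \<alpha> * (2 + C) \<ge> 0" using C by simp
  ultimately show ?thesis by blast
qed

text \<open>At a fixed position the added term is of relative order 1 / N, but its one-step
  variation has the order of the fluctuation of the conditional variance, and cancels it.\<close>

definition perturbed :: "(nat \<Rightarrow> nat \<Rightarrow> real \<Rightarrow> real) \<Rightarrow> nat \<Rightarrow> real \<Rightarrow> real \<Rightarrow> real" where
  "perturbed u s x y = u 0 s (y + \<rho> * x) + corr x / 2 * u 2 s (y + \<rho> * x)"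

lemma heat_family_bound: "heat_family v N D u \<Longrightarrow> i \<le> 3 \<Longrightarrow> \<bar>u i s z\<bar> \<le> D * N powr (- (real i / 2))"
  unfolding heat_family_def by blast

lemma heat_family_deriv: "heat_family v N D u \<Longrightarrow> i < 3 \<Longrightarrow> (u i s has_real_derivative u (Suc i) s z) (at z)"
  unfolding heat_family_def by blast

lemma heat_family_measurable:
  assumes "heat_family v N D u" "i < 3"
  shows "u i s \<in> borel_measurable borel"
  using assms by (intro borel_measurable_continuous_onI continuous_at_imp_continuous_on)
    (auto intro!: DERIV_isCont heat_family_deriv)

lemma adm_family:
  assumes "heat_family v N D u" "i < 3"
  shows "adm (\<lambda>x y. u i s (y + \<rho> * x))"
proof (rule adm_bounded)
  show "case_prod (\<lambda>x y. u i s (y + \<rho> * x)) \<in> borel_measurable (borel \<Otimes>\<^sub>M borel)"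
    unfolding case_prod_unfold
    by (rule measurable_compose[OF _ heat_family_measurable[OF assms]]) measurable
  show "\<bar>u i s (y + \<rho> * x)\<bar> \<le> D * N powr (- (real i / 2))" for x y
    using assms by (intro heat_family_bound) auto
qed

lemma adm_corr_family:
  assumes "heat_family v N D u"
  shows "adm (\<lambda>x y. corr x / 2 * u 2 s (y + \<rho> * x))"
proof (rule adm_dominated)
  have u2: "\<bar>u 2 s z\<bar> \<le> D * N powr (- 1)" for z
    using heat_family_bound[OF assms, of 2] by simp
  have D: "D * N powr (- 1) \<ge> 0" using u2[of 0] by (meson abs_ge_zero order_trans)
  show "adm (\<lambda>x y. (\<bar>corr1\<bar> + \<bar>corr2\<bar>) * (D * N powr (- 1)) * (1 + x\<^sup>2))"
    by (intro adm_cmult adm_add adm_const adm_square)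
  show "case_prod (\<lambda>x y. corr x / 2 * u 2 s (y + \<rho> * x)) \<in> borel_measurable (borel \<Otimes>\<^sub>M borel)"
    unfolding case_prod_unfold corr_def
    by (intro borel_measurable_times measurable_compose[OF _ heat_family_measurable[OF assms]]) auto
  show "\<bar>corr x / 2 * u 2 s (y + \<rho> * x)\<bar> \<le> \<bar>(\<bar>corr1\<bar> + \<bar>corr2\<bar>) * (D * N powr (- 1)) * (1 + x\<^sup>2)\<bar>" for x y
  proof -
    have "\<bar>corr x / 2\<bar> \<le> (\<bar>corr1\<bar> + \<bar>corr2\<bar>) * (1 + x\<^sup>2)" using corr_bound[of x] by (simp add: abs_le_iff)
    then have "\<bar>corr x / 2\<bar> * \<bar>u 2 s (y + \<rho> * x)\<bar> \<le> ((\<bar>corr1\<bar> + \<bar>corr2\<bar>) * (1 + x\<^sup>2)) * (D * N powr (- 1))"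
      using u2 by (intro mult_mono) auto
    also have "\<dots> \<le> \<bar>(\<bar>corr1\<bar> + \<bar>corr2\<bar>) * (D * N powr (- 1)) * (1 + x\<^sup>2)\<bar>"
      by (rule order_trans[OF _ abs_ge_self]) (simp add: mult_ac)
    finally show ?thesis by (simp add: abs_mult)
  qed
qed

lemma adm_perturbed: "heat_family v N D u \<Longrightarrow> adm (perturbed u s)"
  unfolding perturbed_def by (intro adm_add adm_corr_family adm_family) auto

section \<open>Perturbed test functions\<close>

text \<open>A product of total degree \<alpha>, estimated by the maximum of 1, |s| and t. It handles
  the corrector at the new position multiplied by a variation of the second derivative.\<close>

lemma mixed_power_le:
  fixes s t :: real
  assumes "0 \<le> t"
  shows "(1 + s\<^sup>2) * t powr (\<alpha> - 2) \<le> 2 * (1 + \<bar>s\<bar> powr \<alpha> + t powr \<alpha>)"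
proof -
  define m where "m = max (max 1 \<bar>s\<bar>) t"
  have m: "1 \<le> m" "\<bar>s\<bar> \<le> m" "t \<le> m" by (auto simp: m_def)
  have "s\<^sup>2 \<le> m\<^sup>2" using m by (simp add: abs_le_square_iff[symmetric])
  moreover have "1 \<le> m\<^sup>2" using m by (simp add: one_le_power)
  moreover have "m powr 2 = m\<^sup>2" using m by simp
  ultimately have "1 + s\<^sup>2 \<le> 2 * m powr 2" by linarith
  moreover have "t powr (\<alpha> - 2) \<le> m powr (\<alpha> - 2)" using m assms \<alpha>_gt by (intro powr_mono2) auto
  ultimately have "(1 + s\<^sup>2) * t powr (\<alpha> - 2) \<le> (2 * m powr 2) * m powr (\<alpha> - 2)"
    by (intro mult_mono) auto
  also have "\<dots> = 2 * m powr \<alpha>" by (simp add: powr_add[symmetric] mult.assoc)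
  also have "m powr \<alpha> \<le> 1 + \<bar>s\<bar> powr \<alpha> + t powr \<alpha>"
    by (auto simp: m_def max_def add_nonneg_nonneg)
  finally show ?thesis by simp
qed

text \<open>
  The first-order term vanishes because the increment is centred, and the second-order terms
  average out by \<open>corr_poisson\<close>, so only a remainder of Taylor type is left.
\<close>

lemma perturbed_step:
  "\<exists>C\<ge>0. \<forall>N D u s x y. 1 \<le> N \<longrightarrow> heat_family sig2 N D u \<longrightarrow>
    \<bar>transit (perturbed u s) x y - perturbed u (Suc s) x y\<bar> \<le> C * D * N powr (- (\<alpha> / 2)) * (1 + \<bar>x\<bar> powr \<alpha>)"
proof -
  obtain Ci where Ci: "Ci \<ge> 0" "\<forall>x w. \<bar>incr x w\<bar> powr \<alpha> \<le> Ci * (\<bar>a w * x + b w\<bar> powr \<alpha> + \<bar>x\<bar> powr \<alpha>)"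
    using incr_powr_bound by blast
  obtain r Cm where Cm: "0 \<le> r" "r < 1" "0 \<le> Cm" "\<forall>x. (\<integral>w. \<bar>a w * x + b w\<bar> powr \<alpha> \<partial>M) \<le> r * \<bar>x\<bar> powr \<alpha> + Cm"
    using contraction by blast
  define G where "G = \<bar>corr1\<bar> + \<bar>corr2\<bar>"
  have G: "G \<ge> 0" "\<And>x. \<bar>corr x\<bar> \<le> G * (1 + x\<^sup>2)" using corr_bound by (auto simp: G_def)
  define K where "K = Ci + 2 * G * (1 + Ci)"
  have K: "K \<ge> 0" using Ci G by (simp add: K_def)
  define C where "C = K * (2 + Cm) + (1 + 2 * G)"
  have C: "C \<ge> 0" using K Cm G by (simp add: C_def)
  have "\<bar>transit (perturbed u s) x y - perturbed u (Suc s) x y\<bar> \<le> C * D * N powr (- (\<alpha> / 2)) * (1 + \<bar>x\<bar> powr \<alpha>)"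
    if N: "1 \<le> N" and u: "heat_family sig2 N D u" for N D u s x y
  proof -
    let ?e = "D * N powr (- (\<alpha> / 2))" and ?z = "y + \<rho> * x"
    have D: "D \<ge> 0"
    proof -
      have "D * N powr (- (real 0 / 2)) \<ge> 0" using heat_family_bound[OF u, of 0 0 0] by (meson abs_ge_zero order_trans zero_le)
      then show ?thesis using N by (simp add: zero_le_mult_iff)
    qed
    have N0: "N > 0" using N by simp
    have sq: "sqrt N = N powr (1/2)" using N0 by (simp add: powr_half_sqrt)
    \<comment> \<open>What remains of the perturbed function after removing the linear part and the
      averaged quadratic part: a Taylor remainder, and the corrector at the new position times the
      variation of the second derivative.\<close>
    define R where "R w = (u 0 s (?z + incr x w) - u 0 s ?z - u 1 s ?z * incr x w - u 2 s ?z / 2 * (incr x w)\<^sup>2)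
        + corr (a w * x + b w) / 2 * (u 2 s (?z + incr x w) - u 2 s ?z)" for w
    note Taylor = Taylor_three_bound[of "u 0 s" "u 1 s" "u 2 s" "u 3 s" "D * N powr - 1" "D * N powr (- (3/2))"]
    have der: "(u 0 s has_real_derivative u 1 s z) (at z)" "(u 1 s has_real_derivative u 2 s z) (at z)"
        "(u 2 s has_real_derivative u 3 s z) (at z)" for z
      using heat_family_deriv[OF u, of 0 s z] heat_family_deriv[OF u, of 1 s z] heat_family_deriv[OF u, of 2 s z]
      by (auto simp: numeral_2_eq_2 numeral_3_eq_3)
    have bd: "\<bar>u 2 s z\<bar> \<le> D * N powr - 1" "\<bar>u 3 s z\<bar> \<le> D * N powr (- (3/2))" for z
      using heat_family_bound[OF u, of 2 s z] heat_family_bound[OF u, of 3 s z] by auto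
    have R: "\<bar>R w\<bar> \<le> K * ?e * (1 + \<bar>a w * x + b w\<bar> powr \<alpha> + \<bar>x\<bar> powr \<alpha>)" for w
    proof -
      let ?i = "\<bar>incr x w\<bar>" and ?x = "a w * x + b w"
      \<comment> \<open>In the scaled increment the two competing bounds become
        \<open>D * ?t ^ 2\<close> and \<open>D * ?t ^ 3\<close>, ready for interpolation at the
        exponent \<alpha>.\<close>
      let ?t = "?i / sqrt N"
      let ?S = "1 + \<bar>?x\<bar> powr \<alpha> + \<bar>x\<bar> powr \<alpha>"
      have tp: "?t powr p = ?i powr p * N powr (- (p / 2))" for p
        unfolding sq using N0 by (simp add: powr_divide powr_powr powr_minus field_simps)
      have iS: "?i powr \<alpha> \<le> Ci * ?S"
        using Ci(2)[rule_format, of x w] Ci(1) by (simp add: distrib_left)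
      have S0: "?S \<ge> 1" by simp
      have "min (D * N powr - 1 * (incr x w)\<^sup>2) (D * N powr (- (3/2)) * ?i ^ 3) = D * min (?t ^ 2) (?t ^ Suc 2)"
      proof -
        have "D * N powr - 1 * (incr x w)\<^sup>2 = D * ?t ^ 2"
          using N0 by (simp add: power_divide powr_minus field_simps)
        moreover have "D * N powr (- (3/2)) * ?i ^ 3 = D * ?t ^ Suc 2"
        proof -
          have "sqrt N ^ 3 = N powr (3/2)" unfolding sq using N0
            by (simp add: powr_realpow[symmetric] powr_powr)
          then show ?thesis using N0
            by (simp add: power_divide powr_minus field_simps numeral_3_eq_3[symmetric] del: power_Suc)
        qed
        ultimately show ?thesis using D by (simp only: min_mult_distrib_left if_True)
      qed
      also have "\<dots> \<le> D * ?t powr \<alpha>"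
        using \<alpha>_gt \<alpha>_le N0 D by (intro mult_left_mono min_powr_interpolate) auto
      also have "\<dots> = ?e * ?i powr \<alpha>" unfolding tp by (simp only: mult_ac)
      also have "\<dots> \<le> ?e * (Ci * ?S)" using D iS by (intro mult_left_mono) auto
      finally have R1: "\<bar>u 0 s (?z + incr x w) - u 0 s ?z - u 1 s ?z * incr x w - u 2 s ?z / 2 * (incr x w)\<^sup>2\<bar> \<le> ?e * (Ci * ?S)"
        using Taylor(1)[OF der bd, of ?z "incr x w"] by (meson order_trans)
      have "\<bar>u 2 s (?z + incr x w) - u 2 s ?z\<bar> \<le> min (2 * (D * N powr - 1)) (D * N powr (- (3/2)) * ?i)"
        by (rule Taylor(2)[OF der bd])
      also have "\<dots> \<le> 2 * (D * N powr - 1) * min (?t ^ 0) (?t ^ Suc 0)"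
      proof -
        have "D * N powr (- (3/2)) * ?i = D * N powr - 1 * ?t"
        proof -
          have "N powr (- (3/2)) = N powr (-1 + - (1/2))" by (rule arg_cong) simp
          also have "\<dots> = N powr (-1) * N powr (- (1/2))" by (rule powr_add)
          also have "N powr (- (1/2)) = 1 / sqrt N" unfolding sq by (rule powr_minus_divide)
          finally show ?thesis by (simp only: times_divide_eq_right times_divide_eq_left mult_ac mult_1)
        qed
        moreover have "0 \<le> D * N powr - 1 * ?t" using D N0 by simp
        ultimately have "min (2 * (D * N powr - 1)) (D * N powr (- (3/2)) * ?i) \<le> min (2 * (D * N powr - 1) * 1) (2 * (D * N powr - 1) * ?t)"
          by (intro min.mono) auto
        also have "\<dots> = 2 * (D * N powr - 1) * min 1 ?t"
          using D by (subst min_mult_distrib_left) auto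
        finally show ?thesis by simp
      qed
      also have "\<dots> \<le> 2 * (D * N powr - 1) * ?t powr (\<alpha> - 2)"
        using \<alpha>_gt \<alpha>_le N0 D by (intro mult_left_mono min_powr_interpolate) auto
      also have "\<dots> = 2 * ?e * ?i powr (\<alpha> - 2)"
      proof -
        have "N powr (-1) * N powr (- ((\<alpha> - 2) / 2)) = N powr (- (\<alpha> / 2))"
          by (simp only: powr_add[symmetric]) (simp add: field_simps)
        then show ?thesis unfolding tp by (simp only: mult_ac flip: \<open>N powr (-1) * N powr (- ((\<alpha> - 2) / 2)) = N powr (- (\<alpha> / 2))\<close>)
      qed
      finally have du: "\<bar>u 2 s (?z + incr x w) - u 2 s ?z\<bar> \<le> 2 * ?e * ?i powr (\<alpha> - 2)" .
      have "\<bar>corr ?x / 2 * (u 2 s (?z + incr x w) - u 2 s ?z)\<bar> \<le> (G * (1 + ?x\<^sup>2) / 2) * (2 * ?e * ?i powr (\<alpha> - 2))"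
        unfolding abs_mult using G(2)[of ?x] G(1) du by (intro mult_mono) (auto simp: add_nonneg_nonneg)
      also have "\<dots> = G * ?e * ((1 + ?x\<^sup>2) * ?i powr (\<alpha> - 2))" by simp
      also have "\<dots> \<le> G * ?e * (2 * (1 + \<bar>?x\<bar> powr \<alpha> + ?i powr \<alpha>))"
        using G D by (intro mult_left_mono mixed_power_le) auto
      also have "\<dots> \<le> G * ?e * (2 * (?S + Ci * ?S))"
      proof -
        have "1 + \<bar>?x\<bar> powr \<alpha> + ?i powr \<alpha> \<le> ?S + Ci * ?S"
          using iS powr_ge_zero[of "\<bar>x\<bar>" \<alpha>] by linarith
        then show ?thesis using G D by (intro mult_left_mono) auto
      qed
      finally have "\<bar>R w\<bar> \<le> ?e * (Ci * ?S) + G * ?e * (2 * (?S + Ci * ?S))"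
        unfolding R_def using R1 by (intro order_trans[OF abs_triangle_ineq] add_mono)
      also have "\<dots> = K * ?e * ?S"
      proof -
        have "e * (Ci * S) + G * e * (2 * (S + Ci * S)) = (Ci + 2 * G * (1 + Ci)) * e * S" for e S :: real
          by (simp add: algebra_simps)
        then show ?thesis unfolding K_def by this
      qed
      finally show ?thesis .
    qed
    \<comment> \<open>The part with explicit mean: the linear term integrates to 0, and
      \<open>corr_poisson\<close> evaluates the quadratic one.\<close>
    let ?L = "\<lambda>w. (u 0 s ?z + u 1 s ?z * incr x w) + u 2 s ?z / 2 * ((incr x w)\<^sup>2 + corr (a w * x + b w))"
    have int1: "integrable M (\<lambda>w. perturbed u s (a w * x + b w) (y + (a w * x + b w)))"
      by (rule integrable_step[OF adm_perturbed[OF u]])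
    have int2: "integrable M ?L" using integrable_incr[of x] corr_poisson(1)[of x] by simp
    have eq: "perturbed u s (a w * x + b w) (y + (a w * x + b w)) - ?L w = R w" for w
      unfolding perturbed_def incr_shift R_def by (simp add: algebra_simps)
    have "transit (perturbed u s) x y - (\<integral>w. ?L w \<partial>M) = (\<integral>w. R w \<partial>M)"
      unfolding transit_def Bochner_Integration.integral_diff[OF int1 int2, symmetric] eq ..
    moreover have "(\<integral>w. ?L w \<partial>M) = u 0 s ?z + u 2 s ?z / 2 * (sig2 + corr x)"
      using integrable_incr[of x] corr_poisson[of x] mean_incr[of x] by (simp add: prob_space)
    moreover have "\<bar>\<integral>w. R w \<partial>M\<bar> \<le> K * ?e * (2 + Cm) * (1 + \<bar>x\<bar> powr \<alpha>)"
    proof -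
      have intR: "integrable M R"
        using Bochner_Integration.integrable_diff[OF int1 int2] unfolding eq .
      have intp: "integrable M (\<lambda>w. K * ?e * (1 + \<bar>a w * x + b w\<bar> powr \<alpha> + \<bar>x\<bar> powr \<alpha>))"
        using integrable_step_powr[of x] by simp
      have "\<bar>\<integral>w. R w \<partial>M\<bar> \<le> (\<integral>w. \<bar>R w\<bar> \<partial>M)" by (rule integral_abs_bound)
      also have "\<dots> \<le> (\<integral>w. K * ?e * (1 + \<bar>a w * x + b w\<bar> powr \<alpha> + \<bar>x\<bar> powr \<alpha>) \<partial>M)"
        using intR intp R by (intro integral_mono) auto
      also have "\<dots> = K * ?e * (1 + (\<integral>w. \<bar>a w * x + b w\<bar> powr \<alpha> \<partial>M) + \<bar>x\<bar> powr \<alpha>)"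
        using integrable_step_powr[of x] by (simp add: prob_space)
      also have "\<dots> \<le> K * ?e * ((2 + Cm) * (1 + \<bar>x\<bar> powr \<alpha>))"
      proof (rule mult_left_mono)
        have "r * \<bar>x\<bar> powr \<alpha> \<le> 1 * \<bar>x\<bar> powr \<alpha>" using Cm by (intro mult_right_mono) auto
        moreover have "0 \<le> Cm * \<bar>x\<bar> powr \<alpha>" using Cm by simp
        ultimately show "1 + (\<integral>w. \<bar>a w * x + b w\<bar> powr \<alpha> \<partial>M) + \<bar>x\<bar> powr \<alpha> \<le> (2 + Cm) * (1 + \<bar>x\<bar> powr \<alpha>)"
          using Cm(4)[rule_format, of x] by (simp add: algebra_simps)
      qed (use K D in simp)
      finally show ?thesis by (simp only: mult.assoc)
    qed
    moreover have "\<bar>u 0 s ?z + u 2 s ?z / 2 * (sig2 + corr x) - perturbed u (Suc s) x y\<bar> \<le> (1 + 2 * G) * ?e * (1 + \<bar>x\<bar> powr \<alpha>)"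
    proof -
      have t0: "\<bar>u 0 (Suc s) ?z - u 0 s ?z - sig2 / 2 * u 2 s ?z\<bar> \<le> D * N powr (- 2)"
        and t2: "\<bar>u 2 (Suc s) ?z - u 2 s ?z\<bar> \<le> D * N powr (- 2)"
        using u unfolding heat_family_def by blast+
      \<comment> \<open>The time discretisation error of order N^(-2) is within the allowed
        N^(-\<alpha>/2) because \<alpha> \<le> 3.\<close>
      have "N powr (- 2) \<le> N powr (- (\<alpha> / 2))" using N \<alpha>_le by (intro powr_mono) auto
      then have De: "D * N powr (- 2) \<le> ?e" using D by (rule mult_left_mono)
      have "u 0 s ?z + u 2 s ?z / 2 * (sig2 + corr x) - perturbed u (Suc s) x y
          = - (u 0 (Suc s) ?z - u 0 s ?z - sig2 / 2 * u 2 s ?z) - corr x / 2 * (u 2 (Suc s) ?z - u 2 s ?z)"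
        unfolding perturbed_def by (simp add: algebra_simps)
      then have "\<bar>u 0 s ?z + u 2 s ?z / 2 * (sig2 + corr x) - perturbed u (Suc s) x y\<bar>
          \<le> \<bar>u 0 (Suc s) ?z - u 0 s ?z - sig2 / 2 * u 2 s ?z\<bar> + \<bar>corr x / 2\<bar> * \<bar>u 2 (Suc s) ?z - u 2 s ?z\<bar>"
        unfolding abs_mult[symmetric] by linarith
      also have "\<dots> \<le> ?e + (G * (1 + x\<^sup>2)) * ?e"
      proof (intro add_mono mult_mono)
        show "\<bar>corr x / 2\<bar> \<le> G * (1 + x\<^sup>2)" using G(2)[of x] abs_ge_zero[of "corr x"] by simp
      qed (use t0 t2 De G D in auto)
      also have "\<dots> \<le> (1 * (1 + \<bar>x\<bar> powr \<alpha>)) * ?e + (G * (2 * (1 + \<bar>x\<bar> powr \<alpha>))) * ?e"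
      proof (intro add_mono mult_right_mono mult_left_mono)
        show "?e \<le> (1 * (1 + \<bar>x\<bar> powr \<alpha>)) * ?e" using mult_right_mono[of 1 "1 * (1 + \<bar>x\<bar> powr \<alpha>)" ?e] D by simp
        have "1 + s \<le> 2 * (1 + p)" if "s \<le> 1 + p" "0 \<le> p" for s p :: real using that by simp
        from this[OF square_le_powr powr_ge_zero] show "1 + x\<^sup>2 \<le> 2 * (1 + \<bar>x\<bar> powr \<alpha>)" .
      qed (use G D in auto)
      also have "\<dots> = (1 + 2 * G) * ?e * (1 + \<bar>x\<bar> powr \<alpha>)"
      proof -
        have "(1 * S) * e + (G * (2 * S)) * e = (1 + 2 * G) * e * S" for e S :: real
          by (simp add: algebra_simps)
        then show ?thesis by this
      qed
      finally show ?thesis .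
    qed
    moreover have "\<bar>t - q\<bar> \<le> A + B" if "t - l = r" "l = l'" "\<bar>r\<bar> \<le> A" "\<bar>l' - q\<bar> \<le> B" for t l l' r q A B :: real
      using that by linarith
    ultimately have "\<bar>transit (perturbed u s) x y - perturbed u (Suc s) x y\<bar> \<le>
        K * ?e * (2 + Cm) * (1 + \<bar>x\<bar> powr \<alpha>) + (1 + 2 * G) * ?e * (1 + \<bar>x\<bar> powr \<alpha>)"
      by blast
    also have "\<dots> = C * D * N powr (- (\<alpha> / 2)) * (1 + \<bar>x\<bar> powr \<alpha>)"
    proof -
      have "K * (D * e) * (2 + Cm) * S + (1 + 2 * G) * (D * e) * S = (K * (2 + Cm) + (1 + 2 * G)) * D * e * S" for e S
        by (simp add: algebra_simps)
      then show ?thesis unfolding C_def by this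
    qed
    finally show ?thesis .
  qed
  with C show ?thesis by blast
qed

text \<open>Telescoping in time: a path alive at time k sees the function at remaining time n - k,
  and a path that exits at time k + 1 leaves it at remaining time n - k - 1, whence the index
  \<open>n - Suc k\<close>. Each one-step error is weighted by moment and probability on survival at
  its time.\<close>

lemma perturbed_evolution:
  "\<exists>C\<ge>0. \<forall>N D u x y m n. 1 \<le> N \<longrightarrow> heat_family sig2 N D u \<longrightarrow> 0 < y \<longrightarrow> m \<le> n \<longrightarrow>
    \<bar>mean n (perturbed u 0) x y - mean m (perturbed u (n - m)) x y
      + (\<Sum>k=m..<n. mean k (exiting (perturbed u (n - Suc k))) x y)\<bar>
    \<le> C * D * N powr (- (\<alpha> / 2)) * (\<Sum>k=m..<n. moment k x y + surv k x y)"
proof -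
  obtain C where C: "C \<ge> 0" "\<forall>N D u s x y. 1 \<le> N \<longrightarrow> heat_family sig2 N D u \<longrightarrow>
    \<bar>transit (perturbed u s) x y - perturbed u (Suc s) x y\<bar> \<le> C * D * N powr (- (\<alpha> / 2)) * (1 + \<bar>x\<bar> powr \<alpha>)"
    using perturbed_step by blast
  have "\<bar>mean n (perturbed u 0) x y - mean m (perturbed u (n - m)) x y
      + (\<Sum>k=m..<n. mean k (exiting (perturbed u (n - Suc k))) x y)\<bar>
    \<le> C * D * N powr (- (\<alpha> / 2)) * (\<Sum>k=m..<n. moment k x y + surv k x y)"
    if N: "1 \<le> N" and u: "heat_family sig2 N D u" and y: "0 < y" and mn: "m \<le> n" for N D u x y m n
  proof -
    let ?c = "C * D * N powr (- (\<alpha> / 2))"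
    have one: "\<bar>mean (Suc k) (perturbed u s) x y - mean k (perturbed u (Suc s)) x y + mean k (exiting (perturbed u s)) x y\<bar>
        \<le> ?c * (moment k x y + surv k x y)" for k s
    proof -
      note adm = adm_perturbed[OF u]
      have eq: "mean (Suc k) (perturbed u s) x y - mean k (perturbed u (Suc s)) x y + mean k (exiting (perturbed u s)) x y
          = mean k (\<lambda>x y. transit (perturbed u s) x y - perturbed u (Suc s) x y) x y"
        using mean_transit[OF adm, of k s x y] by (simp add: mean_minus adm_transit adm)
      have "\<bar>mean k (\<lambda>x y. transit (perturbed u s) x y - perturbed u (Suc s) x y) x y\<bar> \<le> mean k (\<lambda>x y. ?c * 1 + ?c * (\<bar>x\<bar> powr \<alpha>)) x y"
      proof (rule mean_abs_le[OF _ _ _ y])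
        show "adm (\<lambda>x y. transit (perturbed u s) x y - perturbed u (Suc s) x y)"
          by (intro adm_diff adm_transit adm)
        show "adm (\<lambda>x y. ?c * 1 + ?c * (\<bar>x\<bar> powr \<alpha>))" by (intro adm_add adm_cmult adm_const adm_powr)
        show "\<bar>transit (perturbed u s) x y - perturbed u (Suc s) x y\<bar> \<le> ?c * 1 + ?c * (\<bar>x\<bar> powr \<alpha>)" for x y
          using C(2) N u by (simp only: distrib_left[symmetric])
      qed
      also have "\<dots> = ?c * surv k x y + ?c * moment k x y"
        unfolding moment_def surv_def by (subst mean_linear[OF adm_const adm_powr]) (rule refl)
      also have "\<dots> = ?c * (moment k x y + surv k x y)" by (simp only: distrib_left add.commute)
      finally show ?thesis unfolding eq .
    qed
    define T where "T j = mean j (perturbed u (n - j)) x y" for j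
    have tele: "T n - T m = (\<Sum>k=m..<n. T (Suc k) - T k)" using mn by (simp add: sum_Suc_diff')
    have eq: "T n - T m + (\<Sum>k=m..<n. mean k (exiting (perturbed u (n - Suc k))) x y)
        = (\<Sum>k=m..<n. T (Suc k) - T k + mean k (exiting (perturbed u (n - Suc k))) x y)"
      unfolding tele by (simp add: sum.distrib)
    have "\<bar>\<Sum>k=m..<n. T (Suc k) - T k + mean k (exiting (perturbed u (n - Suc k))) x y\<bar> \<le> (\<Sum>k=m..<n. ?c * (moment k x y + surv k x y))"
    proof (rule order_trans[OF sum_abs sum_mono])
      fix k assume k: "k \<in> {m..<n}"
      then have "Suc (n - Suc k) = n - k" by auto
      then show "\<bar>T (Suc k) - T k + mean k (exiting (perturbed u (n - Suc k))) x y\<bar> \<le> ?c * (moment k x y + surv k x y)"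
        using one[of k "n - Suc k"] by (simp add: T_def)
    qed
    then show ?thesis unfolding eq[symmetric] by (simp add: T_def sum_distrib_left)
  qed
  with C(1) show ?thesis by blast
qed

section \<open>Weights, the accumulated error and the evolution of bare test functions\<close>

definition wt :: "real \<Rightarrow> real" where "wt x = 1 + \<bar>x\<bar> powr \<alpha>"

lemma wt_ge_one: "1 \<le> wt x" by (simp add: wt_def)

lemma adm_wt: "adm (\<lambda>x y. wt x)"
  unfolding wt_def by (intro adm_add adm_const adm_powr)

lemma square_le_wt: "1 + x\<^sup>2 \<le> 2 * wt x"
proof -
  have "1 + s \<le> 2 * (1 + p)" if "s \<le> 1 + p" "0 \<le> p" for s p :: real using that by simp
  from this[OF square_le_powr powr_ge_zero] show ?thesis unfolding wt_def .
qed

lemma mean_wt_bound: "\<exists>C\<ge>0. \<forall>n x y. 0 < y \<longrightarrow> mean n (\<lambda>x y. wt x) x y \<le> C * wt x"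
proof -
  obtain C where C: "C \<ge> 0" "\<forall>x y. 0 < y \<longrightarrow> (\<forall>n. moment n x y \<le> C * (1 + \<bar>x\<bar> powr \<alpha>))"
    using moment_bounds by blast
  have "mean n (\<lambda>x y. wt x) x y \<le> (1 + C) * wt x" if y: "0 < y" for n x y
  proof -
    have "mean n (\<lambda>x y. wt x) x y = surv n x y + moment n x y"
      unfolding wt_def surv_def moment_def by (rule mean_plus[OF adm_const adm_powr])
    also have "\<dots> \<le> 1 + C * wt x"
      using surv_le_one[OF y, of n x] C(2) y unfolding wt_def by (intro add_mono) auto
    also have "\<dots> \<le> (1 + C) * wt x" using wt_ge_one[of x] by (simp add: distrib_right)
    finally show ?thesis .
  qed
  moreover have "1 + C \<ge> 0" using C by simp
  ultimately show ?thesis by blast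
qed

text \<open>The two sources of error in \<open>evolution\<close>. The part with N^(-1) is the
  corrector at both ends of the window and at exit, where the squared position is truncated at
  \<open>l\<close>; the part with N^(-\<alpha>/2) is the sum of the one-step errors along surviving
  paths.\<close>

definition err :: "real \<Rightarrow> real \<Rightarrow> nat \<Rightarrow> real \<Rightarrow> real \<Rightarrow> real" where
  "err N l n x y = N powr (- 1) * (wt x + l * exit_abs n x y + l powr (2 - \<alpha>) * (wt x + (\<Sum>k<n. surv k x y)))
     + N powr (- (\<alpha> / 2)) * (wt x + (\<Sum>k<n. surv k x y))"

lemma sum_surv_nonneg: "0 < y \<Longrightarrow> 0 \<le> (\<Sum>k\<in>A. surv k x y)"
  by (intro sum_nonneg surv_nonneg)

lemma err_nonneg: "0 < y \<Longrightarrow> 0 \<le> l \<Longrightarrow> 0 \<le> err N l n x y"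
  unfolding err_def using wt_ge_one[of x] sum_surv_nonneg[of y x "{..<n}"] exit_abs_nonneg[of y n x]
  by (intro add_nonneg_nonneg mult_nonneg_nonneg) auto

text \<open>The free parameter \<open>l\<close> is a truncation level for the position at the exit time.\<close>

lemma evolution:
  "\<exists>C\<ge>0. \<forall>N D u x y m n l. 1 \<le> N \<longrightarrow> heat_family sig2 N D u \<longrightarrow> 0 < y \<longrightarrow> m \<le> n \<longrightarrow> 0 < l \<longrightarrow>
    \<bar>mean n (\<lambda>x y. u 0 0 (y + \<rho> * x)) x y - mean m (\<lambda>x y. u 0 (n - m) (y + \<rho> * x)) x y
      + (\<Sum>k=m..<n. mean k (exiting (\<lambda>x y. u 0 (n - Suc k) (y + \<rho> * x))) x y)\<bar>
    \<le> C * D * err N l n x y"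
proof -
  obtain C0 where C0: "C0 \<ge> 0" "\<forall>N D u x y m n. 1 \<le> N \<longrightarrow> heat_family sig2 N D u \<longrightarrow> 0 < y \<longrightarrow> m \<le> n \<longrightarrow>
    \<bar>mean n (perturbed u 0) x y - mean m (perturbed u (n - m)) x y
      + (\<Sum>k=m..<n. mean k (exiting (perturbed u (n - Suc k))) x y)\<bar>
    \<le> C0 * D * N powr (- (\<alpha> / 2)) * (\<Sum>k=m..<n. moment k x y + surv k x y)"
    using perturbed_evolution by blast
  obtain C1 where C1: "C1 \<ge> 0" "\<forall>x y. 0 < y \<longrightarrow>
      (\<forall>m n. (\<Sum>k=m..<n. moment k x y + surv k x y) \<le> C1 * (1 + \<bar>x\<bar> powr \<alpha> + (\<Sum>k=m..<n. surv k x y)))"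
    using moment_bounds by blast
  obtain C2 where C2: "C2 \<ge> 0" "\<forall>x y l. \<forall>n::nat. 0 < y \<longrightarrow> 0 < l \<longrightarrow>
    (\<Sum>k<n. mean k (exiting (\<lambda>x y. 1 + x\<^sup>2)) x y) \<le> 1 + l * exit_abs n x y
      + l powr (2 - \<alpha>) * (C2 * (1 + \<bar>x\<bar> powr \<alpha> + (\<Sum>k<n. surv k x y)))"
    using exit_square_sum by blast
  obtain C3 where C3: "C3 \<ge> 0" "\<forall>n x y. 0 < y \<longrightarrow> mean n (\<lambda>x y. wt x) x y \<le> C3 * wt x"
    using mean_wt_bound by blast
  define G where "G = \<bar>corr1\<bar> + \<bar>corr2\<bar>"
  have G: "G \<ge> 0" "\<And>x. \<bar>corr x\<bar> \<le> G * (1 + x\<^sup>2)" using corr_bound by (auto simp: G_def)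
  define C where "C = C0 * C1 + 4 * G * C3 + G * (1 + C2)"
  have C: "C \<ge> 0" using C0(1) C1(1) C2(1) C3(1) G(1) by (simp add: C_def)
  have "\<bar>mean n (\<lambda>x y. u 0 0 (y + \<rho> * x)) x y - mean m (\<lambda>x y. u 0 (n - m) (y + \<rho> * x)) x y
      + (\<Sum>k=m..<n. mean k (exiting (\<lambda>x y. u 0 (n - Suc k) (y + \<rho> * x))) x y)\<bar>
    \<le> C * D * err N l n x y"
    if N: "1 \<le> N" and u: "heat_family sig2 N D u" and y: "0 < y" and mn: "m \<le> n" and l: "0 < l"
    for N D u x y m n l
  proof -
    have D: "D \<ge> 0"
    proof -
      have "D * N powr (- (real 0 / 2)) \<ge> 0" using heat_family_bound[OF u, of 0 0 0] by (meson abs_ge_zero order_trans zero_le)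
      then show ?thesis using N by (simp add: zero_le_mult_iff)
    qed
    let ?P = "\<Sum>k<n. surv k x y"
    have P: "?P \<ge> 0" by (rule sum_surv_nonneg[OF y])
    \<comment> \<open>\<open>f\<close> is the bare test function and \<open>g\<close> the corrector.
      The estimate at hand concerns their sum, so the claim for \<open>f\<close> follows from bounds
      on \<open>g\<close>.\<close>
    define f where "f s = (\<lambda>x y. u 0 s (y + \<rho> * x))" for s
    define g where "g s = (\<lambda>x y. corr x / 2 * u 2 s (y + \<rho> * x))" for s
    have af: "adm (f s)" for s unfolding f_def by (rule adm_family[OF u]) simp
    have ag: "adm (g s)" for s unfolding g_def by (rule adm_corr_family[OF u])
    have pert: "perturbed u s = (\<lambda>x y. f s x y + g s x y)" for s
      by (simp add: perturbed_def f_def g_def fun_eq_iff)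
    let ?d = "G * (D * N powr - 1)"
    have d: "?d \<ge> 0" using G D by simp
    have g_le: "\<bar>g s x y\<bar> \<le> ?d * (1 + x\<^sup>2)" for s x y
    proof -
      have "\<bar>corr x / 2\<bar> \<le> G * (1 + x\<^sup>2)" using G(2)[of x] abs_ge_zero[of "corr x"] by simp
      then have "\<bar>corr x / 2\<bar> * \<bar>u 2 s (y + \<rho> * x)\<bar> \<le> (G * (1 + x\<^sup>2)) * (D * N powr - 1)"
        using heat_family_bound[OF u, of 2 s] by (intro mult_mono) auto
      then show ?thesis unfolding g_def abs_mult by (simp only: mult_ac)
    qed
    have g_mean: "\<bar>mean k (g s) x y\<bar> \<le> ?d * (2 * (C3 * wt x))" for k s
    proof -
      have "\<bar>mean k (g s) x y\<bar> \<le> mean k (\<lambda>x y. (?d * 2) * wt x) x y"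
      proof (rule mean_abs_le[OF ag _ _ y])
        show "adm (\<lambda>x y. (?d * 2) * wt x)" by (intro adm_cmult adm_wt)
        show "\<bar>g s x y\<bar> \<le> (?d * 2) * wt x" for x y
          using order_trans[OF g_le mult_left_mono[OF square_le_wt d]] by (simp only: mult.assoc)
      qed
      also have "\<dots> = (?d * 2) * mean k (\<lambda>x y. wt x) x y" by (rule mean_cmult[OF adm_wt])
      also have "\<dots> \<le> (?d * 2) * (C3 * wt x)" using C3 y G(1) D by (intro mult_left_mono) auto
      finally show ?thesis by (simp only: mult.assoc)
    qed
    have as: "adm (\<lambda>x y. 1 + x\<^sup>2)" by (intro adm_add adm_const adm_square)
    have g_exit: "\<bar>mean k (exiting (g s)) x y\<bar> \<le> ?d * mean k (exiting (\<lambda>x y. 1 + x\<^sup>2)) x y" for k s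
    proof -
      have "\<bar>mean k (exiting (g s)) x y\<bar> \<le> mean k (\<lambda>x y. ?d * exiting (\<lambda>x y. 1 + x\<^sup>2) x y) x y"
      proof (rule mean_abs_le[OF adm_exiting[OF ag] adm_cmult[OF adm_exiting[OF as]] _ y])
        fix x y :: real assume y: "0 < y"
        have "exiting (g s) x y \<le> exiting (\<lambda>x y. ?d * (1 + x\<^sup>2)) x y"
          using g_le by (intro exiting_mono ag adm_cmult as y) (simp add: abs_le_iff)
        moreover have "exiting (\<lambda>x y. (- 1) * g s x y) x y \<le> exiting (\<lambda>x y. ?d * (1 + x\<^sup>2)) x y"
          using g_le by (intro exiting_mono ag adm_cmult as y) (simp add: abs_le_iff)
        ultimately show "\<bar>exiting (g s) x y\<bar> \<le> ?d * exiting (\<lambda>x y. 1 + x\<^sup>2) x y"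
          unfolding exiting_cmult[OF ag] exiting_cmult[OF as] by (simp add: abs_le_iff)
      qed
      then show ?thesis by (simp only: mean_cmult[OF adm_exiting[OF as]])
    qed
    have mp: "mean k (perturbed u s) x y = mean k (f s) x y + mean k (g s) x y" for k s
      unfolding pert by (rule mean_plus[OF af ag])
    have ep: "mean k (exiting (perturbed u s)) x y = mean k (exiting (f s)) x y + mean k (exiting (g s)) x y" for k s
    proof -
      have "exiting (perturbed u s) = (\<lambda>x y. exiting (f s) x y + exiting (g s) x y)"
        unfolding pert using exiting_plus[OF af ag] by blast
      then show ?thesis by (simp add: mean_plus adm_exiting af ag)
    qed
    let ?X = "mean n (f 0) x y - mean m (f (n - m)) x y + (\<Sum>k=m..<n. mean k (exiting (f (n - Suc k))) x y)"
    let ?Y = "mean n (g 0) x y - mean m (g (n - m)) x y + (\<Sum>k=m..<n. mean k (exiting (g (n - Suc k))) x y)"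
    let ?B1 = "C0 * D * N powr (- (\<alpha> / 2)) * (\<Sum>k=m..<n. moment k x y + surv k x y)"
    have XY: "\<bar>?X + ?Y\<bar> \<le> ?B1"
      using C0(2)[rule_format, OF N u y mn, of x] unfolding mp ep sum.distrib by (simp add: algebra_simps)
    have B1: "?B1 \<le> C0 * D * N powr (- (\<alpha> / 2)) * (C1 * (wt x + ?P))"
    proof (rule mult_left_mono)
      have "(\<Sum>k=m..<n. surv k x y) \<le> ?P" by (intro sum_mono2 surv_nonneg y) auto
      then have "C1 * (1 + \<bar>x\<bar> powr \<alpha> + (\<Sum>k=m..<n. surv k x y)) \<le> C1 * (wt x + ?P)"
        unfolding wt_def using C1(1) by (intro mult_left_mono) auto
      then show "(\<Sum>k=m..<n. moment k x y + surv k x y) \<le> C1 * (wt x + ?P)"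
        using C1(2) y by (meson order_trans)
    qed (use C0 D in simp)
    let ?S = "\<Sum>k<n. mean k (exiting (\<lambda>x y. 1 + x\<^sup>2)) x y"
    have "\<bar>\<Sum>k=m..<n. mean k (exiting (g (n - Suc k))) x y\<bar> \<le> (\<Sum>k=m..<n. ?d * mean k (exiting (\<lambda>x y. 1 + x\<^sup>2)) x y)"
      by (rule order_trans[OF sum_abs sum_mono]) (rule g_exit)
    also have "\<dots> \<le> (\<Sum>k<n. ?d * mean k (exiting (\<lambda>x y. 1 + x\<^sup>2)) x y)"
      using G(1) D as y by (intro sum_mono2 mult_nonneg_nonneg mean_exiting_nonneg) auto
    also have "\<dots> = ?d * ?S" by (rule sum_distrib_left[symmetric])
    finally have "\<bar>?Y\<bar> \<le> ?d * (2 * (C3 * wt x)) + ?d * (2 * (C3 * wt x)) + ?d * ?S"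
      using g_mean[of n 0] g_mean[of m "n - m"] by linarith
    moreover have "?S \<le> wt x + l * exit_abs n x y + l powr (2 - \<alpha>) * (C2 * (wt x + ?P))"
      using C2(2)[rule_format, OF y l, of x n] wt_ge_one[of x] unfolding wt_def by linarith
    then have "?d * ?S \<le> ?d * (wt x + l * exit_abs n x y + l powr (2 - \<alpha>) * (C2 * (wt x + ?P)))"
      using d by (rule mult_left_mono)
    ultimately have Y: "\<bar>?Y\<bar> \<le> ?d * (4 * (C3 * wt x)) + ?d * (wt x + l * exit_abs n x y + l powr (2 - \<alpha>) * (C2 * (wt x + ?P)))"
      by linarith
    have X: "\<bar>?X\<bar> \<le> C0 * D * N powr (- (\<alpha> / 2)) * (C1 * (wt x + ?P))
        + (?d * (4 * (C3 * wt x)) + ?d * (wt x + l * exit_abs n x y + l powr (2 - \<alpha>) * (C2 * (wt x + ?P))))"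
    proof -
      have "\<bar>X\<bar> \<le> B + E" if "\<bar>X + Y\<bar> \<le> B'" "B' \<le> B" "\<bar>Y\<bar> \<le> E" for X Y B B' E :: real using that by linarith
      from this[OF XY B1 Y] show ?thesis .
    qed
    also have "\<dots> \<le> C * D * err N l n x y"
    proof -
      have alg: "C0 * D * N2 * (C1 * (w + P)) + (G * (D * N1) * (4 * (C3 * w)) + G * (D * N1) * (w + lH + lp * (C2 * (w + P))))
          \<le> (C0 * C1 + 4 * G * C3 + G * (1 + C2)) * D * (N1 * (w + lH + lp * (w + P)) + N2 * (w + P))"
        if nn: "0 \<le> N1" "0 \<le> N2" "0 \<le> w" "0 \<le> P" "0 \<le> lH" "0 \<le> lp" for N1 N2 w P lH lp :: real
      proof -
        let ?U = "w + lH + lp * (w + P)"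
        let ?E = "N1 * ?U + N2 * (w + P)"
        have U: "0 \<le> ?U" using nn by simp
        have 1: "N2 * (w + P) \<le> ?E" using nn by simp
        have 2: "N1 * w \<le> ?E"
          using nn by (simp add: distrib_left add_nonneg_nonneg add.assoc)
        have 3: "N1 * ?U \<le> ?E" using nn by simp
        have 4: "w + lH + lp * (C2 * (w + P)) \<le> (1 + C2) * ?U"
          using nn C2(1) by (simp add: algebra_simps add_nonneg_nonneg)
        have "C0 * D * N2 * (C1 * (w + P)) = C0 * C1 * D * (N2 * (w + P))" by (simp only: mult_ac)
        also have "\<dots> \<le> C0 * C1 * D * ?E" using 1 C0(1) C1(1) D by (intro mult_left_mono) auto
        finally have a: "C0 * D * N2 * (C1 * (w + P)) \<le> C0 * C1 * D * ?E" .
        have "G * (D * N1) * (4 * (C3 * w)) = 4 * G * C3 * D * (N1 * w)" by (simp only: mult_ac)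
        also have "\<dots> \<le> 4 * G * C3 * D * ?E" using 2 G(1) C3(1) D by (intro mult_left_mono) auto
        finally have b: "G * (D * N1) * (4 * (C3 * w)) \<le> 4 * G * C3 * D * ?E" .
        have "G * (D * N1) * (w + lH + lp * (C2 * (w + P))) \<le> G * (D * N1) * ((1 + C2) * ?U)"
          using 4 G(1) D nn by (intro mult_left_mono) auto
        also have "\<dots> = G * (1 + C2) * D * (N1 * ?U)" by (simp only: mult_ac)
        also have "\<dots> \<le> G * (1 + C2) * D * ?E" using 3 G(1) C2(1) D by (intro mult_left_mono) auto
        finally have c: "G * (D * N1) * (w + lH + lp * (C2 * (w + P))) \<le> G * (1 + C2) * D * ?E" .
        have "(p + q + r) * D * E = p * D * E + q * D * E + r * D * E" for p q r E :: real
          by (simp only: distrib_right)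
        with a b c show ?thesis by (simp only: add_mono add.assoc)
      qed
      show ?thesis unfolding C_def err_def
        using wt_ge_one[of x] P l exit_abs_nonneg[OF y, of n x] by (intro alg) auto
    qed
    finally show ?thesis unfolding f_def .
  qed
  with C show ?thesis by blast
qed

lemma heat_family_lipschitz:
  assumes "heat_family v N D u" and "u 0 s 0 = 0"
  shows "\<bar>u 0 s z\<bar> \<le> D * N powr (- (1 / 2)) * \<bar>z\<bar>"
  using field_differentiable_bound[of UNIV "u 0 s" "u 1 s" "D * N powr (- (1 / 2))" z 0]
    heat_family_deriv[OF assms(1), of 0 s] heat_family_bound[OF assms(1), of 1 s] assms(2)
  by (simp add: has_field_derivative_at_within)

text \<open>At exit |Z| is at most (1 + |\<rho>|) times the last position, and a function that
  vanishes at 0 with slope of order N^(-1/2) is small there. Killing an odd solution is therefore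
  cheap.\<close>

lemma exiting_odd_bound:
  assumes u: "heat_family sig2 N D u" and odd: "\<And>s. u 0 s 0 = 0" and D: "0 \<le> D" and y: "0 < y"
  shows "\<bar>mean k (exiting (\<lambda>x y. u 0 s (y + \<rho> * x))) x y\<bar>
    \<le> D * N powr (- (1 / 2)) * (1 + \<bar>\<rho>\<bar>) * mean k (exiting (\<lambda>x y. \<bar>x\<bar>)) x y"
proof -
  let ?d = "D * N powr (- (1 / 2)) * (1 + \<bar>\<rho>\<bar>)"
  have d: "?d \<ge> 0" using D by simp
  note lip = heat_family_lipschitz[OF u odd]
  have bd: "\<bar>u 0 s (y + \<rho> * x)\<bar> \<le> ?d * \<bar>x\<bar>" if "y \<le> 0" "x \<le> y" for x y
  proof -
    have "\<bar>y + \<rho> * x\<bar> \<le> \<bar>y\<bar> + \<bar>\<rho>\<bar> * \<bar>x\<bar>" using abs_triangle_ineq[of y "\<rho> * x"] by (simp add: abs_mult)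
    also have "\<dots> \<le> \<bar>x\<bar> + \<bar>\<rho>\<bar> * \<bar>x\<bar>" using that by simp
    also have "\<dots> = (1 + \<bar>\<rho>\<bar>) * \<bar>x\<bar>" by (simp add: distrib_right)
    finally have "D * N powr (- (1 / 2)) * \<bar>y + \<rho> * x\<bar> \<le> D * N powr (- (1 / 2)) * ((1 + \<bar>\<rho>\<bar>) * \<bar>x\<bar>)"
      using D by (intro mult_left_mono) auto
    with lip[of s "y + \<rho> * x"] show ?thesis by (simp only: mult.assoc)
  qed
  have af: "adm (\<lambda>x y. u 0 s (y + \<rho> * x))" by (rule adm_family[OF u]) simp
  have "\<bar>mean k (exiting (\<lambda>x y. u 0 s (y + \<rho> * x))) x y\<bar> \<le> mean k (\<lambda>x y. ?d * exiting (\<lambda>x y. \<bar>x\<bar>) x y) x y"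
  proof (rule mean_abs_le[OF adm_exiting[OF af] adm_cmult[OF adm_exiting[OF adm_abs]] _ y])
    fix x y :: real assume y: "0 < y"
    have "exiting (\<lambda>x y. u 0 s (y + \<rho> * x)) x y \<le> exiting (\<lambda>x y. ?d * \<bar>x\<bar>) x y"
      using bd by (intro exiting_mono af adm_cmult adm_abs y) (simp add: abs_le_iff)
    moreover have "exiting (\<lambda>x y. (- 1) * u 0 s (y + \<rho> * x)) x y \<le> exiting (\<lambda>x y. ?d * \<bar>x\<bar>) x y"
      using bd by (intro exiting_mono af adm_cmult adm_abs y) (simp add: abs_le_iff)
    ultimately show "\<bar>exiting (\<lambda>x y. u 0 s (y + \<rho> * x)) x y\<bar> \<le> ?d * exiting (\<lambda>x y. \<bar>x\<bar>) x y"
      unfolding exiting_cmult[OF af] exiting_cmult[OF adm_abs] by (simp add: abs_le_iff)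
  qed
  then show ?thesis by (simp only: mean_cmult[OF adm_exiting[OF adm_abs]])
qed

section \<open>Bounds for the survival probability\<close>

text \<open>\<open>evolution\<close> from time 0, with the initial value and the exit terms both
  estimated by the slope at the origin. Up to \<open>err\<close>, an odd profile has mean of order
  N^(-1/2) on survival as soon as the overshoot is under control.\<close>

lemma odd_mean_bound:
  "\<exists>C\<ge>0. \<forall>N D u x y n l. 1 \<le> N \<longrightarrow> heat_family sig2 N D u \<longrightarrow> (\<forall>s. u 0 s 0 = 0) \<longrightarrow> 0 \<le> D \<longrightarrow> 0 < y \<longrightarrow> 0 < l \<longrightarrow>
    \<bar>mean n (\<lambda>x y. u 0 0 (y + \<rho> * x)) x y\<bar> \<le> C * D * (N powr (- (1 / 2)) * (y + \<bar>x\<bar> + exit_abs n x y) + err N l n x y)"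
proof -
  obtain C0 where C0: "C0 \<ge> 0" "\<forall>N D u x y m n l. 1 \<le> N \<longrightarrow> heat_family sig2 N D u \<longrightarrow> 0 < y \<longrightarrow> m \<le> n \<longrightarrow> 0 < l \<longrightarrow>
    \<bar>mean n (\<lambda>x y. u 0 0 (y + \<rho> * x)) x y - mean m (\<lambda>x y. u 0 (n - m) (y + \<rho> * x)) x y
      + (\<Sum>k=m..<n. mean k (exiting (\<lambda>x y. u 0 (n - Suc k) (y + \<rho> * x))) x y)\<bar>
    \<le> C0 * D * err N l n x y"
    using evolution by blast
  define C where "C = C0 + (1 + \<bar>\<rho>\<bar>)"
  have "\<bar>mean n (\<lambda>x y. u 0 0 (y + \<rho> * x)) x y\<bar> \<le> C * D * (N powr (- (1 / 2)) * (y + \<bar>x\<bar> + exit_abs n x y) + err N l n x y)"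
    if N: "1 \<le> N" and u: "heat_family sig2 N D u" and odd: "\<forall>s. u 0 s 0 = 0" and D: "0 \<le> D" and y: "0 < y" and l: "0 < l"
    for N D u x y n l
  proof -
    let ?d = "D * N powr (- (1 / 2)) * (1 + \<bar>\<rho>\<bar>)" and ?Z = "N powr (- (1 / 2)) * (y + \<bar>x\<bar> + exit_abs n x y)"
    have d: "?d \<ge> 0" using D by simp
    have 1: "\<bar>mean n (\<lambda>x y. u 0 0 (y + \<rho> * x)) x y - u 0 n (y + \<rho> * x)
      + (\<Sum>k=0..<n. mean k (exiting (\<lambda>x y. u 0 (n - Suc k) (y + \<rho> * x))) x y)\<bar> \<le> C0 * D * err N l n x y"
      using C0(2)[rule_format, OF N u y le0 l, of n x] by simp
    have 2: "\<bar>u 0 n (y + \<rho> * x)\<bar> \<le> ?d * (y + \<bar>x\<bar>)"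
    proof -
      have "\<bar>y + \<rho> * x\<bar> \<le> y + \<bar>\<rho>\<bar> * \<bar>x\<bar>" using abs_triangle_ineq[of y "\<rho> * x"] y by (simp add: abs_mult)
      also have "\<dots> \<le> (1 + \<bar>\<rho>\<bar>) * (y + \<bar>x\<bar>)" using y by (simp add: algebra_simps)
      finally have "D * N powr (- (1 / 2)) * \<bar>y + \<rho> * x\<bar> \<le> D * N powr (- (1 / 2)) * ((1 + \<bar>\<rho>\<bar>) * (y + \<bar>x\<bar>))"
        using D by (intro mult_left_mono) auto
      with heat_family_lipschitz[of sig2 N D u n "y + \<rho> * x", OF u odd[rule_format]]
      have "\<bar>u 0 n (y + \<rho> * x)\<bar> \<le> D * N powr (- (1 / 2)) * ((1 + \<bar>\<rho>\<bar>) * (y + \<bar>x\<bar>))" by (rule order_trans)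
      then show ?thesis by (simp only: mult.assoc)
    qed
    have "\<bar>\<Sum>k=0..<n. mean k (exiting (\<lambda>x y. u 0 (n - Suc k) (y + \<rho> * x))) x y\<bar>
        \<le> (\<Sum>k=0..<n. ?d * mean k (exiting (\<lambda>x y. \<bar>x\<bar>)) x y)"
      by (rule order_trans[OF sum_abs sum_mono]) (rule exiting_odd_bound[OF u odd[rule_format] D y])
    also have "\<dots> = ?d * exit_abs n x y"
      unfolding exit_abs_def lessThan_atLeast0 by (rule sum_distrib_left[symmetric])
    finally have 3: "\<bar>\<Sum>k=0..<n. mean k (exiting (\<lambda>x y. u 0 (n - Suc k) (y + \<rho> * x))) x y\<bar> \<le> ?d * exit_abs n x y" .
    have "\<bar>a\<bar> \<le> e + d1 + d2" if "\<bar>a - b + s\<bar> \<le> e" "\<bar>b\<bar> \<le> d1" "\<bar>s\<bar> \<le> d2" for a b s e d1 d2 :: real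
      using that by linarith
    from this[OF 1 2 3] have "\<bar>mean n (\<lambda>x y. u 0 0 (y + \<rho> * x)) x y\<bar> \<le> C0 * D * err N l n x y + ?d * (y + \<bar>x\<bar>) + ?d * exit_abs n x y" .
    also have "\<dots> = C0 * D * err N l n x y + (1 + \<bar>\<rho>\<bar>) * D * ?Z"
    proof -
      have "e + D * p * r * s + D * p * r * t = e + r * D * (p * (s + t))" for e p r s t
        by (simp add: algebra_simps)
      then show ?thesis by this
    qed
    also have "\<dots> \<le> C * D * err N l n x y + C * D * ?Z"
      using C0(1) D err_nonneg[OF y less_imp_le[OF l], of N n x] y exit_abs_nonneg[OF y, of n x]
      by (intro add_mono mult_right_mono) (auto simp: C_def)
    finally show ?thesis by (simp only: distrib_left add.commute)
  qed
  moreover have "C \<ge> 0" using C0(1) by (simp add: C_def)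
  ultimately show ?thesis by blast
qed

lemma heat_kernel_one: "0 < v \<Longrightarrow> heat_kernel 1 v z = exp (- z\<^sup>2 / (2 * v)) / sqrt v"
  by (simp add: heat_kernel_def powr_minus powr_half_sqrt power_divide field_simps)

text \<open>A Gaussian bump of variance \<open>sig2 * h * n\<close> at time n is, seen from time n
  div 2, a kernel of variance at least \<open>sig2 * n / 2\<close>, hence lower by the factor sqrt
  (2 h), uniformly in the centre \<open>c\<close>.\<close>

lemma concentration:
  assumes h: "0 < h"
  shows "\<exists>C\<ge>0. \<forall>n x y c l. 2 \<le> n \<longrightarrow> 0 < y \<longrightarrow> 0 < l \<longrightarrow>
    mean n (\<lambda>x y. exp (- (y + \<rho> * x - c)\<^sup>2 / (2 * (sig2 * h * real n)))) x y
    \<le> sqrt (2 * h) * surv (n div 2) x y + C * err (real n) l n x y"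
proof -
  obtain C0 where C0: "C0 \<ge> 0" "\<forall>N D u x y m n l. 1 \<le> N \<longrightarrow> heat_family sig2 N D u \<longrightarrow> 0 < y \<longrightarrow> m \<le> n \<longrightarrow> 0 < l \<longrightarrow>
    \<bar>mean n (\<lambda>x y. u 0 0 (y + \<rho> * x)) x y - mean m (\<lambda>x y. u 0 (n - m) (y + \<rho> * x)) x y
      + (\<Sum>k=m..<n. mean k (exiting (\<lambda>x y. u 0 (n - Suc k) (y + \<rho> * x))) x y)\<bar>
    \<le> C0 * D * err N l n x y"
    using evolution by blast
  obtain D where D: "D \<ge> 0" "\<And>N c. N \<ge> 1 \<Longrightarrow> heat_family sig2 N D
      (\<lambda>i s z. N powr (real 1 / 2) * heat_kernel (1 + i) (sig2 * (real s + h * N)) (z - c))"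
    using heat_family_heat_kernel[OF sig2_pos h, of 1 thesis] by simp
  let ?C = "sqrt (sig2 * h) * (C0 * D)"
  have "mean n (\<lambda>x y. exp (- (y + \<rho> * x - c)\<^sup>2 / (2 * (sig2 * h * real n)))) x y
    \<le> sqrt (2 * h) * surv (n div 2) x y + ?C * err (real n) l n x y"
    if n: "2 \<le> n" and y: "0 < y" and l: "0 < l" for n x y c l
  proof -
    define N where "N = real n"
    define u where "u = (\<lambda>i s z. N powr (real 1 / 2) * heat_kernel (1 + i) (sig2 * (real s + h * N)) (z - c))"
    have N: "1 \<le> N" "0 < N" using n by (auto simp: N_def)
    have u: "heat_family sig2 N D u" unfolding u_def by (rule D(2)[OF N(1)])
    let ?m = "n div 2"
    have v: "0 < sig2 * (real s + h * N)" for s using sig2_pos h N by (intro mult_pos_pos add_nonneg_pos) auto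
    have u_eq: "u 0 s z = sqrt N * (exp (- (z - c)\<^sup>2 / (2 * (sig2 * (real s + h * N)))) / sqrt (sig2 * (real s + h * N)))" for s z
      unfolding u_def using N heat_kernel_one[OF v, of s "z - c"] by (simp add: powr_half_sqrt)
    have u_nonneg: "0 \<le> u 0 s z" for s z unfolding u_eq using v[of s] N by simp
    have af: "adm (\<lambda>x y. u 0 s (y + \<rho> * x))" for s by (rule adm_family[OF u]) simp
    have "\<bar>mean n (\<lambda>x y. u 0 0 (y + \<rho> * x)) x y - mean ?m (\<lambda>x y. u 0 (n - ?m) (y + \<rho> * x)) x y
      + (\<Sum>k=?m..<n. mean k (exiting (\<lambda>x y. u 0 (n - Suc k) (y + \<rho> * x))) x y)\<bar> \<le> C0 * D * err N l n x y"
      using C0(2)[rule_format, OF N(1) u y _ l, of ?m n x] by simp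
    \<comment> \<open>The kernel is nonnegative, so the exit terms have the favourable sign and are
      dropped.\<close>
    moreover have "0 \<le> (\<Sum>k=?m..<n. mean k (exiting (\<lambda>x y. u 0 (n - Suc k) (y + \<rho> * x))) x y)"
      by (intro sum_nonneg mean_exiting_nonneg af u_nonneg y)
    moreover have "p \<le> q + e" if "\<bar>p - q + s\<bar> \<le> e" "0 \<le> s" for p q s e :: real using that by linarith
    ultimately have 1: "mean n (\<lambda>x y. u 0 0 (y + \<rho> * x)) x y \<le> mean ?m (\<lambda>x y. u 0 (n - ?m) (y + \<rho> * x)) x y + C0 * D * err N l n x y"
      by blast
    have "mean ?m (\<lambda>x y. u 0 (n - ?m) (y + \<rho> * x)) x y \<le> mean ?m (\<lambda>x y. (sqrt 2 / sqrt sig2) * 1) x y"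
    proof (intro mean_mono af adm_cmult adm_const y)
      fix x y :: real
      let ?z = "y + \<rho> * x" and ?v = "sig2 * (real (n - ?m) + h * N)"
      have "N / 2 \<le> real (n - ?m)" unfolding N_def using div_times_less_eq_dividend[of n 2] by linarith
      then have "N / 2 \<le> real (n - ?m) + h * N" using h N by (simp add: add_increasing2)
      then have "sig2 * (N / 2) \<le> ?v" using sig2_pos by (intro mult_left_mono) auto
      then have "sqrt (sig2 * (N / 2)) \<le> sqrt ?v" by simp
      moreover have "0 < sqrt (sig2 * (N / 2))" using sig2_pos N by simp
      ultimately have "exp (- (?z - c)\<^sup>2 / (2 * ?v)) / sqrt ?v \<le> 1 / sqrt (sig2 * (N / 2))"
        using v[of "n - ?m"] by (intro frac_le) auto
      then have "u 0 (n - ?m) ?z \<le> sqrt N * (1 / sqrt (sig2 * (N / 2)))"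
        unfolding u_eq using N by (intro mult_left_mono) auto
      also have "\<dots> = sqrt 2 / sqrt sig2" using N by (simp add: real_sqrt_mult real_sqrt_divide)
      finally show "u 0 (n - ?m) ?z \<le> (sqrt 2 / sqrt sig2) * 1" by simp
    qed
    also have "\<dots> = (sqrt 2 / sqrt sig2) * surv ?m x y"
      unfolding surv_def by (rule mean_cmult[OF adm_const])
    finally have "mean n (\<lambda>x y. u 0 0 (y + \<rho> * x)) x y \<le> (sqrt 2 / sqrt sig2) * surv ?m x y + C0 * D * err N l n x y"
      using 1 by linarith
    then have "sqrt (sig2 * h) * mean n (\<lambda>x y. u 0 0 (y + \<rho> * x)) x y \<le>
        sqrt (sig2 * h) * ((sqrt 2 / sqrt sig2) * surv ?m x y + C0 * D * err N l n x y)"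
      by (rule mult_left_mono) (use sig2_pos h in simp)
    also have "\<dots> = sqrt (2 * h) * surv ?m x y + ?C * err N l n x y"
    proof -
      have "sqrt (sig2 * h) * (sqrt 2 / sqrt sig2) = sqrt (2 * h)"
        using sig2_pos by (simp add: real_sqrt_mult)
      then show ?thesis by (simp only: distrib_left mult.assoc[symmetric])
    qed
    also have "sqrt (sig2 * h) * mean n (\<lambda>x y. u 0 0 (y + \<rho> * x)) x y
        = mean n (\<lambda>x y. sqrt (sig2 * h) * u 0 0 (y + \<rho> * x)) x y"
      by (rule mean_cmult[OF af, symmetric])
    also have "(\<lambda>x y. sqrt (sig2 * h) * u 0 0 (y + \<rho> * x)) = (\<lambda>x y. exp (- (y + \<rho> * x - c)\<^sup>2 / (2 * (sig2 * h * real n))))"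
      unfolding u_eq using sig2_pos h N by (simp add: real_sqrt_mult N_def mult.assoc)
    finally show ?thesis unfolding N_def .
  qed
  moreover have "?C \<ge> 0" using C0(1) D(1) sig2_pos h by simp
  ultimately show ?thesis by blast
qed

lemma adm_bump: "adm (\<lambda>x y. exp (- (y + \<rho> * x - c)\<^sup>2 / (2 * v)))" if "0 \<le> v"
  using that by (intro adm_bounded[of _ 1]) (auto simp: case_prod_unfold)

lemma adm_gauss_prim: "adm (\<lambda>x y. gauss_prim ((y + \<rho> * x) / q))"
proof (rule adm_bounded)
  show "case_prod (\<lambda>x y. gauss_prim ((y + \<rho> * x) / q)) \<in> borel_measurable (borel \<Otimes>\<^sub>M borel)"
    unfolding case_prod_unfold
    by (rule measurable_compose[where g = gauss_prim], measurable)
      (intro borel_measurable_continuous_onI continuous_at_imp_continuous_on ballI DERIV_isCont[OF gauss_prim_deriv])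
qed (rule abs_gauss_prim_le_sup)

text \<open>The constant 1 is dominated by an odd profile, a bump at the origin and a weight, whose
  means are all estimated. The order of the quantifiers matters: \<open>K\<close> is fixed before
  \<open>h\<close>, so the coefficient of the earlier survival probability can be made
  small.\<close>

lemma surv_recursion:
  "\<exists>K>0. \<forall>h>0. \<exists>C\<ge>0. \<forall>n x y l. 2 \<le> n \<longrightarrow> 0 < y \<longrightarrow> 0 < l \<longrightarrow>
    surv n x y \<le> K * sqrt (2 * h) * surv (n div 2) x y
      + C * (real n powr (- (1 / 2)) * (y + \<bar>x\<bar> + exit_abs n x y) + err (real n) l n x y)"
proof -
  define g1 where "g1 = gauss_prim 1"
  have g1: "g1 > 0" using gauss_prim_less[of 0 1] by (simp add: g1_def)
  \<comment> \<open>In the window around the origin the odd profile divided by \<open>g1\<close> may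
    be as low as -1, so the bump must contribute 2; its minimum there is exp (-1/2).\<close>
  define K where "K = 2 * exp (1 / 2 :: real)"
  have K: "K > 0" by (simp add: K_def)
  obtain C3 where C3: "C3 \<ge> 0" "\<forall>n x y. 0 < y \<longrightarrow> mean n (\<lambda>x y. wt x) x y \<le> C3 * wt x"
    using mean_wt_bound by blast
  obtain C1 where C1: "C1 \<ge> 0" "\<forall>N D u x y n l. 1 \<le> N \<longrightarrow> heat_family sig2 N D u \<longrightarrow> (\<forall>s. u 0 s 0 = 0) \<longrightarrow> 0 \<le> D \<longrightarrow> 0 < y \<longrightarrow> 0 < l \<longrightarrow>
    \<bar>mean n (\<lambda>x y. u 0 0 (y + \<rho> * x)) x y\<bar> \<le> C1 * D * (N powr (- (1 / 2)) * (y + \<bar>x\<bar> + exit_abs n x y) + err N l n x y)"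
    using odd_mean_bound by blast
  have "\<exists>C\<ge>0. \<forall>n x y l. 2 \<le> n \<longrightarrow> 0 < y \<longrightarrow> 0 < l \<longrightarrow>
    surv n x y \<le> K * sqrt (2 * h) * surv (n div 2) x y
      + C * (real n powr (- (1 / 2)) * (y + \<bar>x\<bar> + exit_abs n x y) + err (real n) l n x y)"
    if h: "h > 0" for h
  proof -
    obtain C2 where C2: "C2 \<ge> 0" "\<forall>n x y c l. 2 \<le> n \<longrightarrow> 0 < y \<longrightarrow> 0 < l \<longrightarrow>
      mean n (\<lambda>x y. exp (- (y + \<rho> * x - c)\<^sup>2 / (2 * (sig2 * h * real n)))) x y
      \<le> sqrt (2 * h) * surv (n div 2) x y + C2 * err (real n) l n x y"
      using concentration[OF h] by blast
    obtain D where D: "D \<ge> 0" "\<And>N c. N \<ge> 1 \<Longrightarrow> heat_family sig2 N D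
        (\<lambda>i s z. N powr (real 0 / 2) * heat_kernel (0 + i) (sig2 * (real s + h * N)) (z - c))"
      using heat_family_heat_kernel[OF sig2_pos h, of 0 thesis] by simp
    define K3 where "K3 = (1 + gauss_sup / g1) * \<rho>\<^sup>2 / (sig2 * h)"
    have K3: "K3 \<ge> 0" using g1 gauss_sup_pos sig2_pos h by (simp add: K3_def)
    let ?C = "C1 * D / g1 + K * C2 + K3 * C3"
    have "surv n x y \<le> K * sqrt (2 * h) * surv (n div 2) x y
      + ?C * (real n powr (- (1 / 2)) * (y + \<bar>x\<bar> + exit_abs n x y) + err (real n) l n x y)"
      if n: "2 \<le> n" and y: "0 < y" and l: "0 < l" for n x y l
    proof -
      define N where "N = real n"
      have N: "1 \<le> N" "0 < N" using n by (auto simp: N_def)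
      let ?q = "sqrt (sig2 * h * N)"
      have q: "?q > 0" "?q\<^sup>2 = sig2 * h * N" using sig2_pos h N by auto
      let ?f = "\<lambda>x y. gauss_prim ((y + \<rho> * x) / ?q)"
      let ?b = "\<lambda>x y. exp (- (y + \<rho> * x - 0)\<^sup>2 / (2 * (sig2 * h * N)))"
      let ?Z = "N powr (- (1 / 2)) * (y + \<bar>x\<bar> + exit_abs n x y)" and ?E = "err N l n x y"
      have Z: "?Z \<ge> 0" using y exit_abs_nonneg[OF y, of n x] by simp
      have E: "?E \<ge> 0" using err_nonneg[OF y less_imp_le[OF l]] .
      have af: "adm ?f" by (rule adm_gauss_prim)
      have ab: "adm ?b" using sig2_pos h N by (intro adm_bump) auto
      have pw: "1 \<le> (1 / g1 * ?f x y + K * ?b x y) + K3 / N * wt x" if y: "0 < y" for x y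
      proof -
        let ?z = "y + \<rho> * x"
        have b0: "0 \<le> K * ?b x y" using K by simp
        have w0: "0 \<le> K3 / N * wt x" using K3 N wt_ge_one[of x] by simp
        consider "?z \<ge> ?q" | "- ?q < ?z" "?z < ?q" | "?z \<le> - ?q" by linarith
        then show ?thesis
        proof cases
          case 1
          then have "g1 \<le> ?f x y" unfolding g1_def using q by (intro gauss_prim_mono) (simp add: field_simps)
          then have "1 \<le> 1 / g1 * ?f x y" using g1 by (simp add: field_simps)
          with b0 w0 show ?thesis by linarith
        next
          case 2
          then have "gauss_prim (- 1) \<le> ?f x y" using q by (intro gauss_prim_mono) (simp add: field_simps)
          then have "- 1 \<le> 1 / g1 * ?f x y" using g1 by (simp add: gauss_prim_minus field_simps g1_def)
          moreover have "2 \<le> K * ?b x y"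
          proof -
            have "?z\<^sup>2 \<le> ?q\<^sup>2" using 2 by (intro abs_le_square_iff[THEN iffD1]) auto
            then have "- (1 / 2) \<le> - (?z - 0)\<^sup>2 / (2 * (sig2 * h * N))"
              using q by (simp add: field_simps)
            then have "exp (- (1 / 2)) \<le> ?b x y" by (subst exp_le_cancel_iff)
            then have "K * exp (- (1 / 2)) \<le> K * ?b x y" using K by (intro mult_left_mono) auto
            moreover have "K * exp (- (1 / 2)) = 2" unfolding K_def by (simp add: exp_minus)
            ultimately show ?thesis by linarith
          qed
          ultimately show ?thesis using w0 by linarith
        next
          case 3
          have "?f x y \<ge> - gauss_sup" using abs_gauss_prim_le_sup[of "?z / ?q"] by linarith
          then have "1 / g1 * ?f x y \<ge> - (gauss_sup / g1)" using g1 by (simp add: field_simps)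
          moreover have "1 + gauss_sup / g1 \<le> K3 / N * wt x"
          proof -
            \<comment> \<open>Since the walk is positive, a martingale value below
              \<open>- ?q\<close> forces a large position, and the weight pays for it.\<close>
            have "?q \<le> \<bar>\<rho> * x\<bar>" using 3 y by linarith
            then have "?q\<^sup>2 \<le> (\<rho> * x)\<^sup>2" using q(1) by (intro abs_le_square_iff[THEN iffD1]) linarith
            then have "1 \<le> (\<rho> * x)\<^sup>2 / (sig2 * h * N)" using q by (simp add: field_simps)
            then have "(1 + gauss_sup / g1) * 1 \<le> (1 + gauss_sup / g1) * ((\<rho> * x)\<^sup>2 / (sig2 * h * N))"
              using g1 gauss_sup_pos by (intro mult_left_mono) auto
            also have "\<dots> = K3 / N * x\<^sup>2" by (simp add: K3_def power_mult_distrib mult_ac)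
            also have "\<dots> \<le> K3 / N * wt x" using K3 N square_le_powr[of x] unfolding wt_def by (intro mult_left_mono) auto
            finally show ?thesis by simp
          qed
          ultimately show ?thesis using b0 by linarith
        qed
      qed
      have "surv n x y \<le> mean n (\<lambda>x y. (1 / g1 * ?f x y + K * ?b x y) + K3 / N * wt x) x y"
        unfolding surv_def by (intro mean_mono adm_const adm_add adm_cmult af ab adm_wt pw y)
      also have "\<dots> = (1 / g1 * mean n ?f x y + K * mean n ?b x y) + K3 / N * mean n (\<lambda>x y. wt x) x y"
        by (subst mean_plus, intro adm_add adm_cmult af ab, intro adm_cmult adm_wt,
            subst mean_linear[OF af ab], subst mean_cmult[OF adm_wt]) (rule refl)
      also have "\<dots> \<le> (1 / g1 * (C1 * D * (?Z + ?E)) + K * (sqrt (2 * h) * surv (n div 2) x y + C2 * ?E)) + K3 * C3 * ?E"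
      proof (intro add_mono mult_left_mono)
        let ?u = "\<lambda>i s z. N powr (real 0 / 2) * heat_kernel (0 + i) (sig2 * (real s + h * N)) (z - 0)"
        have "\<forall>s. ?u 0 s 0 = 0" by (simp add: heat_kernel_def)
        from C1(2)[rule_format, OF N(1) D(2)[OF N(1), of 0] this[rule_format] D(1) y l, of n x]
        have "mean n (\<lambda>x y. ?u 0 0 (y + \<rho> * x)) x y \<le> C1 * D * (?Z + ?E)" by (simp only: abs_le_iff)
        moreover have "(\<lambda>x y. ?u 0 0 (y + \<rho> * x)) = ?f" using N sig2_pos h by (simp add: heat_kernel_def mult.assoc)
        ultimately show "mean n ?f x y \<le> C1 * D * (?Z + ?E)" by simp
        show "mean n ?b x y \<le> sqrt (2 * h) * surv (n div 2) x y + C2 * ?E"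
          using C2(2) n y l unfolding N_def by blast
        have "K3 / N * mean n (\<lambda>x y. wt x) x y \<le> K3 / N * (C3 * wt x)"
          using C3 K3 N y by (intro mult_left_mono) auto
        also have "\<dots> = K3 * C3 * (N powr (- 1) * wt x)" using N by (simp add: powr_minus field_simps)
        also have "\<dots> \<le> K3 * C3 * ?E"
        proof (rule mult_left_mono)
          have "N powr (- 1) * wt x \<le> N powr (- 1) * (wt x + l * exit_abs n x y + l powr (2 - \<alpha>) * (wt x + (\<Sum>k<n. surv k x y)))"
            using l exit_abs_nonneg[OF y, of n x] sum_surv_nonneg[OF y, of x "{..<n}"] wt_ge_one[of x]
            by (intro mult_left_mono) auto
          moreover have "0 \<le> N powr (- (\<alpha> / 2)) * (wt x + (\<Sum>k<n. surv k x y))"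
            using sum_surv_nonneg[OF y, of x "{..<n}"] wt_ge_one[of x] by (intro mult_nonneg_nonneg) auto
          ultimately show "N powr (- 1) * wt x \<le> ?E" unfolding err_def by linarith
        qed (use K3 C3 in simp)
        finally show "K3 / N * mean n (\<lambda>x y. wt x) x y \<le> K3 * C3 * ?E" .
      qed (use g1 K in auto)
      also have "\<dots> \<le> K * sqrt (2 * h) * surv (n div 2) x y + ?C * (?Z + ?E)"
      proof -
        have "K * C2 * ?E \<le> K * C2 * (?Z + ?E)" "K3 * C3 * ?E \<le> K3 * C3 * (?Z + ?E)"
          using Z K C2(1) K3 C3(1) by (auto intro!: mult_left_mono)
        then show ?thesis unfolding distrib_right[of _ _ "?Z + ?E"] by (simp add: distrib_left mult.assoc)
      qed
      finally show ?thesis unfolding N_def .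
    qed
    moreover have "?C \<ge> 0" using C1(1) D(1) g1 K C2(1) K3 C3(1) by simp
    ultimately show ?thesis by blast
  qed
  with K show ?thesis by blast
qed

lemma abs_le_powr_half: "\<bar>x\<bar> \<le> 1 + \<bar>x\<bar> powr (\<alpha> / 2)" for x :: real
proof (cases "\<bar>x\<bar> \<le> 1")
  case False
  then have "\<bar>x\<bar> powr 1 \<le> \<bar>x\<bar> powr (\<alpha> / 2)" using \<alpha>_gt by (intro powr_mono) auto
  then show ?thesis using False by simp
qed (simp add: add_increasing2)

text \<open>Truncation at sqrt n gives \<open>exit_abs\<close> the coefficient 1. The condition on
  \<open>n\<close> makes n^(-1/2) |x|^\<alpha> at most |x|^(\<alpha>/2), which is the origin of the
  exponent \<alpha> / 2 in the bounds that follow.\<close>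

lemma err_sqrt_bound:
  assumes n: "1 \<le> n" "\<bar>x\<bar> powr \<alpha> \<le> real n" and y: "0 < y"
  shows "sqrt (real n) * err (real n) (sqrt (real n)) n x y
    \<le> 3 * (1 + \<bar>x\<bar> powr (\<alpha> / 2)) + exit_abs n x y + 2 * (real n powr ((1 - \<alpha>) / 2) * (\<Sum>k<n. surv k x y))"
proof -
  let ?N = "real n" and ?V = "1 + \<bar>x\<bar> powr (\<alpha> / 2)" and ?P = "\<Sum>k<n. surv k x y"
  have N: "?N \<ge> 1" "?N > 0" using n by auto
  have s: "sqrt ?N = ?N powr (1 / 2)" using N by (simp add: powr_half_sqrt)
  have e: "?N powr a * (?N powr b * c) = ?N powr (a + b) * c" for a b c by (simp add: powr_add)
  have w: "?N powr (- (1 / 2)) * wt x \<le> ?V"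
  proof -
    have "?N powr (- (1 / 2)) * 1 \<le> 1" using N powr_mono[of "- (1 / 2)" 0 ?N] by simp
    moreover have "?N powr (- (1 / 2)) * \<bar>x\<bar> powr \<alpha> \<le> \<bar>x\<bar> powr (\<alpha> / 2)"
    proof -
      have a: "\<bar>x\<bar> powr \<alpha> = \<bar>x\<bar> powr (\<alpha> / 2) * \<bar>x\<bar> powr (\<alpha> / 2)" by (simp add: powr_add[symmetric])
      have "\<bar>x\<bar> powr (\<alpha> / 2) = (\<bar>x\<bar> powr \<alpha>) powr (1 / 2)" by (simp add: powr_powr)
      also have "\<dots> \<le> ?N powr (1 / 2)" using n by (intro powr_mono2) auto
      finally have "\<bar>x\<bar> powr (\<alpha> / 2) * \<bar>x\<bar> powr (\<alpha> / 2) \<le> ?N powr (1 / 2) * \<bar>x\<bar> powr (\<alpha> / 2)"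
        by (intro mult_right_mono) auto
      then have "?N powr (- (1 / 2)) * \<bar>x\<bar> powr \<alpha> \<le> ?N powr (- (1 / 2)) * (?N powr (1 / 2) * \<bar>x\<bar> powr (\<alpha> / 2))"
        unfolding a by (intro mult_left_mono) auto
      also have "\<dots> = \<bar>x\<bar> powr (\<alpha> / 2)" unfolding e using N by simp
      finally show ?thesis .
    qed
    ultimately show ?thesis unfolding wt_def distrib_left by linarith
  qed
  have w': "?N powr ((1 - \<alpha>) / 2) * wt x \<le> ?V"
  proof -
    have "?N powr ((1 - \<alpha>) / 2) * wt x \<le> ?N powr (- (1 / 2)) * wt x"
      using N \<alpha>_gt wt_ge_one[of x] by (intro mult_right_mono powr_mono) auto
    with w show ?thesis by linarith
  qed
  have l: "(?N powr (1 / 2)) powr (2 - \<alpha>) = ?N powr (1 - \<alpha> / 2)" by (simp add: powr_powr field_simps)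
  have x1: "(1 / 2 + (- 1 + 1 / 2) :: real) = 0" "(1 / 2 + - 1 :: real) = - (1 / 2)"
    "1 / 2 + (- 1 + (1 - \<alpha> / 2)) = (1 - \<alpha>) / 2" "1 / 2 + - (\<alpha> / 2) = (1 - \<alpha>) / 2" by (auto simp: field_simps)
  have "sqrt ?N * err ?N (sqrt ?N) n x y =
      ?N powr (- (1 / 2)) * wt x + exit_abs n x y + ?N powr ((1 - \<alpha>) / 2) * (wt x + ?P)
        + ?N powr ((1 - \<alpha>) / 2) * (wt x + ?P)"
    unfolding err_def s l distrib_left[of "?N powr (1 / 2)"] distrib_left[of "?N powr (- 1)"] e x1
    using N by simp
  also have "\<dots> = ?N powr (- (1 / 2)) * wt x + exit_abs n x y + 2 * (?N powr ((1 - \<alpha>) / 2) * wt x) + 2 * (?N powr ((1 - \<alpha>) / 2) * ?P)"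
    by (simp only: distrib_left)
  finally have eq: "sqrt ?N * err ?N (sqrt ?N) n x y = ?N powr (- (1 / 2)) * wt x + exit_abs n x y
    + 2 * (?N powr ((1 - \<alpha>) / 2) * wt x) + 2 * (?N powr ((1 - \<alpha>) / 2) * ?P)" .
  have "l \<le> 3 * v + e + 2 * p" if "l = w1 + e + 2 * w2 + 2 * p" "w1 \<le> v" "w2 \<le> v" for l v e p w1 w2 :: real
    using that by linarith
  from this[OF eq w w'] show ?thesis .
qed

text \<open>First half of the bootstrap. The recursion is applied to the maximum \<open>Q\<close> of
  sqrt k times survival over k \<le> n: for small \<open>h\<close> and large k the terms that
  contain \<open>Q\<close> again have total coefficient 1 / 2 and are absorbed.\<close>

lemma surv_bound:
  "\<exists>C\<ge>0. \<forall>x y n. 0 < y \<longrightarrow> 1 \<le> n \<longrightarrow>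
    sqrt (real n) * surv n x y \<le> C * (1 + y + \<bar>x\<bar> powr (\<alpha> / 2) + exit_abs n x y)"
proof -
  obtain K where K: "K > 0" "\<forall>h>0. \<exists>C\<ge>0. \<forall>n x y l. 2 \<le> n \<longrightarrow> 0 < y \<longrightarrow> 0 < l \<longrightarrow>
    surv n x y \<le> K * sqrt (2 * h) * surv (n div 2) x y
      + C * (real n powr (- (1 / 2)) * (y + \<bar>x\<bar> + exit_abs n x y) + err (real n) l n x y)"
    using surv_recursion by blast
  \<comment> \<open>Makes \<open>K * sqrt (2 * h) * 2\<close> equal to 1 / 4; the factor 2 is the
    loss between sqrt k and sqrt (k div 2).\<close>
  define h where "h = 1 / (2 * (8 * K)\<^sup>2)"
  have h: "h > 0" using K by (simp add: h_def)
  have "2 * h = (1 / (8 * K))\<^sup>2" by (simp add: h_def power_divide)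
  then have Kh: "K * sqrt (2 * h) * 2 = 1 / 4" using K(1) by simp
  obtain C where C: "C \<ge> 0" "\<forall>n x y l. 2 \<le> n \<longrightarrow> 0 < y \<longrightarrow> 0 < l \<longrightarrow>
    surv n x y \<le> K * sqrt (2 * h) * surv (n div 2) x y
      + C * (real n powr (- (1 / 2)) * (y + \<bar>x\<bar> + exit_abs n x y) + err (real n) l n x y)"
    using K(2) h by blast
  \<comment> \<open>The integrated survival probability returns \<open>Q\<close> with this
    coefficient, which is small for large times because \<alpha> > 2.\<close>
  have "((\<lambda>n. 4 * C * real n powr (1 - \<alpha> / 2)) \<longlongrightarrow> 4 * C * 0) sequentially"
    using \<alpha>_gt by (intro tendsto_mult tendsto_const tendsto_neg_powr filterlim_real_sequentially) auto
  then have "eventually (\<lambda>n. 4 * C * real n powr (1 - \<alpha> / 2) < 1 / 4) sequentially"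
    by (intro order_tendstoD(2)) auto
  then obtain n0' where n0': "\<And>n. n \<ge> n0' \<Longrightarrow> 4 * C * real n powr (1 - \<alpha> / 2) < 1 / 4"
    unfolding eventually_sequentially by blast
  define n0 where "n0 = max n0' 2"
  define C' where "C' = 9 * C + sqrt (real n0) + 1"
  have C': "C' \<ge> 9 * C" "C' \<ge> sqrt (real n0)" "C' \<ge> 1" using C(1) by (auto simp: C'_def)
  have "sqrt (real n) * surv n x y \<le> 2 * C' * (1 + y + \<bar>x\<bar> powr (\<alpha> / 2) + exit_abs n x y)"
    if y: "0 < y" and n: "1 \<le> n" for x y n
  proof -
    let ?W = "1 + y + \<bar>x\<bar> powr (\<alpha> / 2)"
    have W: "?W \<ge> 1" using y by simp
    define Q where "Q = Max ((\<lambda>k. sqrt (real k) * surv k x y) ` {1..n})"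
    have Q: "sqrt (real k) * surv k x y \<le> Q" if "1 \<le> k" "k \<le> n" for k
      unfolding Q_def using that by (intro Max_ge) auto
    have Q0: "Q \<ge> 0" using Q[OF order_refl n] surv_nonneg[OF y, of 1 x] by simp
    have step: "sqrt (real k) * surv k x y \<le> Q / 2 + C' * (?W + exit_abs n x y)" if k: "1 \<le> k" "k \<le> n" for k
    proof (cases "k < n0 \<or> real k < \<bar>x\<bar> powr \<alpha>")
      \<comment> \<open>For k below \<open>n0\<close> or below |x|^\<alpha>, survival is bounded by
        1 and sqrt k by a constant plus |x|^(\<alpha>/2).\<close>
      case True
      have "sqrt (real k) \<le> sqrt (real n0) + \<bar>x\<bar> powr (\<alpha> / 2)"
      proof (cases "k < n0")
        case True
        then have "sqrt (real k) \<le> sqrt (real n0)" by simp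
        then show ?thesis by (simp add: add_increasing2)
      next
        case False
        then have "sqrt (real k) \<le> sqrt (\<bar>x\<bar> powr \<alpha>)" using True by simp
        also have "\<dots> = \<bar>x\<bar> powr (\<alpha> / 2)" by (simp add: powr_half_sqrt[symmetric] powr_powr)
        finally show ?thesis by (simp add: add_increasing)
      qed
      also have "\<dots> \<le> C' * 1 + C' * \<bar>x\<bar> powr (\<alpha> / 2)"
        using C' mult_right_mono[OF C'(3), of "\<bar>x\<bar> powr (\<alpha> / 2)"] by simp
      also have "\<dots> \<le> C' * (?W + exit_abs n x y)"
        unfolding distrib_left[symmetric] using C' y exit_abs_nonneg[OF y, of n x] by (intro mult_left_mono) auto
      finally have "sqrt (real k) * surv k x y \<le> C' * (?W + exit_abs n x y) * 1"
        using surv_le_one[OF y, of k x] surv_nonneg[OF y, of k x] C' y exit_abs_nonneg[OF y, of n x]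
        by (intro mult_mono mult_nonneg_nonneg add_nonneg_nonneg) auto
      then show ?thesis using Q0 by simp
    next
      case False
      then have k2: "2 \<le> k" "n0' \<le> k" "\<bar>x\<bar> powr \<alpha> \<le> real k" by (auto simp: n0_def)
      let ?N = "real k" and ?H = "exit_abs k x y" and ?P = "\<Sum>j<k. surv j x y"
      have N: "0 < ?N" using k2 by simp
      have "sqrt ?N * surv k x y \<le> sqrt ?N * (K * sqrt (2 * h) * surv (k div 2) x y
          + C * (?N powr (- (1 / 2)) * (y + \<bar>x\<bar> + ?H) + err ?N (sqrt ?N) k x y))"
        using C(2) k2 y N by (intro mult_left_mono) auto
      also have "\<dots> = K * sqrt (2 * h) * (sqrt ?N * surv (k div 2) x y)
          + C * ((sqrt ?N * ?N powr (- (1 / 2))) * (y + \<bar>x\<bar> + ?H) + sqrt ?N * err ?N (sqrt ?N) k x y)"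
        by (simp only: distrib_left mult_ac)
      also have "sqrt ?N * ?N powr (- (1 / 2)) = 1"
        using N by (simp add: powr_half_sqrt[symmetric] powr_add[symmetric])
      also have "K * sqrt (2 * h) * (sqrt ?N * surv (k div 2) x y) \<le> K * sqrt (2 * h) * (2 * Q)"
      proof (rule mult_left_mono)
        \<comment> \<open>True with the rounded half for every k \<ge> 2, the tightest case being k
          = 3.\<close>
        have "?N \<le> 4 * real (k div 2)" using k2 by linarith
        then have "sqrt ?N \<le> sqrt (4 * real (k div 2))" by (rule real_sqrt_le_mono)
        also have "\<dots> = 2 * sqrt (real (k div 2))" by (simp add: real_sqrt_mult)
        finally have "sqrt ?N * surv (k div 2) x y \<le> 2 * sqrt (real (k div 2)) * surv (k div 2) x y"
          using surv_nonneg[OF y] by (rule mult_right_mono)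
        also have "\<dots> \<le> 2 * Q" using Q[of "k div 2"] k2 k by simp
        finally show "sqrt ?N * surv (k div 2) x y \<le> 2 * Q" .
      qed (use K h in simp)
      also have "K * sqrt (2 * h) * (2 * Q) = Q / 4" using Kh by (metis (no_types, lifting) mult.assoc mult.commute times_divide_eq_right mult_1)
      finally have main: "sqrt ?N * surv k x y \<le> Q / 4 + C * (1 * (y + \<bar>x\<bar> + ?H) + sqrt ?N * err ?N (sqrt ?N) k x y)" by simp
      \<comment> \<open>The time 0 is split off, since \<open>Q\<close> gives no information
        there.\<close>
      have P: "?P \<le> 1 + 2 * Q * sqrt ?N"
      proof -
        have "?P = surv 0 x y + (\<Sum>j=1..<k. surv j x y)"
          using k by (simp add: lessThan_atLeast0 sum.atLeast_Suc_lessThan)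
        also have "(\<Sum>j=1..<k. surv j x y) \<le> (\<Sum>j=1..<k. Q * real j powr (- (1 / 2)))"
        proof (rule sum_mono)
          fix j assume j: "j \<in> {1..<k}"
          then have "sqrt (real j) * surv j x y \<le> Q" using k by (intro Q) auto
          then show "surv j x y \<le> Q * real j powr (- (1 / 2))"
            using j by (simp add: powr_minus powr_half_sqrt field_simps)
        qed
        also have "\<dots> \<le> Q * (2 * sqrt ?N)"
          unfolding sum_distrib_left[symmetric] using Q0 sum_inverse_sqrt_le by (intro mult_left_mono) auto
        finally show ?thesis by simp
      qed
      have P': "?N powr ((1 - \<alpha>) / 2) * ?P \<le> 1 + 2 * Q * ?N powr (1 - \<alpha> / 2)"
      proof -
        have "?N powr ((1 - \<alpha>) / 2) * ?P \<le> ?N powr ((1 - \<alpha>) / 2) * (1 + 2 * Q * sqrt ?N)"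
          using P by (intro mult_left_mono) auto
        also have "\<dots> = ?N powr ((1 - \<alpha>) / 2) + 2 * Q * (?N powr ((1 - \<alpha>) / 2) * ?N powr (1 / 2))"
          using N by (simp add: powr_half_sqrt algebra_simps)
        also have "?N powr ((1 - \<alpha>) / 2) * ?N powr (1 / 2) = ?N powr (1 - \<alpha> / 2)"
          by (simp only: powr_add[symmetric]) (simp add: field_simps)
        also have "?N powr ((1 - \<alpha>) / 2) \<le> ?N powr 0" using k2 \<alpha>_gt by (intro powr_mono) auto
        finally show ?thesis using N by simp
      qed
      have "y + \<bar>x\<bar> \<le> ?W"
      proof -
        have "y + s \<le> 1 + y + v" if "s \<le> 1 + v" for s v :: real using that by simp
        from this[OF abs_le_powr_half] show ?thesis .
      qed
      moreover have "1 + \<bar>x\<bar> powr (\<alpha> / 2) \<le> ?W" using y by simp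
      moreover have "1 * (s + h) + E \<le> 6 * W + 2 * h + 4 * Q * r"
        if "s \<le> W" "v \<le> W" "1 \<le> W" "E \<le> 3 * v + h + 2 * p" "p \<le> 1 + 2 * Q * r" for s h E W v p r :: real
        using that by (simp add: mult.assoc)
      ultimately have "1 * (y + \<bar>x\<bar> + ?H) + sqrt ?N * err ?N (sqrt ?N) k x y \<le> 6 * ?W + 2 * ?H + 4 * Q * ?N powr (1 - \<alpha> / 2)"
        using W err_sqrt_bound[OF k(1) k2(3) y] P' by blast
      then have "sqrt ?N * surv k x y \<le> Q / 4 + C * (6 * ?W + 2 * ?H + 4 * Q * ?N powr (1 - \<alpha> / 2))"
        using main C(1) by (meson add_left_mono mult_left_mono order_trans)
      also have "\<dots> = Q / 4 + (4 * C * ?N powr (1 - \<alpha> / 2)) * Q + C * (6 * ?W + 2 * ?H)"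
        by (simp only: distrib_left mult_ac add_ac)
      also have "\<dots> \<le> Q / 4 + 1 / 4 * Q + C' * (?W + exit_abs n x y)"
      proof (intro add_mono mult_right_mono)
        show "4 * C * ?N powr (1 - \<alpha> / 2) \<le> 1 / 4" using n0'[OF k2(2)] by linarith
        have "?H \<le> exit_abs n x y" by (rule exit_abs_mono[OF k(2) y])
        then have "C * (6 * ?W + 2 * ?H) \<le> C * (9 * (?W + exit_abs n x y))"
          using C(1) W exit_abs_nonneg[OF y, of n x] by (intro mult_left_mono) auto
        also have "\<dots> \<le> C' * (?W + exit_abs n x y)"
          using C' W exit_abs_nonneg[OF y, of n x] mult_right_mono[OF C'(1), of "?W + exit_abs n x y"] by (simp add: mult_ac)
        finally show "C * (6 * ?W + 2 * ?H) \<le> C' * (?W + exit_abs n x y)" .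
      qed (use Q0 in auto)
      finally show ?thesis by simp
    qed
    have "Q \<in> (\<lambda>k. sqrt (real k) * surv k x y) ` {1..n}" unfolding Q_def using n by (intro Max_in) auto
    then obtain k where "1 \<le> k" "k \<le> n" "Q = sqrt (real k) * surv k x y" by auto
    then have "Q \<le> Q / 2 + C' * (?W + exit_abs n x y)" using step by metis
    then have "Q \<le> 2 * C' * (?W + exit_abs n x y)" by simp
    then show ?thesis using Q[OF n order_refl] by linarith
  qed
  moreover have "2 * C' \<ge> 0" using C' by simp
  ultimately show ?thesis by blast
qed

text \<open>Second half of the bootstrap. Doubling the time multiplies the bracket by at most 1 + C
  k^(-\<eta>) with \<eta> = 1/2 - 1/\<alpha> > 0, and along dyadic times these factors have a
  bounded product. Finiteness of the overshoot uses m = 1; the estimate on the cone uses that the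
  exponential tends to 1 for large m.\<close>

lemma exit_abs_bound:
  "\<exists>C\<ge>0. \<forall>x y m n. 0 < y \<longrightarrow> 1 \<le> m \<longrightarrow>
    1 + y + \<bar>x\<bar> powr (\<alpha> / 2) + real m powr (- (1 / 2)) * wt x + exit_abs n x y
    \<le> (1 + y + \<bar>x\<bar> powr (\<alpha> / 2) + real m powr (- (1 / 2)) * wt x + exit_abs m x y)
      * exp (C * real m powr (1 / \<alpha> - 1 / 2))"
proof -
  obtain C1 where C1: "C1 \<ge> 0" "\<forall>x y l m n. 0 < y \<longrightarrow> 0 < l \<longrightarrow> m \<le> n \<longrightarrow>
    exit_abs n x y \<le> exit_abs m x y + l * surv m x y
      + l powr (1 - \<alpha>) * (C1 * (1 + \<bar>x\<bar> powr \<alpha> + (\<Sum>k=m..<n. surv k x y)))"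
    using exit_abs_increment by blast
  obtain C2 where C2: "C2 \<ge> 0" "\<forall>x y n. 0 < y \<longrightarrow> 1 \<le> n \<longrightarrow>
    sqrt (real n) * surv n x y \<le> C2 * (1 + y + \<bar>x\<bar> powr (\<alpha> / 2) + exit_abs n x y)"
    using surv_bound by blast
  define \<eta> where "\<eta> = 1 / 2 - 1 / \<alpha>"
  have \<eta>: "\<eta> > 0" using \<alpha>_gt by (simp add: \<eta>_def field_simps)
  define q where "q = 2 powr (- \<eta>)"
  have q: "0 < q" "q < 1" using \<eta> powr_less_mono[of "- \<eta>" 0 2] by (auto simp: q_def)
  define C where "C = C2 + C1 + C1 * C2"
  have C: "C \<ge> 0" using C1(1) C2(1) by (simp add: C_def)
  have "1 + y + \<bar>x\<bar> powr (\<alpha> / 2) + real m powr (- (1 / 2)) * wt x + exit_abs n x y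
    \<le> (1 + y + \<bar>x\<bar> powr (\<alpha> / 2) + real m powr (- (1 / 2)) * wt x + exit_abs m x y)
      * exp (C / (1 - q) * real m powr (- \<eta>))"
    if y: "0 < y" and m: "1 \<le> m" for x y m n
  proof -
    define W where "W = 1 + y + \<bar>x\<bar> powr (\<alpha> / 2)"
    \<comment> \<open>The last term absorbs the initial weight at every later doubling: for k \<ge>
      m, k^(1/\<alpha> - 1) wt x is at most k^(-\<eta>) m^(-1/2) wt x.\<close>
    define B where "B = W + real m powr (- (1 / 2)) * wt x"
    define H where "H k = exit_abs k x y" for k
    have W: "W \<ge> 1" using y by (simp add: W_def)
    have B: "B \<ge> W" "B \<ge> real m powr (- (1 / 2)) * wt x"
      using wt_ge_one[of x] W by (auto simp: B_def)
    have H0: "H k \<ge> 0" for k unfolding H_def by (rule exit_abs_nonneg[OF y])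
    have dbl: "B + H (2 * k) \<le> (B + H k) * exp (C * real k powr (- \<eta>))" if k: "m \<le> k" for k
    proof -
      let ?N = "real k" and ?p = "surv k x y"
      have N: "1 \<le> ?N" "0 < ?N" using k m by auto
      have p0: "?p \<ge> 0" by (rule surv_nonneg[OF y])
      \<comment> \<open>This level balances small and large exit positions, since
        \<open>l = l powr (1 - \<alpha>) * k\<close>.\<close>
      let ?l = "?N powr (1 / \<alpha>)" and ?e = "?N powr (- \<eta>)"
      have l: "?l > 0" "?l powr (1 - \<alpha>) = ?N powr (1 / \<alpha> - 1)"
        using N \<alpha>_pos by (auto simp: powr_powr field_simps)
      have "(\<Sum>j=k..<2*k. surv j x y) \<le> (\<Sum>j=k..<2*k. ?p)"
        by (intro sum_mono surv_antimono y) auto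
      then have S: "(\<Sum>j=k..<2*k. surv j x y) \<le> ?N * ?p" by simp
      have "H (2 * k) \<le> H k + ?l * ?p + ?N powr (1 / \<alpha> - 1) * (C1 * (wt x + (\<Sum>j=k..<2*k. surv j x y)))"
        using C1(2)[rule_format, OF y l(1), of k "2 * k" x] unfolding l(2) H_def wt_def by simp
      also have "\<dots> \<le> H k + ?l * ?p + ?N powr (1 / \<alpha> - 1) * (C1 * (wt x + ?N * ?p))"
        using S C1(1) by (intro add_mono mult_left_mono) auto
      also have "\<dots> = H k + (1 + C1) * (?l * ?p) + C1 * (?N powr (1 / \<alpha> - 1) * wt x)"
      proof -
        have "?N powr (1 / \<alpha> - 1) * ?N = ?l" using N by (simp add: powr_diff)
        moreover have "h + l * p + r * (C1 * (w + N * p)) = h + (1 + C1) * (l * p) + C1 * (r * w)" if "r * N = l" for h l p r w N :: real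
          unfolding that[symmetric] by (simp add: algebra_simps)
        ultimately show ?thesis by blast
      qed
      finally have I: "H (2 * k) \<le> H k + (1 + C1) * (?l * ?p) + C1 * (?N powr (1 / \<alpha> - 1) * wt x)" .
      have I1: "?l * ?p \<le> C2 * (?e * (B + H k))"
      proof -
        have "sqrt ?N * ?p \<le> C2 * (W + H k)"
          using C2(2)[rule_format, OF y, of k x] N unfolding W_def H_def by simp
        also have "\<dots> \<le> C2 * (B + H k)" using B C2(1) by (intro mult_left_mono) auto
        finally have "?e * (sqrt ?N * ?p) \<le> ?e * (C2 * (B + H k))" by (intro mult_left_mono) auto
        moreover have "?e * sqrt ?N = ?l"
          using N by (simp add: powr_half_sqrt[symmetric] powr_add[symmetric] \<eta>_def)
        ultimately show ?thesis by (metis mult.assoc mult.left_commute)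
      qed
      have I2: "?N powr (1 / \<alpha> - 1) * wt x \<le> ?e * (B + H k)"
      proof -
        have "?N powr (- (1 / 2)) * wt x \<le> real m powr (- (1 / 2)) * wt x"
          using m k wt_ge_one[of x] by (intro mult_right_mono powr_mono2') auto
        also have "\<dots> \<le> B + H k" using B(2) H0[of k] by linarith
        finally have "?e * (?N powr (- (1 / 2)) * wt x) \<le> ?e * (B + H k)" by (intro mult_left_mono) auto
        moreover have "?e * ?N powr (- (1 / 2)) = ?N powr (1 / \<alpha> - 1)"
          by (simp only: powr_add[symmetric]) (simp add: \<eta>_def)
        ultimately show ?thesis by (simp only: mult.assoc[symmetric])
      qed
      have "H (2 * k) \<le> H k + (1 + C1) * (C2 * (?e * (B + H k))) + C1 * (?e * (B + H k))"
        using C1(1) by (intro order_trans[OF I] add_mono mult_left_mono I1 I2) auto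
      then have "B + H (2 * k) \<le> (B + H k) * (1 + C * ?e)" by (simp add: C_def algebra_simps)
      also have "\<dots> \<le> (B + H k) * exp (C * ?e)"
        using exp_ge_add_one_self[of "C * ?e"] B W H0[of k] by (intro mult_left_mono) auto
      finally show ?thesis .
    qed
    \<comment> \<open>The exponents along the times 2^i m form a geometric series with ratio
      2^(-\<eta>).\<close>
    have iter: "B + H (2 ^ j * m) \<le> (B + H m) * exp (C * real m powr (- \<eta>) * (\<Sum>i<j. q ^ i))" for j
    proof (induction j)
      case (Suc j)
      have "B + H (2 ^ Suc j * m) = B + H (2 * (2 ^ j * m))" by (simp add: mult.assoc)
      also have "\<dots> \<le> (B + H (2 ^ j * m)) * exp (C * real (2 ^ j * m) powr (- \<eta>))"
        by (intro dbl) simp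
      also have "real (2 ^ j * m) powr (- \<eta>) = real m powr (- \<eta>) * q ^ j"
        by (simp add: powr_mult q_def powr_realpow[symmetric] powr_powr mult.commute)
      also have "(B + H (2 ^ j * m)) * exp (C * (real m powr (- \<eta>) * q ^ j))
          \<le> ((B + H m) * exp (C * real m powr (- \<eta>) * (\<Sum>i<j. q ^ i))) * exp (C * (real m powr (- \<eta>) * q ^ j))"
        by (intro mult_right_mono Suc.IH) auto
      also have "\<dots> = (B + H m) * exp (C * real m powr (- \<eta>) * (\<Sum>i<Suc j. q ^ i))"
        by (simp add: exp_add[symmetric] distrib_left mult.assoc)
      finally show ?case .
    qed simp
    obtain j where "n < 2 ^ j" using less_exp by blast
    then have "n \<le> 2 ^ j * m" using m by (metis less_imp_le mult_le_mono nat_mult_1_right)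
    then have "B + H n \<le> B + H (2 ^ j * m)" unfolding H_def using y by (simp add: exit_abs_mono)
    also note iter[of j]
    also have "(B + H m) * exp (C * real m powr (- \<eta>) * (\<Sum>i<j. q ^ i))
        \<le> (B + H m) * exp (C * real m powr (- \<eta>) * (1 / (1 - q)))"
    proof -
      have "(\<Sum>i<j. q ^ i) \<le> 1 / (1 - q)"
        using q by (simp add: sum_gp_strict divide_right_mono)
      then have "C * real m powr (- \<eta>) * (\<Sum>i<j. q ^ i) \<le> C * real m powr (- \<eta>) * (1 / (1 - q))"
        using C by (intro mult_left_mono) auto
      then show ?thesis using B W H0[of m] by (intro mult_left_mono) auto
    qed
    finally show ?thesis unfolding B_def W_def H_def by (simp add: mult_ac)
  qed
  moreover have "C / (1 - q) \<ge> 0" using C q by simp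
  moreover have "- \<eta> = 1 / \<alpha> - 1 / 2" by (simp add: \<eta>_def)
  ultimately show ?thesis by metis
qed

section \<open>The limit on the diffusive scale\<close>

lemma mean_exiting_abs_le:
  assumes "adm f" "adm g" "0 < y" and bd: "\<And>x y. y \<le> 0 \<Longrightarrow> x \<le> y \<Longrightarrow> \<bar>f x y\<bar> \<le> g x y"
  shows "\<bar>mean k (exiting f) x y\<bar> \<le> mean k (exiting g) x y"
proof (rule mean_abs_le[OF adm_exiting[OF assms(1)] adm_exiting[OF assms(2)] _ assms(3)])
  fix x y :: real assume y: "0 < y"
  have "exiting f x y \<le> exiting g x y"
    using bd by (intro exiting_mono assms y) (simp add: abs_le_iff)
  moreover have "exiting (\<lambda>x y. (- 1) * f x y) x y \<le> exiting g x y"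
    using bd by (intro exiting_mono adm_cmult assms y) (simp add: abs_le_iff)
  ultimately show "\<bar>exiting f x y\<bar> \<le> exiting g x y"
    unfolding exiting_cmult[OF assms(1)] by (simp add: abs_le_iff)
qed

text \<open>Optional stopping for Z: what the mean on survival has lost by time n has left through
  the exits up to then.\<close>

lemma mean_martingale:
  "mean n (\<lambda>x y. y + \<rho> * x) x y = y + \<rho> * x - (\<Sum>k<n. mean k (exiting (\<lambda>x y. y + \<rho> * x)) x y)"
proof (induction n)
  case (Suc n)
  have "transit (\<lambda>x y. y + \<rho> * x) = (\<lambda>x y. y + \<rho> * x)"
    by (rule ext)+ (rule transit_martingale)
  then show ?case using Suc mean_transit[OF adm_linear, of n \<rho> x y] by simp
qed simp

lemma abs_linear_exit: "y \<le> 0 \<Longrightarrow> x \<le> y \<Longrightarrow> \<bar>y + \<rho> * x\<bar> \<le> (1 + \<bar>\<rho>\<bar>) * \<bar>x\<bar>" for x y :: real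
  using abs_triangle_ineq[of y "\<rho> * x"] by (simp add: abs_mult distrib_right)

lemma exit_linear_bound:
  assumes "0 < y"
  shows "\<bar>mean k (exiting (\<lambda>x y. y + \<rho> * x)) x y\<bar> \<le> (1 + \<bar>\<rho>\<bar>) * mean k (exiting (\<lambda>x y. \<bar>x\<bar>)) x y"
proof -
  have "\<bar>mean k (exiting (\<lambda>x y. y + \<rho> * x)) x y\<bar> \<le> mean k (exiting (\<lambda>x y. (1 + \<bar>\<rho>\<bar>) * \<bar>x\<bar>)) x y"
    by (intro mean_exiting_abs_le adm_linear adm_cmult adm_abs assms abs_linear_exit)
  also have "exiting (\<lambda>x y. (1 + \<bar>\<rho>\<bar>) * \<bar>x\<bar>) = (\<lambda>x y. (1 + \<bar>\<rho>\<bar>) * exiting (\<lambda>x y. \<bar>x\<bar>) x y)"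
    by (rule ext)+ (rule exiting_cmult[OF adm_abs])
  finally show ?thesis by (simp only: mean_cmult[OF adm_exiting[OF adm_abs]])
qed

lemma exit_abs_finite:
  assumes "0 < y"
  shows "\<exists>H\<ge>0. \<forall>n. exit_abs n x y \<le> H"
proof -
  obtain C where "\<forall>x y m n. 0 < y \<longrightarrow> 1 \<le> m \<longrightarrow>
    1 + y + \<bar>x\<bar> powr (\<alpha> / 2) + real m powr (- (1 / 2)) * wt x + exit_abs n x y
    \<le> (1 + y + \<bar>x\<bar> powr (\<alpha> / 2) + real m powr (- (1 / 2)) * wt x + exit_abs m x y)
      * exp (C * real m powr (1 / \<alpha> - 1 / 2))"
    using exit_abs_bound by blast
  from this[rule_format, OF assms order_refl] obtain B where B: "\<And>n. 1 + y + \<bar>x\<bar> powr (\<alpha> / 2) + real 1 powr (- (1 / 2)) * wt x + exit_abs n x y \<le> B"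
    by blast
  have "0 \<le> 1 + y + \<bar>x\<bar> powr (\<alpha> / 2) + real 1 powr (- (1 / 2)) * wt x"
    using assms wt_ge_one[of x] by (intro add_nonneg_nonneg mult_nonneg_nonneg) auto
  then have "exit_abs n x y \<le> B" for n using B[of n] by linarith
  moreover from this[of 0] have "0 \<le> B" using exit_abs_nonneg[OF assms, of 0 x] by linarith
  ultimately show ?thesis by blast
qed

lemma surv_decay:
  assumes "0 < y"
  shows "\<exists>K\<ge>0. \<forall>n\<ge>1. surv n x y \<le> K * real n powr (- (1 / 2))"
proof -
  obtain C where C: "C \<ge> 0" "\<forall>x y n. 0 < y \<longrightarrow> 1 \<le> n \<longrightarrow>
    sqrt (real n) * surv n x y \<le> C * (1 + y + \<bar>x\<bar> powr (\<alpha> / 2) + exit_abs n x y)"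
    using surv_bound by blast
  obtain H where H: "H \<ge> 0" "\<forall>n. exit_abs n x y \<le> H" using exit_abs_finite[OF assms] by blast
  let ?K = "C * (1 + y + \<bar>x\<bar> powr (\<alpha> / 2) + H)"
  have "surv n x y \<le> ?K * real n powr (- (1 / 2))" if n: "1 \<le> n" for n
  proof -
    have "sqrt (real n) * surv n x y \<le> C * (1 + y + \<bar>x\<bar> powr (\<alpha> / 2) + exit_abs n x y)"
      using C(2) assms n by blast
    also have "\<dots> \<le> ?K" using C(1) H(2) by (intro mult_left_mono add_left_mono) auto
    finally have "sqrt (real n) * surv n x y \<le> ?K" .
    then have "surv n x y \<le> ?K / sqrt (real n)" using n by (simp only: pos_le_divide_eq real_sqrt_gt_0_iff of_nat_0_less_iff mult.commute)
    moreover have "real n powr (- (1 / 2)) = 1 / sqrt (real n)"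
      by (simp only: powr_minus_divide powr_half_sqrt of_nat_0_le_iff)
    ultimately show ?thesis by simp
  qed
  moreover have "?K \<ge> 0" using C(1) H(1) assms by (intro mult_nonneg_nonneg add_nonneg_nonneg) auto
  ultimately show ?thesis by blast
qed

lemma sum_surv_le:
  assumes y: "0 < y" and K: "0 \<le> K" "\<forall>n\<ge>1. surv n x y \<le> K * real n powr (- (1 / 2))"
  shows "(\<Sum>k<n. surv k x y) \<le> 1 + 2 * K * sqrt (real n)"
proof (cases "n = 0")
  case False
  have "(\<Sum>k<n. surv k x y) = surv 0 x y + (\<Sum>j=1..<n. surv j x y)"
    using False by (simp add: lessThan_atLeast0 sum.atLeast_Suc_lessThan)
  also have "\<dots> \<le> 1 + (\<Sum>j=1..<n. K * real j powr (- (1 / 2)))"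
    using K by (intro add_mono sum_mono) auto
  also have "\<dots> \<le> 1 + K * (2 * sqrt (real n))"
    unfolding sum_distrib_left[symmetric] using K sum_inverse_sqrt_le by (intro add_left_mono mult_left_mono) auto
  finally show ?thesis by simp
qed simp

text \<open>The truncation level n^(1/4) must tend to infinity, so that l^(2 - \<alpha>) beats an
  integrated survival probability of order sqrt n, and more slowly than sqrt n, so that the
  overshoot term vanishes. The level sqrt n used in the bootstrap leaves a term of order 1.\<close>

lemma err_tendsto_0:
  assumes y: "0 < y"
  shows "(\<lambda>n. sqrt (real n) * err (real n) (real n powr (1 / 4)) n x y) \<longlonglongrightarrow> 0"
proof -
  obtain H where H: "H \<ge> 0" "\<forall>n. exit_abs n x y \<le> H" using exit_abs_finite[OF y] by blast
  obtain K where K: "K \<ge> 0" "\<forall>n\<ge>1. surv n x y \<le> K * real n powr (- (1 / 2))" using surv_decay[OF y] by blast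
  let ?w = "wt x"
  let ?g = "\<lambda>n. ?w * real n powr (- (1 / 2)) + H * real n powr (- (1 / 4)) + (?w + 1) * real n powr ((2 - \<alpha>) / 4 - 1 / 2)
    + 2 * K * real n powr ((2 - \<alpha>) / 4) + (?w + 1) * real n powr ((1 - \<alpha>) / 2) + 2 * K * real n powr (1 - \<alpha> / 2)"
  have z: "(\<lambda>n. real n powr a) \<longlonglongrightarrow> 0" if "a < 0" for a
    using that by (intro tendsto_neg_powr filterlim_real_sequentially)
  have "?g \<longlonglongrightarrow> ?w * 0 + H * 0 + (?w + 1) * 0 + 2 * K * 0 + (?w + 1) * 0 + 2 * K * 0"
    using \<alpha>_gt by (intro tendsto_add tendsto_mult tendsto_const z) (auto simp: field_simps)
  then have g: "?g \<longlonglongrightarrow> 0" by simp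
  show ?thesis
  proof (rule tendsto_sandwich[OF _ _ tendsto_const g])
    show "eventually (\<lambda>n. 0 \<le> sqrt (real n) * err (real n) (real n powr (1 / 4)) n x y) sequentially"
      using y by (intro always_eventually allI mult_nonneg_nonneg err_nonneg) auto
    show "eventually (\<lambda>n. sqrt (real n) * err (real n) (real n powr (1 / 4)) n x y \<le> ?g n) sequentially"
    proof (rule eventually_mono[OF eventually_ge_at_top[of 1]])
      fix n :: nat assume n: "1 \<le> n"
      let ?N = "real n" and ?P = "1 + 2 * K * real n powr (1 / 2)"
      have N: "0 < ?N" using n by simp
      have s: "sqrt ?N = ?N powr (1 / 2)" by (simp add: powr_half_sqrt)
      have P: "(\<Sum>k<n. surv k x y) \<le> ?P" using sum_surv_le[OF y K, of n] unfolding s .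
      have l: "(?N powr (1 / 4)) powr (2 - \<alpha>) = ?N powr ((2 - \<alpha>) / 4)" by (simp add: powr_powr)
      have "sqrt ?N * err ?N (?N powr (1 / 4)) n x y \<le> ?N powr (1 / 2) *
          (?N powr (- 1) * (?w + ?N powr (1 / 4) * H + ?N powr ((2 - \<alpha>) / 4) * (?w + ?P)) + ?N powr (- (\<alpha> / 2)) * (?w + ?P))"
        unfolding err_def s l using P H by (intro mult_left_mono add_mono order_refl) auto
      also have "\<dots> = ?w * ?N powr (1 / 2 + - 1) + H * ?N powr (1 / 2 + - 1 + 1 / 4) + (?w + 1) * ?N powr (1 / 2 + - 1 + (2 - \<alpha>) / 4)
        + 2 * K * ?N powr (1 / 2 + - 1 + (2 - \<alpha>) / 4 + 1 / 2) + (?w + 1) * ?N powr (1 / 2 + - (\<alpha> / 2)) + 2 * K * ?N powr (1 / 2 + - (\<alpha> / 2) + 1 / 2)"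
      proof -
        have "a * (b * (w + c * H + d * (w + (1 + 2 * K * a))) + e * (w + (1 + 2 * K * a)))
          = w * (a * b) + H * (a * b * c) + (w + 1) * (a * b * d) + 2 * K * (a * b * d * a) + (w + 1) * (a * e) + 2 * K * (a * e * a)"
          for a b c d e w :: real by (simp add: algebra_simps)
        then show ?thesis unfolding powr_add by this
      qed
      also have "\<dots> = ?g n"
      proof -
        have "1 / 2 + - 1 = - (1 / 2 :: real)" "1 / 2 + - 1 + 1 / 4 = - (1 / 4 :: real)"
          "1 / 2 + - 1 + (2 - \<alpha>) / 4 = (2 - \<alpha>) / 4 - 1 / 2" "1 / 2 + - 1 + (2 - \<alpha>) / 4 + 1 / 2 = (2 - \<alpha>) / 4"
          "1 / 2 + - (\<alpha> / 2) = (1 - \<alpha>) / 2" "1 / 2 + - (\<alpha> / 2) + 1 / 2 = 1 - \<alpha> / 2"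
          by (auto simp: field_simps)
        then show ?thesis by presburger
      qed
      finally show "sqrt ?N * err ?N (?N powr (1 / 4)) n x y \<le> ?g n" .
    qed
  qed
qed

text \<open>The limit of the means of Z on survival, see \<open>mean_linear_tendsto\<close>. The
  series converges absolutely because \<open>exit_abs\<close> is bounded in n.\<close>

definition V :: "real \<Rightarrow> real \<Rightarrow> real" where
  "V x y = y + \<rho> * x - (\<Sum>k. mean k (exiting (\<lambda>x y. y + \<rho> * x)) x y)"

lemma summable_exit_abs:
  assumes "0 < y"
  shows "summable (\<lambda>k. mean k (exiting (\<lambda>x y. \<bar>x\<bar>)) x y)"
proof -
  obtain H where "\<forall>n. exit_abs n x y \<le> H" using exit_abs_finite[OF assms] by blast
  then show ?thesis
    using assms by (intro bounded_imp_summable[of _ H] mean_exiting_nonneg adm_abs)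
      (auto simp: exit_abs_def simp del: sum.lessThan_Suc simp flip: lessThan_Suc_atMost)
qed

lemma summable_exit_linear:
  assumes "0 < y"
  shows "summable (\<lambda>k. mean k (exiting (\<lambda>x y. y + \<rho> * x)) x y)"
  by (rule summable_comparison_test'[OF summable_mult[OF summable_exit_abs[OF assms]]])
    (use exit_linear_bound[OF assms] in auto)

lemma mean_linear_tendsto:
  assumes "0 < y"
  shows "(\<lambda>n. mean n (\<lambda>x y. y + \<rho> * x) x y) \<longlonglongrightarrow> V x y"
  unfolding mean_martingale V_def
  by (intro tendsto_diff tendsto_const summable_LIMSEQ summable_exit_linear assms)

definition sg :: real where "sg = sqrt sig2"

lemma sg_pos: "0 < sg" using sig2_pos by (simp add: sg_def)

lemma sg_square: "sg * sg = sig2" using sig2_pos by (simp add: sg_def)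

text \<open>Slope at the origin, multiplied by sqrt n, of the two profiles centred at plus and minus
  c sg sqrt n when their variance is sig2 q n. At q = 1 the exponential factor is the Rayleigh
  tail.\<close>

definition kap :: "real \<Rightarrow> real \<Rightarrow> real" where
  "kap c q = 2 / sg * (exp (- c\<^sup>2 / (2 * q)) / sqrt q)"

lemma kap_bound: "0 < h \<Longrightarrow> h \<le> q \<Longrightarrow> \<bar>kap c q\<bar> \<le> 2 / sg * (1 / sqrt h)"
proof -
  assume h: "0 < h" "h \<le> q"
  have "exp (- c\<^sup>2 / (2 * q)) / sqrt q \<le> 1 / sqrt h" using h by (intro frac_le) auto
  then have "2 / sg * (exp (- c\<^sup>2 / (2 * q)) / sqrt q) \<le> 2 / sg * (1 / sqrt h)"
    using sg_pos by (intro mult_left_mono) auto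
  moreover have "0 \<le> kap c q" unfolding kap_def using sg_pos h by simp
  ultimately show ?thesis by (simp only: kap_def abs_of_nonneg)
qed

lemma kap_tendsto: "(f \<longlongrightarrow> q) F \<Longrightarrow> 0 < q \<Longrightarrow> ((\<lambda>t. kap c (f t)) \<longlongrightarrow> kap c q) F"
  unfolding kap_def by (intro tendsto_intros) auto

text \<open>The odd solution equals its slope times Z up to second order. So sqrt n times the mean
  becomes the initial slope times z, minus the slopes at the exits times the exit values of Z. For a
  fixed exit time the remaining time is asymptotically n, so all slopes share one limit and
  \<open>V\<close> factors out.\<close>

lemma gauss_limit:
  assumes y: "0 < y" and h: "0 < h"
  shows "(\<lambda>n. sqrt (real n) * mean n (\<lambda>x y.
      gauss_prim ((y + \<rho> * x - c * sg * sqrt (real n)) / (sg * sqrt (h * real n)))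
      + gauss_prim ((y + \<rho> * x + c * sg * sqrt (real n)) / (sg * sqrt (h * real n)))) x y)
    \<longlonglongrightarrow> kap c (1 + h) * V x y"
proof -
  obtain D0 where D0: "D0 \<ge> 0" "\<And>N c. N \<ge> 1 \<Longrightarrow> heat_family sig2 N D0
      (\<lambda>i s z. N powr (real 0 / 2) * heat_kernel (0 + i) (sig2 * (real s + h * N)) (z - c))"
    using heat_family_heat_kernel[OF sig2_pos h, of 0 thesis] by simp
  define D where "D = 2 * D0"
  have D: "D \<ge> 0" using D0 by (simp add: D_def)
  define d where "d n = c * sg * sqrt (real n)" for n :: nat
  \<comment> \<open>With centres at plus and minus \<open>d n\<close>, the function of order i = 0
    is odd in z at every remaining time.\<close>
  define u where "u n i s z = heat_kernel i (sig2 * (real s + h * real n)) (z - d n) + heat_kernel i (sig2 * (real s + h * real n)) (z - (- d n))"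
    for n :: nat and i s :: nat and z :: real
  have fam: "heat_family sig2 (real n) D (u n)" if "1 \<le> n" for n
    using heat_family_add[OF D0(2)[of "real n" "d n"] D0(2)[of "real n" "- d n"]] that by (simp add: u_def[abs_def] D_def)
  have odd: "u n 0 s 0 = 0" for n s
    by (simp add: u_def heat_kernel_def gauss_prim_minus)
  obtain Ce where Ce: "Ce \<ge> 0" "\<forall>N D u x y m n l. 1 \<le> N \<longrightarrow> heat_family sig2 N D u \<longrightarrow> 0 < y \<longrightarrow> m \<le> n \<longrightarrow> 0 < l \<longrightarrow>
    \<bar>mean n (\<lambda>x y. u 0 0 (y + \<rho> * x)) x y - mean m (\<lambda>x y. u 0 (n - m) (y + \<rho> * x)) x y
      + (\<Sum>k=m..<n. mean k (exiting (\<lambda>x y. u 0 (n - Suc k) (y + \<rho> * x))) x y)\<bar>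
    \<le> Ce * D * err N l n x y"
    using evolution by blast
  obtain C2 where C2: "C2 \<ge> 0" "\<forall>x y l. \<forall>n::nat. 0 < y \<longrightarrow> 0 < l \<longrightarrow>
    (\<Sum>k<n. mean k (exiting (\<lambda>x y. 1 + x\<^sup>2)) x y) \<le> 1 + l * exit_abs n x y
      + l powr (2 - \<alpha>) * (C2 * (1 + \<bar>x\<bar> powr \<alpha> + (\<Sum>k<n. surv k x y)))"
    using exit_square_sum by blast
  let ?z = "y + \<rho> * x"
  define e where "e k = mean k (exiting (\<lambda>x y. y + \<rho> * x)) x y" for k
  define E where "E n = sqrt (real n) * err (real n) (real n powr (1 / 4)) n x y" for n :: nat
  have E0: "E \<longlonglongrightarrow> 0" unfolding E_def by (rule err_tendsto_0[OF y])
  define S where "S n = (\<Sum>k<n. mean k (exiting (\<lambda>x y. 1 + x\<^sup>2)) x y)" for n :: nat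
  \<comment> \<open>The constant 2 D of the quadratic error at exit, times the square of the ratio 1
    + |\<rho>| between Z and the position there.\<close>
  let ?R = "2 * D * (1 + \<bar>\<rho>\<bar>)\<^sup>2"
  \<comment> \<open>The linear part of the expansion. An exit at time k + 1 leaves n - k - 1 steps,
    divided by n and shifted by \<open>h\<close>.\<close>
  define T where "T n = kap c (1 + h) * ?z - (\<Sum>k<n. kap c (real (n - Suc k) / real n + h) * e k)" for n :: nat
  define X where "X n = sqrt (real n) * mean n (\<lambda>x y. u n 0 0 (y + \<rho> * x)) x y" for n :: nat
  have main: "\<bar>X n - T n\<bar> \<le> (Ce * D + ?R * (1 + C2)) * E n + real n powr (- (1 / 2)) * (2 * D * ?z\<^sup>2)"
    if n: "1 \<le> n" for n
  proof -
    let ?N = "real n" and ?l = "real n powr (1 / 4)"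
    have N: "1 \<le> ?N" "0 < ?N" using n by auto
    have l: "0 < ?l" using N by simp
    have sN: "sqrt ?N * ?N powr (- 1) = ?N powr (- (1 / 2))"
    proof -
      have "sqrt ?N * ?N powr (- 1) = ?N powr (1 / 2) * ?N powr (- 1)" by (simp add: powr_half_sqrt)
      also have "\<dots> = ?N powr (1 / 2 + - 1)" by (rule powr_add[symmetric])
      finally show ?thesis by simp
    qed
    note fn = fam[OF n]
    have kap_eq: "sqrt ?N * u n 1 s 0 = kap c (real s / ?N + h)" for s
    proof -
      let ?v = "sig2 * (real s + h * ?N)" and ?q = "real s / ?N + h"
      have q: "?q > 0" using N h by (intro add_nonneg_pos) auto
      have vq: "?v = sig2 * ?N * ?q" using N by (simp add: field_simps)
      have v: "?v > 0" unfolding vq using sig2_pos N q by simp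
      have "(0 - d n)\<^sup>2 / (2 * ?v) = c\<^sup>2 / (2 * ?q)" "(0 - (- d n))\<^sup>2 / (2 * ?v) = c\<^sup>2 / (2 * ?q)"
        unfolding vq d_def using N sig2_pos by (auto simp: power_mult_distrib sg_def)
      then have "u n 1 s 0 = 2 * (exp (- c\<^sup>2 / (2 * ?q)) / sqrt ?v)"
        unfolding u_def heat_kernel_one[OF v] by (simp add: minus_divide_left[symmetric])
      moreover have "sqrt ?v = sg * sqrt ?N * sqrt ?q" unfolding vq by (simp add: real_sqrt_mult sg_def)
      ultimately show ?thesis using N sg_pos q by (simp add: kap_def)
    qed
    \<comment> \<open>The value at 0 vanishes by oddness; the Taylor remainder and the quadratic
      term each cost D z^2 / N.\<close>
    have tay: "\<bar>u n 0 s z - u n 1 s 0 * z\<bar> \<le> 2 * (D * ?N powr - 1) * z\<^sup>2" for s z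
    proof -
      have "(u n 0 s has_real_derivative u n 1 s z) (at z)" "(u n 1 s has_real_derivative u n 2 s z) (at z)"
        "(u n 2 s has_real_derivative u n 3 s z) (at z)" for z
        using heat_family_deriv[OF fn, of 0 s z] heat_family_deriv[OF fn, of 1 s z] heat_family_deriv[OF fn, of 2 s z]
        by (auto simp: numeral_2_eq_2 numeral_3_eq_3)
      moreover have u2: "\<bar>u n 2 s z\<bar> \<le> D * ?N powr - 1" for z using heat_family_bound[OF fn, of 2 s z] by simp
      moreover have "\<bar>u n 3 s z\<bar> \<le> D * ?N powr (- (3/2))" for z using heat_family_bound[OF fn, of 3 s z] by simp
      ultimately have t1: "\<bar>u n 0 s (0 + z) - u n 0 s 0 - u n 1 s 0 * z - u n 2 s 0 / 2 * z\<^sup>2\<bar> \<le> D * ?N powr - 1 * z\<^sup>2"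
        using Taylor_three_bound(1)[of "u n 0 s" "u n 1 s" "u n 2 s" "u n 3 s" "D * ?N powr - 1" "D * ?N powr (- (3/2))" 0 z] by simp
      have t2: "\<bar>u n 2 s 0 / 2 * z\<^sup>2\<bar> \<le> D * ?N powr - 1 * z\<^sup>2"
      proof -
        have "\<bar>p / 2\<bar> \<le> m" if "\<bar>p\<bar> \<le> m" for p m :: real using that by linarith
        from mult_right_mono[OF this[OF u2[of 0]], of "z\<^sup>2"] show ?thesis by (simp add: abs_mult)
      qed
      have gen: "\<bar>p - q\<bar> \<le> 2 * m * t" if "\<bar>p' - o' - q - r\<bar> \<le> m * t" "\<bar>r\<bar> \<le> m * t" "p' = p" "o' = 0" for p q r m t p' o' :: real
        using that by linarith
      show ?thesis by (rule gen[OF t1 t2 _ odd]) simp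
    qed
    have af: "adm (\<lambda>x y. u n 0 s (y + \<rho> * x))" for s by (rule adm_family[OF fn]) simp
    have ex: "\<bar>sqrt ?N * mean k (exiting (\<lambda>x y. u n 0 s (y + \<rho> * x))) x y - kap c (real s / ?N + h) * e k\<bar>
        \<le> ?N powr (- (1 / 2)) * (?R * mean k (exiting (\<lambda>x y. 1 + x\<^sup>2)) x y)" for k s
    proof -
      let ?f = "\<lambda>x y. 1 * u n 0 s (y + \<rho> * x) + (- u n 1 s 0) * (y + \<rho> * x)"
      let ?b = "?N powr (- 1) * ?R"
      have "\<bar>mean k (exiting ?f) x y\<bar> \<le> mean k (exiting (\<lambda>x y. ?b * (1 + x\<^sup>2))) x y"
      proof (intro mean_exiting_abs_le adm_add adm_cmult af adm_snd adm_fst adm_const adm_square y)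
        fix x y :: real assume xy: "y \<le> 0" "x \<le> y"
        have "\<bar>?f x y\<bar> \<le> 2 * (D * ?N powr - 1) * (y + \<rho> * x)\<^sup>2" using tay[of s "y + \<rho> * x"] by simp
        also have "\<dots> \<le> 2 * (D * ?N powr - 1) * ((1 + \<bar>\<rho>\<bar>)\<^sup>2 * (1 + x\<^sup>2))"
        proof (rule mult_left_mono)
          have "(y + \<rho> * x)\<^sup>2 \<le> ((1 + \<bar>\<rho>\<bar>) * \<bar>x\<bar>)\<^sup>2"
            using abs_linear_exit[OF xy] by (intro abs_le_square_iff[THEN iffD1]) simp
          also have "\<dots> = (1 + \<bar>\<rho>\<bar>)\<^sup>2 * x\<^sup>2" by (simp add: power_mult_distrib)
          also have "\<dots> \<le> (1 + \<bar>\<rho>\<bar>)\<^sup>2 * (1 + x\<^sup>2)" by (intro mult_left_mono) auto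
          finally show "(y + \<rho> * x)\<^sup>2 \<le> (1 + \<bar>\<rho>\<bar>)\<^sup>2 * (1 + x\<^sup>2)" .
        qed (use D in simp)
        also have "\<dots> = ?b * (1 + x\<^sup>2)" by (simp only: mult_ac)
        finally show "\<bar>?f x y\<bar> \<le> ?b * (1 + x\<^sup>2)" .
      qed
      also have "exiting (\<lambda>x y. ?b * (1 + x\<^sup>2)) = (\<lambda>x y. ?b * exiting (\<lambda>x y. 1 + x\<^sup>2) x y)"
        by (rule ext)+ (intro exiting_cmult adm_add adm_const adm_square)
      also have "mean k (\<lambda>x y. ?b * exiting (\<lambda>x y. 1 + x\<^sup>2) x y) x y = ?b * mean k (exiting (\<lambda>x y. 1 + x\<^sup>2)) x y"
        by (intro mean_cmult adm_exiting adm_add adm_const adm_square)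
      also have "exiting ?f = (\<lambda>x y. 1 * exiting (\<lambda>x y. u n 0 s (y + \<rho> * x)) x y + (- u n 1 s 0) * exiting (\<lambda>x y. y + \<rho> * x) x y)"
        by (rule exiting_linear[OF af adm_linear])
      also have "mean k (\<lambda>x y. 1 * exiting (\<lambda>x y. u n 0 s (y + \<rho> * x)) x y + (- u n 1 s 0) * exiting (\<lambda>x y. y + \<rho> * x) x y) x y
          = mean k (exiting (\<lambda>x y. u n 0 s (y + \<rho> * x))) x y - u n 1 s 0 * e k"
        unfolding e_def by (subst mean_linear[OF adm_exiting[OF af] adm_exiting[OF adm_linear]]) simp
      finally have "\<bar>mean k (exiting (\<lambda>x y. u n 0 s (y + \<rho> * x))) x y - u n 1 s 0 * e k\<bar> \<le> ?b * mean k (exiting (\<lambda>x y. 1 + x\<^sup>2)) x y" .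
      then have "sqrt ?N * \<bar>mean k (exiting (\<lambda>x y. u n 0 s (y + \<rho> * x))) x y - u n 1 s 0 * e k\<bar> \<le> sqrt ?N * (?b * mean k (exiting (\<lambda>x y. 1 + x\<^sup>2)) x y)"
        by (intro mult_left_mono) auto
      also have "\<dots> = (sqrt ?N * ?N powr (- 1)) * (?R * mean k (exiting (\<lambda>x y. 1 + x\<^sup>2)) x y)" by (simp only: mult_ac)
      also have "sqrt ?N * \<bar>mean k (exiting (\<lambda>x y. u n 0 s (y + \<rho> * x))) x y - u n 1 s 0 * e k\<bar>
          = \<bar>sqrt ?N * mean k (exiting (\<lambda>x y. u n 0 s (y + \<rho> * x))) x y - (sqrt ?N * u n 1 s 0) * e k\<bar>"
        using N by (simp only: mult.assoc right_diff_distrib[symmetric] abs_mult) simp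
      finally show ?thesis unfolding sN kap_eq .
    qed
    let ?M = "\<lambda>k. mean k (exiting (\<lambda>x y. u n 0 (n - Suc k) (y + \<rho> * x))) x y"
    have 1: "\<bar>X n - sqrt ?N * u n 0 n ?z + sqrt ?N * (\<Sum>k<n. ?M k)\<bar> \<le> Ce * D * E n"
    proof -
      have "\<bar>mean n (\<lambda>x y. u n 0 0 (y + \<rho> * x)) x y - u n 0 n ?z + (\<Sum>k<n. ?M k)\<bar> \<le> Ce * D * err ?N ?l n x y"
        using Ce(2)[rule_format, OF N(1) fn y le0 l, of n x] by (simp add: lessThan_atLeast0)
      then have "sqrt ?N * \<bar>mean n (\<lambda>x y. u n 0 0 (y + \<rho> * x)) x y - u n 0 n ?z + (\<Sum>k<n. ?M k)\<bar> \<le> sqrt ?N * (Ce * D * err ?N ?l n x y)"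
        by (intro mult_left_mono) auto
      also have "sqrt ?N * \<bar>mean n (\<lambda>x y. u n 0 0 (y + \<rho> * x)) x y - u n 0 n ?z + (\<Sum>k<n. ?M k)\<bar>
          = \<bar>sqrt ?N * (mean n (\<lambda>x y. u n 0 0 (y + \<rho> * x)) x y - u n 0 n ?z + (\<Sum>k<n. ?M k))\<bar>"
        by (simp add: abs_mult)
      finally show ?thesis unfolding X_def E_def by (simp only: distrib_left right_diff_distrib mult_ac)
    qed
    have 2: "\<bar>sqrt ?N * u n 0 n ?z - kap c (1 + h) * ?z\<bar> \<le> ?N powr (- (1 / 2)) * (2 * D * ?z\<^sup>2)"
    proof -
      have "sqrt ?N * \<bar>u n 0 n ?z - u n 1 n 0 * ?z\<bar> \<le> sqrt ?N * (2 * (D * ?N powr - 1) * ?z\<^sup>2)"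
        by (intro mult_left_mono tay) auto
      also have "\<dots> = (sqrt ?N * ?N powr - 1) * (2 * D * ?z\<^sup>2)" by (simp only: mult_ac)
      also have "sqrt ?N * \<bar>u n 0 n ?z - u n 1 n 0 * ?z\<bar> = \<bar>sqrt ?N * u n 0 n ?z - (sqrt ?N * u n 1 n 0) * ?z\<bar>"
        by (simp only: mult.assoc right_diff_distrib[symmetric] abs_mult) simp
      finally show ?thesis unfolding sN kap_eq using N by simp
    qed
    have 3: "\<bar>sqrt ?N * (\<Sum>k<n. ?M k) - (\<Sum>k<n. kap c (real (n - Suc k) / ?N + h) * e k)\<bar> \<le> ?R * (1 + C2) * E n"
    proof -
      have "sqrt ?N * (\<Sum>k<n. ?M k) - (\<Sum>k<n. kap c (real (n - Suc k) / ?N + h) * e k)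
          = (\<Sum>k<n. sqrt ?N * ?M k - kap c (real (n - Suc k) / ?N + h) * e k)"
        by (simp only: sum_subtractf sum_distrib_left)
      then have "\<bar>sqrt ?N * (\<Sum>k<n. ?M k) - (\<Sum>k<n. kap c (real (n - Suc k) / ?N + h) * e k)\<bar>
          \<le> (\<Sum>k<n. ?N powr (- (1 / 2)) * (?R * mean k (exiting (\<lambda>x y. 1 + x\<^sup>2)) x y))"
        using ex by (simp only: order_trans[OF sum_abs sum_mono])
      also have "\<dots> = ?R * (?N powr (- (1 / 2)) * S n)"
        unfolding S_def by (simp only: sum_distrib_left[symmetric] mult_ac)
      also have "\<dots> \<le> ?R * ((1 + C2) * E n)"
      proof (rule mult_left_mono)
        let ?P = "\<Sum>k<n. surv k x y" and ?U = "?l powr (2 - \<alpha>)"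
        have P: "?P \<ge> 0" by (rule sum_surv_nonneg[OF y])
        have "S n \<le> 1 + ?l * exit_abs n x y + ?U * (C2 * (wt x + ?P))"
          using C2(2)[rule_format, OF y l, of x n] unfolding S_def wt_def .
        also have "\<dots> \<le> (1 + C2) * (wt x + ?l * exit_abs n x y + ?U * (wt x + ?P))"
        proof -
          have "1 + H + U * (C2 * W) \<le> (1 + C2) * (w + H + U * W)" if "1 \<le> w" "0 \<le> H" "0 \<le> U * W" for H U W w :: real
          proof -
            have "0 \<le> C2 * w" "0 \<le> C2 * H" using that C2(1) by auto
            then show ?thesis using that by (simp add: algebra_simps)
          qed
          then show ?thesis using wt_ge_one[of x] exit_abs_nonneg[OF y, of n x] P by simp
        qed
        finally have S: "S n \<le> (1 + C2) * (wt x + ?l * exit_abs n x y + ?U * (wt x + ?P))" .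
        have "?N powr (- (1 / 2)) * S n \<le> ?N powr (- (1 / 2)) * ((1 + C2) * (wt x + ?l * exit_abs n x y + ?U * (wt x + ?P)))"
          by (intro mult_left_mono S) auto
        also have "\<dots> = (1 + C2) * (sqrt ?N * (?N powr (- 1) * (wt x + ?l * exit_abs n x y + ?U * (wt x + ?P))))"
          unfolding sN[symmetric] by (simp only: mult_ac)
        also have "\<dots> \<le> (1 + C2) * E n"
          unfolding E_def err_def using C2(1) P wt_ge_one[of x] by (intro mult_left_mono) auto
        finally show "?N powr (- (1 / 2)) * S n \<le> (1 + C2) * E n" .
      qed (use D in simp)
      finally show ?thesis by (simp only: mult.assoc)
    qed
    have "\<bar>X - (k - t)\<bar> \<le> (A + B) * E' + Z" if "\<bar>X - p + s\<bar> \<le> A * E'" "\<bar>p - k\<bar> \<le> Z" "\<bar>s - t\<bar> \<le> B * E'" for X p s k t A B E' Z :: real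
      unfolding distrib_right using that by linarith
    from this[OF 1 2 3] show ?thesis unfolding T_def .
  qed
  have "T \<longlonglongrightarrow> kap c (1 + h) * ?z - (\<Sum>k. kap c (1 + h) * e k)"
  proof -
    \<comment> \<open>Extended by 0 beyond n, the finite sums become series with a summable bound
      uniform in n, as Tannery's theorem requires.\<close>
    define b where "b k n = (if k < n then kap c (real (n - Suc k) / real n + h) * e k else 0)" for k n
    let ?B = "2 / sg * (1 / sqrt h)"
    have se: "summable (\<lambda>k. ?B * ((1 + \<bar>\<rho>\<bar>) * mean k (exiting (\<lambda>x y. \<bar>x\<bar>)) x y))"
      by (intro summable_mult summable_exit_abs y)
    have B: "?B \<ge> 0" using sg_pos h by simp
    have bb: "norm (b k n) \<le> ?B * ((1 + \<bar>\<rho>\<bar>) * mean k (exiting (\<lambda>x y. \<bar>x\<bar>)) x y)" for k n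
    proof (cases "k < n")
      case True
      have "\<bar>kap c (real (n - Suc k) / real n + h)\<bar> * \<bar>e k\<bar> \<le> ?B * ((1 + \<bar>\<rho>\<bar>) * mean k (exiting (\<lambda>x y. \<bar>x\<bar>)) x y)"
        unfolding e_def using h B by (intro mult_mono kap_bound exit_linear_bound y) auto
      then show ?thesis using True by (simp add: b_def abs_mult)
    next
      case False
      then show ?thesis using B mean_exiting_nonneg[OF adm_abs _ y, of k x] by (simp add: b_def)
    qed
    have lim: "((\<lambda>n. b k n) \<longlongrightarrow> kap c (1 + h) * e k) sequentially" for k
    proof -
      have "(\<lambda>n. 1 - real (Suc k) / real n + h) \<longlonglongrightarrow> 1 - 0 + h"
        by (intro tendsto_intros lim_const_over_n)
      then have "(\<lambda>n. kap c (1 - real (Suc k) / real n + h) * e k) \<longlonglongrightarrow> kap c (1 + h) * e k"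
        using h by (intro tendsto_mult tendsto_const kap_tendsto) auto
      moreover have "eventually (\<lambda>n. b k n = kap c (1 - real (Suc k) / real n + h) * e k) sequentially"
      proof (rule eventually_mono[OF eventually_gt_at_top[of k]])
        fix n assume "k < n"
        then have "real (n - Suc k) / real n = 1 - real (Suc k) / real n" by (simp add: of_nat_diff field_simps)
        with \<open>k < n\<close> show "b k n = kap c (1 - real (Suc k) / real n + h) * e k" by (simp add: b_def)
      qed
      ultimately show ?thesis by (simp add: filterlim_cong)
    qed
    have "((\<lambda>n. \<Sum>k. b k n) \<longlongrightarrow> (\<Sum>k. kap c (1 + h) * e k)) sequentially"
      using tannerys_theorem[of b "\<lambda>k. kap c (1 + h) * e k" sequentially, OF lim _ se] bb
      by (simp add: always_eventually case_prod_unfold)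
    moreover have "(\<Sum>k. b k n) = (\<Sum>k<n. kap c (real (n - Suc k) / real n + h) * e k)" for n
      by (subst suminf_finite[of "{..<n}"]) (auto simp: b_def)
    ultimately show ?thesis unfolding T_def by (intro tendsto_diff tendsto_const) simp
  qed
  moreover have "(\<Sum>k. kap c (1 + h) * e k) = kap c (1 + h) * (\<Sum>k. e k)"
    unfolding e_def by (rule suminf_mult[OF summable_exit_linear[OF y]])
  ultimately have T: "T \<longlonglongrightarrow> kap c (1 + h) * V x y"
    unfolding V_def e_def by (simp add: right_diff_distrib)
  have "(\<lambda>n. (Ce * D + ?R * (1 + C2)) * E n + real n powr (- (1 / 2)) * (2 * D * ?z\<^sup>2)) \<longlonglongrightarrow> (Ce * D + ?R * (1 + C2)) * 0 + 0 * (2 * D * ?z\<^sup>2)"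
    by (intro tendsto_add tendsto_mult tendsto_const E0 tendsto_neg_powr filterlim_real_sequentially) auto
  then have "(\<lambda>n. (Ce * D + ?R * (1 + C2)) * E n + real n powr (- (1 / 2)) * (2 * D * ?z\<^sup>2)) \<longlonglongrightarrow> 0"
    by (simp only: mult_zero_right mult_zero_left add_0)
  moreover have "eventually (\<lambda>n. norm (X n - T n) \<le> (Ce * D + ?R * (1 + C2)) * E n + real n powr (- (1 / 2)) * (2 * D * ?z\<^sup>2)) sequentially"
    using eventually_ge_at_top[of 1] by (rule eventually_mono) (simp only: real_norm_def main)
  ultimately have "(\<lambda>n. X n - T n) \<longlonglongrightarrow> 0"
    by (rule Lim_null_comparison[rotated])
  from tendsto_add[OF this T] have X: "X \<longlonglongrightarrow> kap c (1 + h) * V x y" by simp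
  have eq: "X n = sqrt (real n) * mean n (\<lambda>x y.
      gauss_prim ((y + \<rho> * x - c * sg * sqrt (real n)) / (sg * sqrt (h * real n)))
      + gauss_prim ((y + \<rho> * x + c * sg * sqrt (real n)) / (sg * sqrt (h * real n)))) x y" if "1 \<le> n" for n
    unfolding X_def u_def d_def heat_kernel_def using that sig2_pos h by (simp add: real_sqrt_mult sg_def)
  show ?thesis
    by (rule Lim_transform_eventually[OF X], rule eventually_mono[OF eventually_ge_at_top[of 1]], erule eq)
qed

section \<open>Tails of the walk on survival\<close>

lemma adm_of_bool: "Measurable.pred (borel \<Otimes>\<^sub>M borel) (case_prod P) \<Longrightarrow> adm (\<lambda>x y. of_bool (P x y))"
  by (rule adm_bounded[of _ 1]) (auto simp: case_prod_unfold)

text \<open>The event concerns the walk Y, the odd test function the martingale Z. In units of sg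
  sqrt n the step is smoothed over width e^2 and the critical window has half-width e. If Z is far
  from Y, the position is large and the weight pays; if Z lies in the window, the bump pays;
  otherwise the smoothed step is accurate.\<close>

lemma tail_approx:
  assumes c: "0 \<le> c" "c = 0 \<or> 2 * e \<le> c" and e: "0 < e"
  shows "\<exists>C\<ge>0. \<forall>n x y. 1 \<le> n \<longrightarrow> 0 < y \<longrightarrow>
    \<bar>of_bool (c * sg * sqrt (real n) < y) -
      1 / (2 * gauss_sup) * (gauss_prim ((y + \<rho> * x - c * sg * sqrt (real n)) / (sg * sqrt (e ^ 4 * real n)))
        + gauss_prim ((y + \<rho> * x + c * sg * sqrt (real n)) / (sg * sqrt (e ^ 4 * real n))))\<bar>
    \<le> (1 - gauss_prim (1 / e) / gauss_sup) * 1
      + (2 * exp (1 / 2)) * exp (- (y + \<rho> * x - c * sg * sqrt (real n))\<^sup>2 / (2 * (sig2 * e\<^sup>2 * real n)))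
      + C / real n * wt x"
proof -
  define C where "C = 8 * \<rho>\<^sup>2 / (e\<^sup>2 * sig2)"
  have C: "C \<ge> 0" using sig2_pos by (simp add: C_def)
  have "\<bar>of_bool (c * sg * sqrt (real n) < y) -
      1 / (2 * gauss_sup) * (gauss_prim ((y + \<rho> * x - c * sg * sqrt (real n)) / (sg * sqrt (e ^ 4 * real n)))
        + gauss_prim ((y + \<rho> * x + c * sg * sqrt (real n)) / (sg * sqrt (e ^ 4 * real n))))\<bar>
    \<le> (1 - gauss_prim (1 / e) / gauss_sup) * 1
      + (2 * exp (1 / 2)) * exp (- (y + \<rho> * x - c * sg * sqrt (real n))\<^sup>2 / (2 * (sig2 * e\<^sup>2 * real n)))
      + C / real n * wt x" (is "?L \<le> ?T * 1 + ?K * ?b + ?w")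
    if n: "1 \<le> n" and y: "0 < y" for n x y
  proof -
    let ?q = "sg * sqrt (real n)"
    have q: "?q > 0" using sg_pos n by simp
    have q2: "?q\<^sup>2 = sig2 * real n" by (simp add: power_mult_distrib power2_eq_square[of sg] sg_square)
    define Z where "Z = (y + \<rho> * x) / ?q"
    define Y where "Y = y / ?q"
    have z: "y + \<rho> * x = Z * ?q" and yq: "y = Y * ?q" using q by (auto simp: Z_def Y_def)
    have Y0: "Y > 0" using y q by (simp add: Y_def)
    have s4: "sg * sqrt (e ^ 4 * real n) = e\<^sup>2 * ?q"
    proof -
      have "sqrt (e ^ 4) = e\<^sup>2" using real_sqrt_abs[of "e\<^sup>2"] by (simp flip: power_mult)
      then show ?thesis by (simp add: real_sqrt_mult)
    qed
    have "(Z * ?q - c * sg * sqrt (real n)) / (e\<^sup>2 * ?q) = (Z - c) / e\<^sup>2"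
      "(Z * ?q + c * sg * sqrt (real n)) / (e\<^sup>2 * ?q) = (Z + c) / e\<^sup>2"
    proof -
      have "Z * ?q - c * sg * sqrt (real n) = (Z - c) * ?q" "Z * ?q + c * sg * sqrt (real n) = (Z + c) * ?q"
        by (simp_all only: left_diff_distrib distrib_right mult.assoc)
      then show "(Z * ?q - c * sg * sqrt (real n)) / (e\<^sup>2 * ?q) = (Z - c) / e\<^sup>2"
        "(Z * ?q + c * sg * sqrt (real n)) / (e\<^sup>2 * ?q) = (Z + c) / e\<^sup>2" using n sg_pos by auto
    qed
    moreover have "c * sg * sqrt (real n) < y \<longleftrightarrow> c < Y" using q by (simp add: Y_def pos_less_divide_eq mult.assoc)
    ultimately have L: "?L = \<bar>of_bool (c < Y) - (gauss_prim ((Z - c) / e\<^sup>2) + gauss_prim ((Z + c) / e\<^sup>2)) / (2 * gauss_sup)\<bar>"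
      unfolding s4 z by simp
    have T0: "0 \<le> ?T" using gauss_prim_le_sup[of "1 / e"] gauss_sup_pos by simp
    have b0: "0 \<le> ?K * ?b" by simp
    have w0: "0 \<le> ?w" using C wt_ge_one[of x] by simp
    have gen: "l \<le> t * 1 + k + w" if "0 \<le> t" "0 \<le> k" "0 \<le> w" "l \<le> t \<or> l \<le> 2 \<and> (2 \<le> k \<or> 2 \<le> w)" for l t k w :: real
      using that by auto
    have two: "?L \<le> 2" unfolding L by (rule gauss_prim_ratio_bound)
    consider "e / 2 < \<bar>Z - Y\<bar>" | "\<bar>Z - c\<bar> \<le> e" | "\<bar>Z - Y\<bar> \<le> e / 2" "e < \<bar>Z - c\<bar>" by linarith
    then show ?thesis
    proof cases
      case 1
      have "Z - Y = \<rho> * x / ?q" by (simp add: Z_def Y_def add_divide_distrib)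
      then have "e / 2 \<le> \<bar>\<rho> * x / ?q\<bar>" using 1 by simp
      then have "(e / 2)\<^sup>2 \<le> (\<rho> * x / ?q)\<^sup>2" using e by (intro abs_le_square_iff[THEN iffD1]) simp
      moreover have "(\<rho> * x / ?q)\<^sup>2 = \<rho>\<^sup>2 * x\<^sup>2 / (sig2 * real n)"
        by (simp only: power_divide q2 power_mult_distrib[of \<rho>])
      ultimately have "(e / 2)\<^sup>2 \<le> \<rho>\<^sup>2 * x\<^sup>2 / (sig2 * real n)" by simp
      then have "e\<^sup>2 / 4 \<le> \<rho>\<^sup>2 * x\<^sup>2 / (sig2 * real n)" by (simp add: power_divide)
      then have "8 / e\<^sup>2 * (e\<^sup>2 / 4) \<le> 8 / e\<^sup>2 * (\<rho>\<^sup>2 * x\<^sup>2 / (sig2 * real n))" by (intro mult_left_mono) auto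
      moreover have "8 / e\<^sup>2 * (e\<^sup>2 / 4) = 2" using e by simp
      ultimately have "2 \<le> 8 / e\<^sup>2 * (\<rho>\<^sup>2 * x\<^sup>2 / (sig2 * real n))" by simp
      also have "\<dots> = C / real n * x\<^sup>2" by (simp add: C_def)
      also have "\<dots> \<le> ?w" using C square_le_powr[of x] unfolding wt_def by (intro mult_left_mono) auto
      finally have "2 \<le> ?w" .
      then show ?thesis using two by (intro gen T0 b0 w0) blast
    next
      case 2
      have "Z * ?q - c * sg * sqrt (real n) = (Z - c) * ?q" by (simp only: left_diff_distrib mult.assoc)
      then have "(y + \<rho> * x - c * sg * sqrt (real n))\<^sup>2 = (Z - c)\<^sup>2 * (sig2 * real n)"
        unfolding z by (simp only: power_mult_distrib[of "Z - c"] q2)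
      also have "\<dots> \<le> e\<^sup>2 * (sig2 * real n)"
        using 2 e sig2_pos by (intro mult_right_mono abs_le_square_iff[THEN iffD1]) auto
      finally have "- (1 / 2) \<le> - (y + \<rho> * x - c * sg * sqrt (real n))\<^sup>2 / (2 * (sig2 * e\<^sup>2 * real n))"
        using e sig2_pos n by (simp add: divide_simps mult_ac)
      then have "exp (- (1 / 2)) \<le> ?b" by (subst exp_le_cancel_iff)
      then have "?K * exp (- (1 / 2)) \<le> ?K * ?b" by (intro mult_left_mono) auto
      moreover have "?K * exp (- (1 / 2)) = 2" by (simp add: exp_minus)
      ultimately have "2 \<le> ?K * ?b" by linarith
      then show ?thesis using two by (intro gen T0 b0 w0) blast
    next
      case 3
      have "?L \<le> ?T" unfolding L by (rule indicator_gauss_prim[OF e c 3 Y0])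
      then show ?thesis by (intro gen T0 b0 w0) blast
    qed
  qed
  with C show ?thesis by blast
qed

text \<open>First n tends to infinity with \<open>e\<close> fixed, then \<open>e\<close> to 0. The
  window costs a multiple of sqrt (2 e^2), and the smoothing replaces the scaled variance 1 by 1 +
  e^4. The case c = 0 gives the asymptotics of survival itself.\<close>

lemma tail_limit:
  assumes y: "0 < y" and c: "0 \<le> c"
  shows "(\<lambda>n. sqrt (real n) * mean n (\<lambda>x y. of_bool (c * sg * sqrt (real n) < y)) x y)
    \<longlonglongrightarrow> 1 / (2 * gauss_sup) * (kap c 1 * V x y)"
proof (rule LIMSEQ_I)
  fix d :: real assume d: "0 < d"
  let ?lim = "1 / (2 * gauss_sup) * (kap c 1 * V x y)"
  define a where "a n = sqrt (real n) * mean n (\<lambda>x y. of_bool (c * sg * sqrt (real n) < y)) x y" for n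
  obtain K where K: "K \<ge> 0" "\<forall>n\<ge>1. surv n x y \<le> K * real n powr (- (1 / 2))" using surv_decay[OF y] by blast
  \<comment> \<open>Stated for two comparable times, since it is applied at n and at n div
    2.\<close>
  have Ks: "sqrt (real n) * surv m x y \<le> 2 * K" if "1 \<le> m" "real n \<le> 4 * real m" for n m
  proof -
    have "sqrt (real n) \<le> sqrt (4 * real m)" using that by simp
    then have "sqrt (real n) * surv m x y \<le> (2 * sqrt (real m)) * (K * real m powr (- (1 / 2)))"
      using K that surv_nonneg[OF y, of m x] by (intro mult_mono) (auto simp: real_sqrt_mult)
    also have "\<dots> = 2 * K * (sqrt (real m) * real m powr (- (1 / 2)))" by simp
    also have "sqrt (real m) * real m powr (- (1 / 2)) = 1"
      using that by (simp add: powr_half_sqrt[symmetric] powr_add[symmetric])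
    finally show ?thesis by simp
  qed
  define tau where "tau e = 1 - gauss_prim (1 / e) / gauss_sup" for e
  \<comment> \<open>The part of the error that remains after the limit in n; it vanishes as
    \<open>e\<close> tends to 0.\<close>
  define del where "del e = tau e * (2 * K) + 2 * exp (1 / 2) * (sqrt (2 * e\<^sup>2) * (2 * K))
    + \<bar>1 / (2 * gauss_sup) * (kap c (1 + e ^ 4) * V x y) - ?lim\<bar>" for e :: real
  have "((\<lambda>e. gauss_prim (1 / e)) \<longlongrightarrow> gauss_sup) (at_right 0)"
  proof (rule filterlim_compose[OF gauss_prim_tendsto])
    have "filterlim (\<lambda>e::real. inverse e) at_top (at_right 0)" by (rule filterlim_inverse_at_top_right)
    then show "filterlim (\<lambda>e::real. 1 / e) at_top (at_right 0)" by (simp add: inverse_eq_divide)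
  qed
  then have "(tau \<longlongrightarrow> 1 - gauss_sup / gauss_sup) (at_right 0)"
    unfolding tau_def using gauss_sup_pos by (intro tendsto_intros) auto
  then have tau: "(tau \<longlongrightarrow> 0) (at_right 0)" using gauss_sup_pos by simp
  have id0: "((\<lambda>e::real. e) \<longlongrightarrow> 0) (at_right 0)" by (rule tendsto_ident_at)
  have "((\<lambda>e. kap c (1 + e ^ 4)) \<longlongrightarrow> kap c (1 + 0 ^ 4)) (at_right 0)"
    by (intro kap_tendsto tendsto_intros id0) auto
  then have "((\<lambda>e. kap c (1 + e ^ 4)) \<longlongrightarrow> kap c 1) (at_right 0)" by simp
  moreover have "((\<lambda>e::real. sqrt (2 * e\<^sup>2)) \<longlongrightarrow> sqrt (2 * 0\<^sup>2)) (at_right 0)"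
    by (intro tendsto_intros id0)
  then have "((\<lambda>e::real. sqrt (2 * e\<^sup>2)) \<longlongrightarrow> 0) (at_right 0)" by simp
  ultimately have "(del \<longlongrightarrow> 0 * (2 * K) + 2 * exp (1 / 2) * (0 * (2 * K)) + \<bar>?lim - ?lim\<bar>) (at_right 0)"
    unfolding del_def by (intro tendsto_intros tau)
  then have "(del \<longlongrightarrow> 0) (at_right 0)" by simp
  then have "eventually (\<lambda>e. del e < d / 2) (at_right 0)" using d by (intro order_tendstoD(2)) auto
  moreover have "eventually (\<lambda>e. c = 0 \<or> 2 * e \<le> c) (at_right (0::real))"
  proof (cases "c = 0")
    case False
    then have "c / 2 > 0" using c by simp
    then have "eventually (\<lambda>e. e \<in> {0<..<c / 2}) (at_right (0::real))" by (rule eventually_at_right_real)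
    then show ?thesis by eventually_elim auto
  qed simp
  moreover have "eventually (\<lambda>e::real. 0 < e) (at_right 0)" by (simp add: eventually_at_filter)
  ultimately have "eventually (\<lambda>e. del e < d / 2 \<and> (c = 0 \<or> 2 * e \<le> c) \<and> 0 < e) (at_right 0)"
    by eventually_elim auto
  then obtain e where e: "del e < d / 2" "c = 0 \<or> 2 * e \<le> c" "0 < e"
    using eventually_happens'[OF trivial_limit_at_right_real[of "0::real"]] by blast
  define f where "f n = (\<lambda>x y. gauss_prim ((y + \<rho> * x - c * sg * sqrt (real n)) / (sg * sqrt (e ^ 4 * real n)))
        + gauss_prim ((y + \<rho> * x + c * sg * sqrt (real n)) / (sg * sqrt (e ^ 4 * real n))))" for n :: nat
  define bp where "bp n = (\<lambda>x y. exp (- (y + \<rho> * x - c * sg * sqrt (real n))\<^sup>2 / (2 * (sig2 * e\<^sup>2 * real n))))" for n :: nat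
  obtain C where C: "C \<ge> 0" "\<forall>n x y. 1 \<le> n \<longrightarrow> 0 < y \<longrightarrow>
    \<bar>of_bool (c * sg * sqrt (real n) < y) - 1 / (2 * gauss_sup) * f n x y\<bar>
    \<le> tau e * 1 + (2 * exp (1 / 2)) * bp n x y + C / real n * wt x"
    using tail_approx[OF c e(2,3)] unfolding tau_def f_def bp_def by blast
  obtain C2 where C2: "C2 \<ge> 0" "\<forall>n x y c l. 2 \<le> n \<longrightarrow> 0 < y \<longrightarrow> 0 < l \<longrightarrow>
    mean n (\<lambda>x y. exp (- (y + \<rho> * x - c)\<^sup>2 / (2 * (sig2 * e\<^sup>2 * real n)))) x y
    \<le> sqrt (2 * e\<^sup>2) * surv (n div 2) x y + C2 * err (real n) l n x y"
    using concentration[of "e\<^sup>2"] e by auto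
  obtain C3 where C3: "C3 \<ge> 0" "\<forall>n x y. 0 < y \<longrightarrow> mean n (\<lambda>x y. wt x) x y \<le> C3 * wt x"
    using mean_wt_bound by blast
  define r where "r n = 2 * exp (1 / 2) * C2 * (sqrt (real n) * err (real n) (real n powr (1 / 4)) n x y)
    + C * C3 * wt x * real n powr (- (1 / 2))" for n
  define b where "b n = sqrt (real n) * mean n (f n) x y" for n
  have af: "adm (f n)" for n
  proof -
    have "adm (\<lambda>x y. gauss_prim ((y + \<rho> * x + t) / q))" for t q
    proof (rule adm_bounded)
      show "case_prod (\<lambda>x y. gauss_prim ((y + \<rho> * x + t) / q)) \<in> borel_measurable (borel \<Otimes>\<^sub>M borel)"
        unfolding case_prod_unfold
        by (rule measurable_compose[where g = gauss_prim], measurable)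
          (intro borel_measurable_continuous_onI continuous_at_imp_continuous_on ballI DERIV_isCont[OF gauss_prim_deriv])
    qed (rule abs_gauss_prim_le_sup)
    from adm_add[OF this[of "- (c * sg * sqrt (real n))"] this] show ?thesis unfolding f_def by simp
  qed
  have ab: "adm (bp n)" for n unfolding bp_def using sig2_pos by (intro adm_bump) auto
  have ai: "adm (\<lambda>x y. of_bool (c * sg * sqrt (real n) < y))" for n by (rule adm_of_bool) (simp add: case_prod_unfold)
  have main: "\<bar>a n - 1 / (2 * gauss_sup) * b n\<bar> \<le> tau e * (2 * K) + 2 * exp (1 / 2) * (sqrt (2 * e\<^sup>2) * (2 * K)) + r n"
    if n: "2 \<le> n" for n
  proof -
    have N: "0 < real n" "1 \<le> n" using n by auto
    have T0: "0 \<le> tau e" unfolding tau_def using gauss_prim_le_sup[of "1 / e"] gauss_sup_pos by simp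
    have "mean n (\<lambda>x y. of_bool (c * sg * sqrt (real n) < y) - 1 / (2 * gauss_sup) * f n x y) x y
        = mean n (\<lambda>x y. of_bool (c * sg * sqrt (real n) < y)) x y - 1 / (2 * gauss_sup) * mean n (f n) x y"
      by (subst mean_minus[OF ai adm_cmult[OF af]], subst mean_cmult[OF af]) (rule refl)
    then have eq: "a n - 1 / (2 * gauss_sup) * b n = sqrt (real n) * mean n (\<lambda>x y. of_bool (c * sg * sqrt (real n) < y) - 1 / (2 * gauss_sup) * f n x y) x y"
      unfolding a_def b_def by (simp only: right_diff_distrib mult_ac)
    have "\<bar>mean n (\<lambda>x y. of_bool (c * sg * sqrt (real n) < y) - 1 / (2 * gauss_sup) * f n x y) x y\<bar>
        \<le> mean n (\<lambda>x y. tau e * 1 + (2 * exp (1 / 2)) * bp n x y + C / real n * wt x) x y"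
      using C(2) N by (intro mean_abs_le adm_diff adm_add adm_cmult ai af ab adm_const adm_wt y) auto
    also have "\<dots> = tau e * surv n x y + (2 * exp (1 / 2)) * mean n (bp n) x y + C / real n * mean n (\<lambda>x y. wt x) x y"
      unfolding surv_def
      by (subst mean_plus, intro adm_add adm_cmult adm_const ab, intro adm_cmult adm_wt,
          subst mean_linear[OF adm_const ab], subst mean_cmult[OF adm_wt]) (rule refl)
    also have "\<dots> \<le> tau e * surv n x y + (2 * exp (1 / 2)) * (sqrt (2 * e\<^sup>2) * surv (n div 2) x y + C2 * err (real n) (real n powr (1 / 4)) n x y)
        + C / real n * (C3 * wt x)"
      unfolding bp_def using C2(2) C3(2) n y N C(1) by (intro add_mono mult_left_mono order_refl) auto
    finally have "sqrt (real n) * \<bar>mean n (\<lambda>x y. of_bool (c * sg * sqrt (real n) < y) - 1 / (2 * gauss_sup) * f n x y) x y\<bar> \<le>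
        sqrt (real n) * (tau e * surv n x y + (2 * exp (1 / 2)) * (sqrt (2 * e\<^sup>2) * surv (n div 2) x y + C2 * err (real n) (real n powr (1 / 4)) n x y)
        + C / real n * (C3 * wt x))"
      by (intro mult_left_mono) auto
    also have "\<dots> = tau e * (sqrt (real n) * surv n x y) + 2 * exp (1 / 2) * (sqrt (2 * e\<^sup>2) * (sqrt (real n) * surv (n div 2) x y)) + r n"
    proof -
      have "sqrt (real n) / real n = real n powr (- (1 / 2))"
      proof -
        have "real n powr (- (1 / 2)) = 1 / sqrt (real n)" by (simp only: powr_minus_divide powr_half_sqrt of_nat_0_le_iff)
        also have "\<dots> = sqrt (real n) / real n" by (rule frac_eq_eq[THEN iffD2]) (use N in auto)
        finally show ?thesis by simp
      qed
      then have "r n = 2 * exp (1 / 2) * C2 * (sqrt (real n) * err (real n) (real n powr (1 / 4)) n x y) + C * C3 * wt x * (sqrt (real n) / real n)"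
        unfolding r_def by simp
      then show ?thesis by (simp add: algebra_simps)
    qed
    also have "\<dots> \<le> tau e * (2 * K) + 2 * exp (1 / 2) * (sqrt (2 * e\<^sup>2) * (2 * K)) + r n"
    proof (intro add_mono mult_left_mono order_refl)
      show "sqrt (real n) * surv n x y \<le> 2 * K" using N by (intro Ks) auto
      show "sqrt (real n) * surv (n div 2) x y \<le> 2 * K" using n by (intro Ks) linarith+
    qed (use T0 in auto)
    finally show ?thesis unfolding eq by (simp only: abs_mult) simp
  qed
  have "r \<longlonglongrightarrow> 2 * exp (1 / 2) * C2 * 0 + C * C3 * wt x * 0"
    unfolding r_def by (intro tendsto_add tendsto_mult tendsto_const err_tendsto_0 y tendsto_neg_powr filterlim_real_sequentially) auto
  then have "r \<longlonglongrightarrow> 0" by simp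
  moreover have "(\<lambda>n. 1 / (2 * gauss_sup) * b n) \<longlonglongrightarrow> 1 / (2 * gauss_sup) * (kap c (1 + e ^ 4) * V x y)"
    unfolding b_def f_def using e by (intro tendsto_mult tendsto_const gauss_limit y) auto
  ultimately have "eventually (\<lambda>n. \<bar>r n - 0\<bar> < d / 4) sequentially"
    "eventually (\<lambda>n. \<bar>1 / (2 * gauss_sup) * b n - 1 / (2 * gauss_sup) * (kap c (1 + e ^ 4) * V x y)\<bar> < d / 4) sequentially"
    using d unfolding tendsto_iff dist_real_def by (metis zero_less_divide_iff zero_less_numeral)+
  then have "eventually (\<lambda>n. \<bar>a n - ?lim\<bar> < d) sequentially"
    using eventually_ge_at_top[of 2]
  proof eventually_elim
    case (elim n)
    have "\<bar>a - l\<bar> < d" if "\<bar>r - 0\<bar> < d / 4" "\<bar>b - b'\<bar> < d / 4" "\<bar>a - b\<bar> \<le> s + t + r" "s + t + \<bar>b' - l\<bar> < d / 2" for a b b' l r s t :: real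
      using that by linarith
    from this[OF elim(1,2) main[OF elim(3)] e(1)[unfolded del_def]] show ?case .
  qed
  then show "\<exists>no. \<forall>n\<ge>no. norm (sqrt (real n) * mean n (\<lambda>x y. of_bool (c * sg * sqrt (real n) < y)) x y - ?lim) < d"
    unfolding eventually_sequentially a_def real_norm_def .
qed

section \<open>Positivity of the limit constant\<close>

text \<open>Exits before time y^2 are treated by truncation at the level d y with survival bounded
  by 1, later exits by the bootstrap bound with an exponential close to 1. On the region the initial
  weight is at most 2 y^2, so both parts are small multiples of y once c, and with it y, is
  large.\<close>

lemma exit_abs_cone:
  assumes th: "0 < \<theta>" "\<theta> \<le> 1"
  shows "\<exists>c\<ge>1. \<forall>x y n. c * (1 + x\<^sup>2) \<le> y \<longrightarrow> exit_abs n x y \<le> \<theta> * y"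
proof -
  obtain C1 where C1: "C1 \<ge> 0" "\<forall>x y l m n. 0 < y \<longrightarrow> 0 < l \<longrightarrow> m \<le> n \<longrightarrow>
    exit_abs n x y \<le> exit_abs m x y + l * surv m x y
      + l powr (1 - \<alpha>) * (C1 * (1 + \<bar>x\<bar> powr \<alpha> + (\<Sum>k=m..<n. surv k x y)))"
    using exit_abs_increment by blast
  obtain Cb where Cb: "Cb \<ge> 0" "\<forall>x y m n. 0 < y \<longrightarrow> 1 \<le> m \<longrightarrow>
    1 + y + \<bar>x\<bar> powr (\<alpha> / 2) + real m powr (- (1 / 2)) * wt x + exit_abs n x y
    \<le> (1 + y + \<bar>x\<bar> powr (\<alpha> / 2) + real m powr (- (1 / 2)) * wt x + exit_abs m x y)
      * exp (Cb * real m powr (1 / \<alpha> - 1 / 2))"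
    using exit_abs_bound by blast
  \<comment> \<open>The early exits produce two terms of size d y, half of the allowance; the other
    half is left for the late exits.\<close>
  define d where "d = \<theta> / 4"
  have d: "d > 0" using th by (simp add: d_def)
  have neg: "1 / \<alpha> - 1 / 2 < 0" using \<alpha>_gt by (simp add: field_simps)
  have "((\<lambda>c. 4 * C1 * d powr (1 - \<alpha>) * c powr (2 - \<alpha>)) \<longlongrightarrow> 4 * C1 * d powr (1 - \<alpha>) * 0) at_top"
    using \<alpha>_gt by (intro tendsto_mult tendsto_const tendsto_neg_powr filterlim_ident) auto
  then have "eventually (\<lambda>c. 4 * C1 * d powr (1 - \<alpha>) * c powr (2 - \<alpha>) < d) at_top"
    using d by (intro order_tendstoD(2)) auto
  moreover have "((\<lambda>c. 6 * (exp (Cb * c powr (1 / \<alpha> - 1 / 2)) - 1)) \<longlongrightarrow> 6 * (exp (Cb * 0) - 1)) at_top"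
    using neg by (intro tendsto_intros tendsto_neg_powr filterlim_ident)
  then have "eventually (\<lambda>c. 6 * (exp (Cb * c powr (1 / \<alpha> - 1 / 2)) - 1) < \<theta> / 2) at_top"
    using th by (intro order_tendstoD(2)) auto
  ultimately have "eventually (\<lambda>c. 4 * C1 * d powr (1 - \<alpha>) * c powr (2 - \<alpha>) < d \<and>
      6 * (exp (Cb * c powr (1 / \<alpha> - 1 / 2)) - 1) < \<theta> / 2 \<and> 1 \<le> c) at_top"
    using eventually_ge_at_top[of 1] by eventually_elim auto
  then obtain c where c: "4 * C1 * d powr (1 - \<alpha>) * c powr (2 - \<alpha>) < d"
      "6 * (exp (Cb * c powr (1 / \<alpha> - 1 / 2)) - 1) < \<theta> / 2" "1 \<le> c"
    unfolding eventually_at_top_linorder by blast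
  have "exit_abs n x y \<le> \<theta> * y" if xy: "c * (1 + x\<^sup>2) \<le> y" for x y n
  proof -
    have "c * 1 \<le> c * (1 + x\<^sup>2)" "1 * (1 + x\<^sup>2) \<le> c * (1 + x\<^sup>2)" using c(3) by (intro mult_left_mono mult_right_mono; simp)+
    then have cy: "c \<le> y" "1 + x\<^sup>2 \<le> y" using xy by auto
    have y1: "1 \<le> y" and y: "0 < y" using cy(1) c(3) by auto
    have w: "wt x \<le> 2 * y\<^sup>2"
    proof -
      have "\<bar>x\<bar> powr \<alpha> \<le> 1 + \<bar>x\<bar> ^ 4" using \<alpha>_pos \<alpha>_le by (intro powr_le_one_plus_power) auto
      also have "\<bar>x\<bar> ^ 4 = (x\<^sup>2)\<^sup>2" by (simp flip: power_mult)
      finally have "wt x \<le> 2 + (x\<^sup>2)\<^sup>2" by (simp add: wt_def)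
      also have "\<dots> \<le> 2 * (1 + x\<^sup>2)\<^sup>2" by (simp add: power2_sum)
      also have "\<dots> \<le> 2 * y\<^sup>2" using cy(2) by (intro mult_left_mono power_mono) auto
      finally show ?thesis .
    qed
    \<comment> \<open>The diffusive time scale belonging to the height y.\<close>
    define m where "m = nat \<lceil>y\<^sup>2\<rceil>"
    have m: "y\<^sup>2 \<le> real m" "real m \<le> 2 * y\<^sup>2"
    proof -
      show "y\<^sup>2 \<le> real m" unfolding m_def by (rule real_nat_ceiling_ge)
      have "real m < y\<^sup>2 + 1" unfolding m_def using of_int_ceiling_le_add_one[of "y\<^sup>2"]
        by (simp add: ceiling_less_iff[symmetric]) linarith
      moreover have "1 \<le> y\<^sup>2" using y1 by (simp add: one_le_power)
      ultimately show "real m \<le> 2 * y\<^sup>2" by linarith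
    qed
    have "1 \<le> y\<^sup>2" using y1 by (simp add: one_le_power)
    then have m1: "1 \<le> m" "0 < real m" using m(1) by auto
    let ?H = "exit_abs m x y" and ?e = "exp (Cb * real m powr (1 / \<alpha> - 1 / 2))"
    have H: "?H \<le> \<theta> / 2 * y"
    proof -
      have l: "0 < d * y" using d y by simp
      have "(\<Sum>k=0..<m. surv k x y) \<le> (\<Sum>k=0..<m. 1)" by (intro sum_mono surv_le_one y)
      then have s: "1 + \<bar>x\<bar> powr \<alpha> + (\<Sum>k=0..<m. surv k x y) \<le> 4 * y\<^sup>2"
        using w m(2) unfolding wt_def by simp
      have "?H \<le> d * y + (d * y) powr (1 - \<alpha>) * (C1 * (1 + \<bar>x\<bar> powr \<alpha> + (\<Sum>k=0..<m. surv k x y)))"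
        using C1(2)[rule_format, OF y l le0, of m x] by (simp add: exit_abs_def)
      also have "\<dots> \<le> d * y + (d * y) powr (1 - \<alpha>) * (C1 * (4 * y\<^sup>2))"
        using C1(1) s by (intro add_left_mono mult_left_mono) auto
      also have "\<dots> = d * y + 4 * C1 * d powr (1 - \<alpha>) * y powr (2 - \<alpha>) * y"
      proof -
        have "(d * y) powr (1 - \<alpha>) = d powr (1 - \<alpha>) * y powr (1 - \<alpha>)" using d y by (intro powr_mult)
        moreover have "y powr (1 - \<alpha>) * y\<^sup>2 = y powr (2 - \<alpha>) * y"
          using y powr_add[of y "2 - \<alpha>" 1] powr_add[of y "1 - \<alpha>" 2] by simp
        ultimately show ?thesis by (simp add: mult_ac)
      qed
      also have "\<dots> \<le> d * y + d * y"
      proof (intro add_left_mono mult_right_mono)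
        have "y powr (2 - \<alpha>) \<le> c powr (2 - \<alpha>)" using cy(1) c(3) \<alpha>_gt by (intro powr_mono2') auto
        then have "4 * C1 * d powr (1 - \<alpha>) * y powr (2 - \<alpha>) \<le> 4 * C1 * d powr (1 - \<alpha>) * c powr (2 - \<alpha>)"
          using C1(1) by (intro mult_left_mono) auto
        with c(1) show "4 * C1 * d powr (1 - \<alpha>) * y powr (2 - \<alpha>) \<le> d" by linarith
      qed (use y in auto)
      finally show ?thesis by (simp add: d_def)
    qed
    define B where "B = 1 + y + \<bar>x\<bar> powr (\<alpha> / 2) + real m powr (- (1 / 2)) * wt x"
    have B: "B \<le> 5 * y"
    proof -
      have "\<bar>x\<bar> powr (\<alpha> / 2) \<le> 1 + \<bar>x\<bar> ^ 2" using \<alpha>_pos \<alpha>_le by (intro powr_le_one_plus_power) auto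
      then have 1: "\<bar>x\<bar> powr (\<alpha> / 2) \<le> y" using cy(2) by simp
      have "real m powr (- (1 / 2)) \<le> (y\<^sup>2) powr (- (1 / 2))" using m(1) y by (intro powr_mono2') auto
      also have "\<dots> = 1 / y" using y by (simp add: powr_minus_divide powr_half_sqrt)
      finally have "real m powr (- (1 / 2)) * wt x \<le> 1 / y * (2 * y\<^sup>2)"
        using w wt_ge_one[of x] y by (intro mult_mono) auto
      also have "\<dots> = 2 * y" using y by (simp add: power2_eq_square)
      finally show ?thesis using 1 y1 by (simp add: B_def)
    qed
    have e1: "1 \<le> ?e" using Cb(1) by simp
    have "?e \<le> exp (Cb * c powr (1 / \<alpha> - 1 / 2))"
    proof -
      have "y * 1 \<le> y * y" using y1 by (intro mult_left_mono) auto
      then have "c \<le> real m" using m(1) cy(1) by (simp add: power2_eq_square)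
      then have "real m powr (1 / \<alpha> - 1 / 2) \<le> c powr (1 / \<alpha> - 1 / 2)"
        using c(3) neg by (intro powr_mono2') auto
      then show ?thesis using Cb(1) by (simp add: mult_left_mono)
    qed
    then have "6 * (?e - 1) \<le> 6 * (exp (Cb * c powr (1 / \<alpha> - 1 / 2)) - 1)" by (intro mult_left_mono diff_right_mono) auto
    then have e2: "6 * (?e - 1) \<le> \<theta> / 2" by (rule order_trans[OF _ less_imp_le[OF c(2)]])
    have "B + exit_abs n x y \<le> (B + ?H) * ?e" using Cb(2) y m1(1) unfolding B_def by blast
    then have "exit_abs n x y \<le> ?H + (B + ?H) * (?e - 1)" by (simp add: algebra_simps)
    also have "\<dots> \<le> \<theta> / 2 * y + (6 * y) * (?e - 1)"
    proof (intro add_mono H mult_right_mono)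
      have "\<theta> / 2 * y \<le> 1 * y" using th y by (intro mult_right_mono) auto
      then show "B + ?H \<le> 6 * y" using H B by linarith
    qed (use e1 in simp)
    also have "(6 * y) * (?e - 1) = (6 * (?e - 1)) * y" by simp
    also have "\<theta> / 2 * y + (6 * (?e - 1)) * y \<le> \<theta> / 2 * y + \<theta> / 2 * y"
      using e2 y by (intro add_left_mono mult_right_mono) auto
    finally show ?thesis by simp
  qed
  with c(3) show ?thesis by blast
qed

text \<open>Optional stopping, where the exits take at most y / 4 and the position term at most y /
  4; enlarging the threshold by a multiple of |\<rho>| secures the latter.\<close>

lemma mean_linear_cone:
  "\<exists>c\<ge>1. \<forall>x y n. c * (1 + x\<^sup>2) \<le> y \<longrightarrow> y / 2 \<le> mean n (\<lambda>x y. y + \<rho> * x) x y"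
proof -
  let ?r = "1 + \<bar>\<rho>\<bar>"
  have "0 < 1 / (4 * ?r)" "1 / (4 * ?r) \<le> 1" by (simp_all add: field_simps add_pos_nonneg)
  from exit_abs_cone[OF this] obtain c where c: "c \<ge> 1" "\<forall>x y n. c * (1 + x\<^sup>2) \<le> y \<longrightarrow> exit_abs n x y \<le> 1 / (4 * ?r) * y"
    by blast
  define c' where "c' = c + 4 * \<bar>\<rho>\<bar>"
  have "y / 2 \<le> mean n (\<lambda>x y. y + \<rho> * x) x y" if xy: "c' * (1 + x\<^sup>2) \<le> y" for x y n
  proof -
    have s: "0 \<le> 1 + x\<^sup>2" by simp
    have "c * (1 + x\<^sup>2) + 4 * \<bar>\<rho>\<bar> * (1 + x\<^sup>2) \<le> y" using xy by (simp only: c'_def distrib_right)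
    moreover have "0 \<le> 4 * \<bar>\<rho>\<bar> * (1 + x\<^sup>2)" by simp
    moreover have "1 \<le> c * (1 + x\<^sup>2)" using mult_mono[of 1 c 1 "1 + x\<^sup>2"] c(1) by simp
    ultimately have cy: "c * (1 + x\<^sup>2) \<le> y" "4 * \<bar>\<rho>\<bar> * (1 + x\<^sup>2) \<le> y" and y: "0 < y" by linarith+
    have "?r * exit_abs n x y \<le> ?r * (1 / (4 * ?r) * y)" using c(2) cy by (intro mult_left_mono) auto
    also have "\<dots> = y / 4" by (simp add: field_simps)
    finally have 1: "?r * exit_abs n x y \<le> y / 4" .
    have "\<bar>\<Sum>k<n. mean k (exiting (\<lambda>x y. y + \<rho> * x)) x y\<bar> \<le> (\<Sum>k<n. ?r * mean k (exiting (\<lambda>x y. \<bar>x\<bar>)) x y)"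
      by (rule order_trans[OF sum_abs sum_mono]) (rule exit_linear_bound[OF y])
    then have 2: "\<bar>\<Sum>k<n. mean k (exiting (\<lambda>x y. y + \<rho> * x)) x y\<bar> \<le> ?r * exit_abs n x y"
      unfolding exit_abs_def sum_distrib_left .
    have "\<bar>x\<bar> \<le> 1 + x\<^sup>2" using abs_le_square_iff[of x 1] sum_squares_bound[of "\<bar>x\<bar>" 1] by simp
    then have "\<bar>\<rho>\<bar> * \<bar>x\<bar> \<le> \<bar>\<rho>\<bar> * (1 + x\<^sup>2)" by (intro mult_left_mono) auto
    then have "\<bar>\<rho> * x\<bar> \<le> y / 4" using cy(2) by (simp add: abs_mult)
    with 1 2 show ?thesis unfolding mean_martingale by linarith
  qed
  moreover have "c' \<ge> 1" using c(1) by (simp add: c'_def)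
  ultimately show ?thesis by blast
qed

text \<open>Truncation at n^(1/8) costs a factor n^(1/4) against survival of order n^(-1/2), and the
  tail carries n^((2 - \<alpha>)/8). Consequently a lower bound of Z by minus a multiple of 1 + x^2
  is harmless in the limit.\<close>

lemma mean_square_tendsto_0:
  assumes y: "0 < y"
  shows "(\<lambda>n. mean n (\<lambda>x y. 1 + x\<^sup>2) x y) \<longlonglongrightarrow> 0"
proof -
  obtain K where K: "K \<ge> 0" "\<forall>n\<ge>1. surv n x y \<le> K * real n powr (- (1 / 2))" using surv_decay[OF y] by blast
  obtain C where C: "C \<ge> 0" "\<forall>n x y. 0 < y \<longrightarrow> mean n (\<lambda>x y. wt x) x y \<le> C * wt x"
    using mean_wt_bound by blast
  let ?g = "\<lambda>n. K * real n powr (- (1 / 2)) + K * real n powr (- (1 / 4)) + (C * wt x) * real n powr ((2 - \<alpha>) / 8)"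
  have z: "(\<lambda>n. real n powr a) \<longlonglongrightarrow> 0" if "a < 0" for a
    using that by (intro tendsto_neg_powr filterlim_real_sequentially)
  have "?g \<longlonglongrightarrow> K * 0 + K * 0 + (C * wt x) * 0"
    using \<alpha>_gt by (intro tendsto_add tendsto_mult tendsto_const z) auto
  then have g: "?g \<longlonglongrightarrow> 0" by simp
  have as: "adm (\<lambda>x y. 1 + x\<^sup>2)" by (intro adm_add adm_const adm_square)
  show ?thesis
  proof (rule tendsto_sandwich[OF _ _ tendsto_const g])
    show "eventually (\<lambda>n. 0 \<le> mean n (\<lambda>x y. 1 + x\<^sup>2) x y) sequentially"
      using y by (intro always_eventually allI mean_nonneg as) auto
    show "eventually (\<lambda>n. mean n (\<lambda>x y. 1 + x\<^sup>2) x y \<le> ?g n) sequentially"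
    proof (rule eventually_mono[OF eventually_ge_at_top[of 1]])
      fix n :: nat assume n: "1 \<le> n"
      let ?l = "real n powr (1 / 8)"
      have l: "0 < ?l" using n by simp
      have pw: "1 + x\<^sup>2 \<le> (1 + ?l powr 2) * 1 + ?l powr (2 - \<alpha>) * wt x" for x
      proof -
        have "x\<^sup>2 \<le> ?l powr 2 * \<bar>x\<bar> powr 0 + ?l powr (2 - \<alpha>) * \<bar>x\<bar> powr \<alpha>"
          using powr_split_tail[of "\<bar>x\<bar>" ?l 2 \<alpha> 0] l \<alpha>_gt by simp
        also have "\<dots> \<le> ?l powr 2 * 1 + ?l powr (2 - \<alpha>) * wt x"
          unfolding wt_def by (intro add_mono mult_left_mono) auto
        finally show ?thesis by simp
      qed
      have "mean n (\<lambda>x y. 1 + x\<^sup>2) x y \<le> mean n (\<lambda>x y. (1 + ?l powr 2) * 1 + ?l powr (2 - \<alpha>) * wt x) x y"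
        by (intro mean_mono as adm_add adm_cmult adm_const adm_wt pw y)
      also have "\<dots> = (1 + ?l powr 2) * surv n x y + ?l powr (2 - \<alpha>) * mean n (\<lambda>x y. wt x) x y"
        unfolding surv_def by (subst mean_linear[OF adm_const adm_wt]) (rule refl)
      also have "\<dots> \<le> (1 + ?l powr 2) * (K * real n powr (- (1 / 2))) + ?l powr (2 - \<alpha>) * (C * wt x)"
        using K n C y by (intro add_mono mult_left_mono) auto
      also have "\<dots> = ?g n"
      proof -
        have "?l powr 2 * real n powr (- (1 / 2)) = real n powr (- (1 / 4))"
          by (simp only: powr_powr powr_add[symmetric]) simp
        moreover have "?l powr (2 - \<alpha>) = real n powr ((2 - \<alpha>) / 8)" by (simp add: powr_powr)
        moreover have "(1 + p) * (K * q) + s * w = K * q + K * r + w * s" if "p * q = r" for p q r s w :: real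
          unfolding that[symmetric] by (simp add: algebra_simps)
        ultimately show ?thesis by metis
      qed
      finally show "mean n (\<lambda>x y. 1 + x\<^sup>2) x y \<le> ?g n" .
    qed
  qed
qed

text \<open>Quadratic growth in x suits both the martingale estimate and the sets
  \<open>K_set p c\<close> with p > 2, which lie in such a region after a change of
  constant.\<close>

definition cone :: "real \<Rightarrow> real \<Rightarrow> real \<Rightarrow> real" where
  "cone c x y = of_bool (c * (1 + x\<^sup>2) \<le> y)"

lemma adm_cone: "adm (cone c)"
  unfolding cone_def by (rule adm_of_bool) (simp add: case_prod_unfold)

text \<open>Markov property at time k: from the cone the later means of Z stay above 1 / 2,
  elsewhere they are at least minus a multiple of a mean that vanishes in the limit. Hence
  \<open>V\<close> is at least half the probability of being alive in the cone at time k.\<close>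

lemma V_pos:
  "\<exists>c\<ge>1. \<forall>x y k. 0 < y \<longrightarrow> 0 < mean k (cone c) x y \<longrightarrow> 0 < V x y"
proof -
  obtain c where c: "c \<ge> 1" "\<forall>x y n. c * (1 + x\<^sup>2) \<le> y \<longrightarrow> y / 2 \<le> mean n (\<lambda>x y. y + \<rho> * x) x y"
    using mean_linear_cone by blast
  have "0 < V x y" if y: "0 < y" and k: "0 < mean k (cone c) x y" for x y k
  proof -
    have as: "adm (\<lambda>x y. 1 + x\<^sup>2)" by (intro adm_add adm_const adm_square)
    have ge: "1 / 2 * mean k (cone c) x y - \<bar>\<rho>\<bar> * mean n (\<lambda>x y. 1 + x\<^sup>2) x y \<le> mean n (\<lambda>x y. y + \<rho> * x) x y"
      if n: "k \<le> n" for n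
    proof -
      let ?j = "n - k"
      have n': "n = k + ?j" using n by simp
      have "mean k (\<lambda>x y. 1 / 2 * cone c x y + (- \<bar>\<rho>\<bar>) * mean ?j (\<lambda>x y. 1 + x\<^sup>2) x y) x y
          \<le> mean k (mean ?j (\<lambda>x y. y + \<rho> * x)) x y"
      proof (intro mean_mono adm_add adm_cmult adm_cone adm_mean adm_linear adm_fst adm_snd adm_const adm_square y)
        fix x y :: real assume y: "0 < y"
        have sq: "\<bar>x\<bar> \<le> 1 + x\<^sup>2" for x :: real using sum_squares_bound[of "\<bar>x\<bar>" 1] by simp
        show "1 / 2 * cone c x y + (- \<bar>\<rho>\<bar>) * mean ?j (\<lambda>x y. 1 + x\<^sup>2) x y \<le> mean ?j (\<lambda>x y. y + \<rho> * x) x y"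
        proof (cases "c * (1 + x\<^sup>2) \<le> y")
          case True
          have "1 * 1 \<le> c * (1 + x\<^sup>2)" using c(1) by (intro mult_mono) auto
          then have "1 / 2 \<le> mean ?j (\<lambda>x y. y + \<rho> * x) x y" using c(2) True by (smt (verit) divide_right_mono)
          moreover have "0 \<le> \<bar>\<rho>\<bar> * mean ?j (\<lambda>x y. 1 + x\<^sup>2) x y" by (intro mult_nonneg_nonneg mean_nonneg as y) auto
          ultimately show ?thesis using True by (simp add: cone_def)
        next
          case False
          have "mean ?j (\<lambda>x y. (- \<bar>\<rho>\<bar>) * (1 + x\<^sup>2)) x y \<le> mean ?j (\<lambda>x y. y + \<rho> * x) x y"
          proof (intro mean_mono adm_cmult as adm_linear y)
            fix x y :: real assume "0 < y"
            have "- (\<rho> * x) \<le> \<bar>\<rho>\<bar> * \<bar>x\<bar>" by (metis abs_ge_minus_self abs_mult)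
            also have "\<dots> \<le> \<bar>\<rho>\<bar> * (1 + x\<^sup>2)" by (intro mult_left_mono sq) auto
            finally show "(- \<bar>\<rho>\<bar>) * (1 + x\<^sup>2) \<le> y + \<rho> * x" using \<open>0 < y\<close> by simp
          qed
          then have "(- \<bar>\<rho>\<bar>) * mean ?j (\<lambda>x y. 1 + x\<^sup>2) x y \<le> mean ?j (\<lambda>x y. y + \<rho> * x) x y"
            unfolding mean_cmult[OF as] .
          then show ?thesis using False by (simp add: cone_def)
        qed
      qed
      then show ?thesis
        unfolding mean_add[symmetric] n'[symmetric] mean_linear[OF adm_cone adm_mean[OF as]] by simp
    qed
    have "(\<lambda>n. 1 / 2 * mean k (cone c) x y - \<bar>\<rho>\<bar> * mean n (\<lambda>x y. 1 + x\<^sup>2) x y) \<longlonglongrightarrow> 1 / 2 * mean k (cone c) x y - \<bar>\<rho>\<bar> * 0"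
      by (intro tendsto_diff tendsto_mult tendsto_const mean_square_tendsto_0 y)
    then have "1 / 2 * mean k (cone c) x y - \<bar>\<rho>\<bar> * 0 \<le> V x y"
      by (rule tendsto_le[OF sequentially_bot mean_linear_tendsto[OF y]]) (rule eventually_mono[OF eventually_ge_at_top[of k] ge])
    then show ?thesis using k by simp
  qed
  with c(1) show ?thesis by blast
qed

lemma killed_eq_0:
  assumes "adm f" "\<And>x y. 0 < y \<Longrightarrow> 0 \<le> f x y" "killed f x y = 0"
  shows "AE w in M. 0 < y + (a w * x + b w) \<longrightarrow> f (a w * x + b w) (y + (a w * x + b w)) = 0"
proof -
  let ?f = "\<lambda>x y. if 0 < y then f x y else 0"
  have "adm ?f" by (intro adm_if adm_const assms)
  from integrable_step[OF this] have int: "integrable M (\<lambda>w. ?f (a w * x + b w) (y + (a w * x + b w)))" .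
  have "AE w in M. ?f (a w * x + b w) (y + (a w * x + b w)) = 0"
    using assms(3) unfolding killed_def transit_def
    by (subst (asm) integral_nonneg_eq_0_iff_AE[OF int]) (use assms(2) in auto)
  then show ?thesis by eventually_elim (auto split: if_splits)
qed

text \<open>Nullity is transferred through almost sure statements rather than inequalities, so
  \<open>g\<close> may be unbounded while \<open>f\<close> is an indicator.\<close>

lemma mean_eq_0:
  assumes "adm f" "\<And>x y. 0 < y \<Longrightarrow> 0 \<le> f x y" "\<And>x y. 0 < y \<Longrightarrow> f x y = 0 \<Longrightarrow> g x y = 0" "0 < y" "mean n f x y = 0"
  shows "mean n g x y = 0"
  using assms(4,5)
proof (induction n arbitrary: x y)
  case (Suc n)
  have "AE w in M. 0 < y + (a w * x + b w) \<longrightarrow> mean n f (a w * x + b w) (y + (a w * x + b w)) = 0"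
    using Suc.prems by (intro killed_eq_0 adm_mean assms(1) mean_nonneg assms(2)) (auto simp: mean_Suc')
  then have "AE w in M. (if 0 < y + (a w * x + b w) then mean n g (a w * x + b w) (y + (a w * x + b w)) else 0) = 0"
    by eventually_elim (auto intro: Suc.IH)
  then show ?case unfolding mean_Suc' killed_def transit_def by (rule integral_eq_zero_AE)
qed (use assms(3) in simp)

text \<open>
  If the cone were never reached, the martingale would be dominated on survival by the square of
  the position, whose mean on survival tends to zero.
\<close>

lemma reach_cone_of_pos:
  assumes \<rho>: "0 \<le> \<rho>" and y: "0 < y" and z: "0 < y + \<rho> * x" and c: "0 < c"
  shows "\<exists>k. 0 < mean k (cone c) x y"
proof (rule ccontr)
  assume "\<not> ?thesis"
  moreover have "0 \<le> mean k (cone c) x y" for k by (intro mean_nonneg adm_cone y) (simp add: cone_def)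
  ultimately have 0: "mean k (cone c) x y = 0" for k by (metis less_eq_real_def)
  \<comment> \<open>The martingale restricted to the cone, of mean zero under the assumption that
    the cone is never reached.\<close>
  define g where "g = (\<lambda>x y. cone c x y * (y + \<rho> * x))"
  have ag: "adm g"
  proof (rule adm_dominated[OF adm_linear[of \<rho>]])
    show "case_prod g \<in> borel_measurable (borel \<Otimes>\<^sub>M borel)"
      unfolding g_def case_prod_unfold by (intro borel_measurable_times adm_measurable[OF adm_cone]) auto
    show "\<bar>g x y\<bar> \<le> \<bar>y + \<rho> * x\<bar>" for x y by (simp add: g_def cone_def)
  qed
  have g0: "mean n g x y = 0" for n
    by (rule mean_eq_0[OF adm_cone _ _ y 0]) (auto simp: g_def cone_def)
  have as: "adm (\<lambda>x y. 1 + x\<^sup>2)" by (intro adm_add adm_const adm_square)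
  have up: "mean n (\<lambda>x y. y + \<rho> * x) x y \<le> (c + \<rho>) * mean n (\<lambda>x y. 1 + x\<^sup>2) x y" for n
  proof -
    have "mean n (\<lambda>x y. y + \<rho> * x) x y \<le> mean n (\<lambda>x y. (c + \<rho>) * (1 + x\<^sup>2) + 1 * g x y) x y"
    proof (intro mean_mono adm_linear adm_add adm_cmult as ag adm_snd adm_fst y adm_const adm_square)
      fix x y :: real assume y: "0 < y"
      show "y + \<rho> * x \<le> (c + \<rho>) * (1 + x\<^sup>2) + 1 * g x y"
      proof (cases "c * (1 + x\<^sup>2) \<le> y")
        case True
        then have "1 * g x y = y + \<rho> * x" by (simp add: g_def cone_def)
        moreover have "0 \<le> (c + \<rho>) * (1 + x\<^sup>2)" using c \<rho> by simp
        ultimately show ?thesis by linarith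
      next
        case False
        have "2 * x \<le> x\<^sup>2 + 1" using sum_squares_bound[of x 1] by simp
        then have "x \<le> 1 + x\<^sup>2" using zero_le_power2[of x] by linarith
        then have "\<rho> * x \<le> \<rho> * (1 + x\<^sup>2)" using \<rho> by (rule mult_left_mono)
        moreover have "1 * g x y = 0" using False by (simp add: g_def cone_def)
        ultimately show ?thesis using False unfolding distrib_right[of c] by linarith
      qed
    qed
    also have "\<dots> = (c + \<rho>) * mean n (\<lambda>x y. 1 + x\<^sup>2) x y"
      by (subst mean_linear[OF as ag]) (simp add: g0)
    finally show ?thesis .
  qed
  \<comment> \<open>At exit x \<le> y \<le> 0, so for nonnegative \<rho> the exit value of Z is
    nonpositive, and optional stopping can only raise the mean on survival.\<close>
  have lo: "y + \<rho> * x \<le> mean n (\<lambda>x y. y + \<rho> * x) x y" for n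
  proof -
    have ex: "exiting (\<lambda>x y. y + \<rho> * x) x y \<le> 0" if "0 < y" for x y
    proof -
      have "exiting (\<lambda>x y. y + \<rho> * x) x y \<le> exiting (\<lambda>x y. 0) x y"
        using \<rho> that by (intro exiting_mono adm_linear adm_const) (auto intro!: add_nonpos_nonpos mult_nonneg_nonpos)
      also have "\<dots> = 0" using exiting_cmult[OF adm_const, of 0 0 x y] by simp
      finally show ?thesis .
    qed
    have "mean k (exiting (\<lambda>x y. y + \<rho> * x)) x y \<le> 0" for k
    proof -
      have "mean k (exiting (\<lambda>x y. y + \<rho> * x)) x y \<le> mean k (\<lambda>x y. 0) x y"
        by (intro mean_mono adm_exiting adm_linear adm_const ex y)
      also have "\<dots> = 0" using mean_cmult[OF adm_const, of k 0 0 x y] by simp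
      finally show ?thesis .
    qed
    then show ?thesis unfolding mean_martingale using sum_nonpos[of "{..<n}" "\<lambda>k. mean k (exiting (\<lambda>x y. y + \<rho> * x)) x y"] by simp
  qed
  have "(\<lambda>n. (c + \<rho>) * mean n (\<lambda>x y. 1 + x\<^sup>2) x y) \<longlonglongrightarrow> (c + \<rho>) * 0"
    by (intro tendsto_mult tendsto_const mean_square_tendsto_0 y)
  then have "y + \<rho> * x \<le> (c + \<rho>) * 0"
    by (rule LIMSEQ_le_const) (use order_trans[OF lo up] in blast)
  then show False using z by simp
qed

text \<open>The initial Z may be nonpositive, so one step is made first. Surviving it from the lower
  height y / (1 + \<rho>) means that the new position exceeds - y / (1 + \<rho>), which makes Z
  positive after the step from height y. The survival assumption at the lower height gives this a
  positive probability.\<close>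

lemma reach_cone:
  assumes \<rho>: "0 \<le> \<rho>" and surv: "\<And>x y. 0 < y \<Longrightarrow> 0 < surv 1 x y" and y: "0 < y" and c: "0 < c"
  shows "\<exists>k. 0 < mean k (cone c) x y"
proof (rule ccontr)
  assume "\<not> ?thesis"
  moreover have nn: "0 \<le> mean k (cone c) x y" if "0 < y" for k x y
    by (intro mean_nonneg adm_cone that) (simp add: cone_def)
  ultimately have "killed (mean k (cone c)) x y = 0" for k
    using y mean_Suc'[of k "cone c"] by (metis less_eq_real_def)
  then have "AE w in M. 0 < y + (a w * x + b w) \<longrightarrow> mean k (cone c) (a w * x + b w) (y + (a w * x + b w)) = 0" for k
    by (intro killed_eq_0 adm_mean adm_cone nn) auto
  then have "AE w in M. \<forall>k. 0 < y + (a w * x + b w) \<longrightarrow> mean k (cone c) (a w * x + b w) (y + (a w * x + b w)) = 0"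
    by (subst AE_all_countable) blast
  then have ae: "AE w in M. (if 0 < y / (1 + \<rho>) + (a w * x + b w) then 1 else 0) = (0::real)"
  proof eventually_elim
    case (elim w)
    let ?x = "a w * x + b w"
    show ?case
    proof (rule ccontr)
      assume "\<not> ?case"
      then have "- y < (1 + \<rho>) * ?x" using \<rho> by (auto split: if_splits simp: field_simps)
      moreover have "\<rho> * ?x + ?x = (1 + \<rho>) * ?x" by (simp add: algebra_simps)
      ultimately have z: "0 < (y + ?x) + \<rho> * ?x" by linarith
      have "0 < y + ?x"
      proof (cases "?x \<ge> 0")
        case False
        then have "\<rho> * ?x \<le> 0" using \<rho> by (intro mult_nonneg_nonpos) auto
        then show ?thesis using z by linarith
      qed (use y in simp)
      with reach_cone_of_pos[OF \<rho> this z c] elim show False by auto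
    qed
  qed
  have "surv 1 x (y / (1 + \<rho>)) = 0"
  proof -
    have "surv 1 = killed (\<lambda>x y. 1)" by (simp add: surv_def mean_def)
    then show ?thesis unfolding killed_def transit_def using integral_eq_zero_AE[OF ae] by simp
  qed
  moreover have "0 < y / (1 + \<rho>)" using y \<rho> by simp
  ultimately show False using surv[of "y / (1 + \<rho>)" x] by simp
qed

text \<open>After multiplication by sqrt n, numerator and denominator both converge;
  \<open>V\<close>, \<open>gauss_sup\<close> and \<open>sg\<close> cancel, and \<open>V\<close> > 0
  keeps the limit of the denominator away from 0.\<close>

lemma conditional_limit:
  assumes y: "0 < y" and t: "0 \<le> t" and V: "0 < V x y"
  shows "(\<lambda>n. (surv n x y - mean n (\<lambda>x y. of_bool (t * sg * sqrt (real n) < y)) x y) / surv n x y)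
    \<longlonglongrightarrow> 1 - exp (- (t\<^sup>2) / 2)"
proof -
  let ?L = "\<lambda>c. 1 / (2 * gauss_sup) * (kap c 1 * V x y)"
  let ?m = "\<lambda>n. mean n (\<lambda>x y. of_bool (t * sg * sqrt (real n) < y)) x y"
  have k0: "kap 0 1 = 2 / sg" "kap t 1 = 2 / sg * exp (- (t\<^sup>2) / 2)" by (simp_all add: kap_def)
  have L0: "?L 0 \<noteq> 0" using V gauss_sup_pos sg_pos unfolding k0 by simp
  have ratio: "(?L 0 - ?L t) / ?L 0 = 1 - exp (- (t\<^sup>2) / 2)"
  proof -
    have "?L t = ?L 0 * exp (- (t\<^sup>2) / 2)" unfolding k0 by simp
    then have "?L 0 - ?L t = ?L 0 * (1 - exp (- (t\<^sup>2) / 2))" by (simp only: right_diff_distrib mult_1_right)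
    then show ?thesis by (simp only: nonzero_mult_div_cancel_left[OF L0])
  qed
  have s: "mean n (\<lambda>x y. of_bool (0 * sg * sqrt (real n) < y)) x y = surv n x y" for n
    unfolding surv_def using y
    by (intro antisym mean_mono adm_const adm_of_bool) (auto simp: case_prod_unfold)
  have "(\<lambda>n. (sqrt (real n) * surv n x y - sqrt (real n) * ?m n) / (sqrt (real n) * surv n x y)) \<longlonglongrightarrow> (?L 0 - ?L t) / ?L 0"
    using tail_limit[OF y t, of x] tail_limit[OF y order_refl, of x, unfolded s] L0
    by (intro tendsto_diff tendsto_divide)
  then show ?thesis unfolding ratio
    by (rule Lim_transform_eventually)
      (rule eventually_mono[OF eventually_gt_at_top[of 0]], simp flip: right_diff_distrib)
qed

section \<open>The chain as a Markov functional\<close>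

text \<open>
  By induction on \<open>n\<close>: the state at time \<open>n\<close> and the event \<open>{\<tau>\<^sub>y > n}\<close> are functions of the first
  \<open>n\<close> coefficients, hence independent of the next one.
\<close>

lemma expectation_alive:
  assumes iid: "iid_copies M a b A B"
    and f: "adm f" "\<And>x y. \<bar>f x y\<bar> \<le> C" and y: "0 < y"
  shows "(\<integral>w. (if \<forall>k\<in>{1..n}. 0 < y + affine_walk A B x k w
      then f (affine_chain A B x n w) (y + affine_walk A B x n w) else 0) \<partial>M) = mean n f x y"
  using f
proof (induction n arbitrary: f)
  case 0
  then show ?case by (simp add: prob_space)
next
  case (Suc n)
  have ind: "indep_vars (\<lambda>_. borel) (\<lambda>i w. (A i w, B i w)) {1..}"
    and law: "distr M borel (\<lambda>w. (A (Suc n) w, B (Suc n) w)) = distr M borel (\<lambda>w. (a w, b w))"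
    using iid unfolding iid_copies_def by auto
  let ?J = "{1..n}"
  let ?PJ = "PiM ?J (\<lambda>_. borel :: (real \<times> real) measure)"
  let ?T = "\<lambda>w. restrict (\<lambda>i. (A i w, B i w)) ?J"
  let ?Q = "\<lambda>w. (A (Suc n) w, B (Suc n) w)"
  let ?PR = "PiM {Suc n} (\<lambda>_. borel :: (real \<times> real) measure)"
  let ?R = "\<lambda>w. restrict (\<lambda>i. (A i w, B i w)) {Suc n}"
  \<comment> \<open>The next pair is kept as a family over a singleton, so that independence of
    disjoint blocks of indices applies.\<close>
  have "indep_var ?PJ ?T ?PR ?R"
    by (rule indep_var_restrict[OF ind]) auto
  then have T [measurable]: "?T \<in> M \<rightarrow>\<^sub>M ?PJ" and R [measurable]: "?R \<in> M \<rightarrow>\<^sub>M ?PR"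
    and joint: "distr M ?PJ ?T \<Otimes>\<^sub>M distr M ?PR ?R = distr M (?PJ \<Otimes>\<^sub>M ?PR) (\<lambda>w. (?T w, ?R w))"
    unfolding indep_var_distribution_eq by auto
  have Q: "?Q \<in> M \<rightarrow>\<^sub>M borel" using ind unfolding indep_vars_def by auto
  have last: "(\<lambda>\<omega>. \<omega> (Suc n)) \<in> ?PR \<rightarrow>\<^sub>M borel" by (rule measurable_component_singleton) simp
  let ?A = "\<lambda>i \<omega>. fst (\<omega> i)" and ?B = "\<lambda>i \<omega>. snd (\<omega> i)"
  have comp: "(\<lambda>\<omega>. \<omega> i) \<in> ?PJ \<rightarrow>\<^sub>M borel" if "1 \<le> i" "i \<le> n" for i
    using that by (intro measurable_component_singleton) auto
  have meas: "?A i \<in> borel_measurable ?PJ" "?B i \<in> borel_measurable ?PJ" if "1 \<le> i" "i \<le> n" for i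
    using measurable_compose[OF comp[OF that] fst_measurable_borel] measurable_compose[OF comp[OF that] snd_measurable_borel] by auto
  define X where "X = affine_chain ?A ?B x n"
  define W where "W k = affine_walk ?A ?B x k" for k
  have X [measurable]: "X \<in> borel_measurable ?PJ" unfolding X_def by (intro affine_chain_measurable meas)
  have W [measurable]: "W k \<in> borel_measurable ?PJ" if "k \<le> n" for k
    unfolding W_def using that by (intro affine_walk_measurable meas) auto
  have XT: "X (?T w) = affine_chain A B x n w" for w unfolding X_def by (intro affine_chain_cong) auto
  have WT: "W k (?T w) = affine_walk A B x k w" if "k \<le> n" for k w
    unfolding W_def using that by (intro affine_walk_cong) auto
  define al where "al \<omega> \<longleftrightarrow> (\<forall>k\<in>?J. 0 < y + W k \<omega>)" for \<omega>
  have alT: "al (?T w) \<longleftrightarrow> (\<forall>k\<in>?J. 0 < y + affine_walk A B x k w)" for w unfolding al_def using WT by auto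
  have al: "Measurable.pred ?PJ al" unfolding al_def
    by (intro pred_intros_finite finite_atLeastAtMost borel_measurable_const
        borel_measurable_pred_less borel_measurable_add W) auto
  \<comment> \<open>The integrand as a function of the past \<omega> and the next pair q; averaging
    over q with the generic law produces \<open>killed f\<close>.\<close>
  define G where "G = (\<lambda>\<omega> q. if al \<omega> \<and> 0 < y + W n \<omega> + (fst q * X \<omega> + snd q)
    then f (fst q * X \<omega> + snd q) (y + W n \<omega> + (fst q * X \<omega> + snd q)) else 0)"
  have [measurable]: "fst \<in> borel_measurable (borel :: (real \<times> real) measure)" "snd \<in> borel_measurable (borel :: (real \<times> real) measure)"
    by (rule fst_measurable_borel snd_measurable_borel)+
  note [measurable] = al W[OF order_refl]
  have G: "case_prod G \<in> borel_measurable (?PJ \<Otimes>\<^sub>M borel)"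
    unfolding G_def case_prod_unfold
  proof (intro measurable_If adm_measurable[OF Suc.prems(1)] borel_measurable_const)
    show "{p \<in> space (?PJ \<Otimes>\<^sub>M borel). al (fst p) \<and> 0 < y + W n (fst p) + (fst (snd p) * X (fst p) + snd (snd p))} \<in> sets (?PJ \<Otimes>\<^sub>M borel)"
      by measurable
  qed measurable
  define F where "F = (\<lambda>\<omega> r. G \<omega> (r (Suc n)))"
  have F: "case_prod F \<in> borel_measurable (?PJ \<Otimes>\<^sub>M ?PR)"
    using measurable_compose[OF measurable_Pair[OF measurable_fst measurable_compose[OF measurable_snd last]] G]
    by (simp add: F_def case_prod_unfold)
  have C: "0 \<le> C" using Suc.prems(2)[of 0 0] by linarith
  have Fb: "\<bar>F \<omega> r\<bar> \<le> C" for \<omega> r using Suc.prems(2) C by (simp add: F_def G_def)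
  interpret P1: prob_space "distr M ?PJ ?T" by (rule prob_space_distr) (rule T)
  interpret P2: prob_space "distr M ?PR ?R" by (rule prob_space_distr) (rule R)
  interpret P: pair_prob_space "distr M ?PJ ?T" "distr M ?PR ?R" ..
  have intF: "integrable (distr M ?PJ ?T \<Otimes>\<^sub>M distr M ?PR ?R) (case_prod F)"
    using F Fb by (intro P.integrable_const_bound[of _ C]) (auto cong: measurable_cong_sets)
  have inner: "(\<integral>r. F \<omega> r \<partial>distr M ?PR ?R) = (if al \<omega> then killed f (X \<omega>) (y + W n \<omega>) else 0)" if "\<omega> \<in> space ?PJ" for \<omega>
  proof -
    have Gq: "G \<omega> \<in> borel_measurable borel" using measurable_compose[OF measurable_Pair1'[OF that] G] by simp
    have Fq: "F \<omega> \<in> borel_measurable ?PR" unfolding F_def by (rule measurable_compose[OF last Gq])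
    have ab: "(\<lambda>w. (a w, b w)) \<in> M \<rightarrow>\<^sub>M borel" unfolding borel_prod[symmetric] by measurable
    have "(\<integral>r. F \<omega> r \<partial>distr M ?PR ?R) = (\<integral>w. G \<omega> (?Q w) \<partial>M)"
      unfolding integral_distr[OF R Fq] by (simp add: F_def)
    also have "\<dots> = (\<integral>q. G \<omega> q \<partial>distr M borel ?Q)" by (rule integral_distr[symmetric, OF Q Gq])
    also have "\<dots> = (\<integral>w. G \<omega> (a w, b w) \<partial>M)" unfolding law by (rule integral_distr[OF ab Gq])
    also have "\<dots> = (if al \<omega> then killed f (X \<omega>) (y + W n \<omega>) else 0)"
      by (simp add: G_def killed_def transit_def cong: if_cong)
    finally show ?thesis .
  qed
  have "(\<integral>w. (if \<forall>k\<in>{1..Suc n}. 0 < y + affine_walk A B x k w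
      then f (affine_chain A B x (Suc n) w) (y + affine_walk A B x (Suc n) w) else 0) \<partial>M)
      = (\<integral>w. case_prod F (?T w, ?R w) \<partial>M)"
  proof (intro Bochner_Integration.integral_cong refl)
    fix w
    show "(if \<forall>k\<in>{1..Suc n}. 0 < y + affine_walk A B x k w
      then f (affine_chain A B x (Suc n) w) (y + affine_walk A B x (Suc n) w) else 0) = case_prod F (?T w, ?R w)"
      unfolding F_def G_def case_prod_conv XT WT[OF order_refl] alT
      by (auto simp: affine_walk_Suc atLeastAtMostSuc_conv add.assoc)
  qed
  also have "\<dots> = (\<integral>p. case_prod F p \<partial>distr M (?PJ \<Otimes>\<^sub>M ?PR) (\<lambda>w. (?T w, ?R w)))"
    by (rule integral_distr[symmetric, OF measurable_Pair[OF T R] F])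
  also have "\<dots> = (\<integral>\<omega>. (\<integral>r. F \<omega> r \<partial>distr M ?PR ?R) \<partial>distr M ?PJ ?T)"
    unfolding joint[symmetric] using P.integral_fst'[OF intF] by simp
  also have "\<dots> = (\<integral>\<omega>. (if al \<omega> then killed f (X \<omega>) (y + W n \<omega>) else 0) \<partial>distr M ?PJ ?T)"
    by (intro Bochner_Integration.integral_cong refl inner) simp
  also have "\<dots> = (\<integral>w. (if al (?T w) then killed f (X (?T w)) (y + W n (?T w)) else 0) \<partial>M)"
  proof (rule integral_distr[OF T])
    show "(\<lambda>\<omega>. if al \<omega> then killed f (X \<omega>) (y + W n \<omega>) else 0) \<in> borel_measurable ?PJ"
      by (intro measurable_If adm_measurable[OF adm_killed[OF Suc.prems(1)]]) measurable
  qed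
  also have "\<dots> = (\<integral>w. (if \<forall>k\<in>{1..n}. 0 < y + affine_walk A B x k w
      then killed f (affine_chain A B x n w) (y + affine_walk A B x n w) else 0) \<partial>M)"
    unfolding alT XT WT[OF order_refl] ..
  \<comment> \<open>The induction hypothesis is used for \<open>killed f\<close>, which inherits the
    bound \<open>C\<close>.\<close>
  also have "\<dots> = mean n (killed f) x y"
  proof (rule Suc.IH[OF adm_killed[OF Suc.prems(1)]])
    fix x y :: real
    have "\<bar>killed f x y\<bar> \<le> (\<integral>w. \<bar>if 0 < y + (a w * x + b w) then f (a w * x + b w) (y + (a w * x + b w)) else 0\<bar> \<partial>M)"
      unfolding killed_def transit_def by (rule integral_abs_bound)
    also have "\<dots> \<le> (\<integral>w. C \<partial>M)"
      using integrable_step[OF adm_absval[OF adm_if[OF Suc.prems(1) adm_const[of 0]]]] C Suc.prems(2)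
      by (intro integral_mono) auto
    finally show "\<bar>killed f x y\<bar> \<le> C" by (simp add: prob_space)
  qed
  finally show ?case by (simp add: mean_Suc)
qed

lemma prob_alive:
  assumes iid: "iid_copies M a b A B" and P: "Measurable.pred (borel \<Otimes>\<^sub>M borel) (case_prod P)" and y: "0 < y"
  shows "\<P>(w in M. P (affine_chain A B x n w) (y + affine_walk A B x n w) \<and> exit_time A B x y w > enat n)
    = mean n (\<lambda>x y. of_bool (P x y)) x y"
proof -
  let ?E = "{w. P (affine_chain A B x n w) (y + affine_walk A B x n w) \<and> exit_time A B x y w > enat n}"
  have "mean n (\<lambda>x y. of_bool (P x y)) x y = (\<integral>w. indicator ?E w \<partial>M)"
    unfolding expectation_alive[OF iid adm_of_bool[OF P] _ y, of 1, symmetric, simplified]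
    by (intro Bochner_Integration.integral_cong refl) (auto simp: exit_time_gt_iff indicator_def)
  also have "\<dots> = measure M (?E \<inter> space M)" by (rule Bochner_Integration.integral_indicator)
  also have "?E \<inter> space M = {w \<in> space M. P (affine_chain A B x n w) (y + affine_walk A B x n w) \<and> exit_time A B x y w > enat n}"
    by auto
  finally show ?thesis ..
qed

lemma affine_sigma_eq: "affine_sigma M a b = sg"
  by (simp add: affine_sigma_def sg_def sig2_def a_mean_def a_sq_def b_sq_def)

lemma prob_exit_gt:
  assumes iid: "iid_copies M a b A B" and y: "0 < y"
  shows "\<P>(w in M. exit_time A B x y w > enat n) = surv n x y"
  using prob_alive[OF iid _ y, of "\<lambda>x y. True" x n] by (simp add: surv_def case_prod_unfold)

lemma conditional_rayleigh:
  assumes iid: "iid_copies M a b A B" and y: "0 < y" and t: "0 < t" and V: "0 < V x y"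
  shows "(\<lambda>n. \<P>(w in M. (y + affine_walk A B x n w) / (affine_sigma M a b * sqrt (real n)) \<le> t
            \<bar> exit_time A B x y w > enat n)) \<longlonglongrightarrow> rayleigh_cdf t"
proof -
  let ?m = "\<lambda>n. mean n (\<lambda>x y. of_bool (t * sg * sqrt (real n) < y)) x y"
  \<comment> \<open>The index 0 is excluded because of the division by sqrt n.\<close>
  have eq: "\<P>(w in M. (y + affine_walk A B x n w) / (affine_sigma M a b * sqrt (real n)) \<le> t
            \<bar> exit_time A B x y w > enat n) = (surv n x y - ?m n) / surv n x y" if n: "0 < n" for n
  proof -
    have m: "Measurable.pred (borel \<Otimes>\<^sub>M borel) (\<lambda>(x :: real, y :: real). y \<le> t * sg * sqrt (real n))"
      by (simp add: case_prod_unfold)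
    have "(z / (affine_sigma M a b * sqrt (real n)) \<le> t) \<longleftrightarrow> z \<le> t * sg * sqrt (real n)" for z
      using n sg_pos unfolding affine_sigma_eq by (simp add: pos_divide_le_eq mult.assoc)
    then have "\<P>(w in M. (y + affine_walk A B x n w) / (affine_sigma M a b * sqrt (real n)) \<le> t \<and> exit_time A B x y w > enat n)
        = mean n (\<lambda>x y. of_bool (y \<le> t * sg * sqrt (real n))) x y"
      using prob_alive[OF iid m y, of x n] by simp
    also have "(\<lambda>(x::real) y. of_bool (y \<le> t * sg * sqrt (real n)) :: real) = (\<lambda>x y. 1 - of_bool (t * sg * sqrt (real n) < y))"
      by (auto simp: fun_eq_iff)
    also have "mean n \<dots> x y = surv n x y - ?m n"
      unfolding surv_def by (rule mean_minus[OF adm_const adm_of_bool]) (simp add: case_prod_unfold)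
    finally show ?thesis unfolding cond_prob_def prob_exit_gt[OF iid y] by simp
  qed
  have "(\<lambda>n. (surv n x y - ?m n) / surv n x y) \<longlonglongrightarrow> 1 - exp (- (t\<^sup>2) / 2)"
    using t by (intro conditional_limit y V) simp
  then show ?thesis unfolding rayleigh_cdf_def
    by (rule Lim_transform_eventually) (rule eventually_mono[OF eventually_gt_at_top[of 0]], simp only: eq)
qed

text \<open>A nonnegative mean of \<open>a\<close> makes \<rho> nonnegative, and survival of one
  step from every state is what \<open>reach_cone\<close> asks for.\<close>

lemma V_pos_drift:
  assumes iid: "iid_copies M a b A B" and mean_a: "0 \<le> (\<integral>w. a w \<partial>M)"
    and surv: "\<forall>x y. 0 < y \<longrightarrow> \<P>(w in M. exit_time A B x y w > 1) > 0" and y: "0 < y"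
  shows "0 < V x y"
proof -
  obtain c where c: "1 \<le> c" "\<forall>x y k. 0 < y \<longrightarrow> 0 < mean k (cone c) x y \<longrightarrow> 0 < V x y" using V_pos by blast
  have "0 \<le> \<rho>" using mean_a a_mean_abs_less unfolding \<rho>_def a_mean_def by simp
  moreover have "0 < surv 1 x y" if "0 < y" for x y
    using surv[rule_format, OF that, of x] prob_exit_gt[OF iid that, of 1 x] by (simp add: one_enat_def)
  ultimately obtain k where "0 < mean k (cone c) x y" using reach_cone[OF _ _ y, of c x] c(1) by auto
  with c(2) y show ?thesis by blast
qed

text \<open>For p > 2 the bound 1 + x^2 \<le> 2 (1 + |x|^p) puts the set with constant 2 c inside
  the cone with constant c.\<close>

lemma V_pos_reach:
  assumes iid: "iid_copies M a b A B" and p: "2 < p" and y: "0 < y"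
    and reach: "\<forall>c>0. \<exists>n\<ge>1. \<P>(w in M. (affine_chain A B x n w, y + affine_walk A B x n w) \<in> K_set p c
        \<and> exit_time A B x y w > enat n) > 0"
  shows "0 < V x y"
proof -
  obtain c where c: "1 \<le> c" "\<forall>x y k. 0 < y \<longrightarrow> 0 < mean k (cone c) x y \<longrightarrow> 0 < V x y" using V_pos by blast
  obtain n where n: "\<P>(w in M. (affine_chain A B x n w, y + affine_walk A B x n w) \<in> K_set p (2 * c)
        \<and> exit_time A B x y w > enat n) > 0"
    using reach[rule_format, of "2 * c"] c(1) by auto
  have m: "Measurable.pred (borel \<Otimes>\<^sub>M borel) (\<lambda>(x, y). (x, y) \<in> K_set p (2 * c))"
    unfolding K_set_def case_prod_unfold by simp
  have "0 < mean n (\<lambda>x y. of_bool ((x, y) \<in> K_set p (2 * c))) x y"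
    using n prob_alive[OF iid m y, of x n] by simp
  also have "\<dots> \<le> mean n (cone c) x y"
  proof (intro mean_mono adm_of_bool m adm_cone y)
    fix x y :: real
    show "of_bool ((x, y) \<in> K_set p (2 * c)) \<le> cone c x y"
    proof (cases "(x, y) \<in> K_set p (2 * c)")
      case True
      have "\<bar>x\<bar> powr 2 \<le> 1 + \<bar>x\<bar> powr p"
      proof (cases "\<bar>x\<bar> \<le> 1")
        case True
        then have "\<bar>x\<bar> powr 2 \<le> 1 powr 2" by (intro powr_mono2) auto
        then show ?thesis by (simp add: add_increasing2)
      next
        case False
        then have "\<bar>x\<bar> powr 2 \<le> \<bar>x\<bar> powr p" using p by (intro powr_mono) auto
        then show ?thesis by simp
      qed
      then have "x\<^sup>2 \<le> 1 + \<bar>x\<bar> powr p" by simp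
      moreover have "1 + s \<le> 2 * (1 + q)" if "s \<le> 1 + q" "0 \<le> q" for s q :: real using that by simp
      ultimately have "1 + x\<^sup>2 \<le> 2 * (1 + \<bar>x\<bar> powr p)" using powr_ge_zero by blast
      then have "c * (1 + x\<^sup>2) \<le> c * (2 * (1 + \<bar>x\<bar> powr p))" using c(1) by (intro mult_left_mono) auto
      also have "\<dots> = 2 * c * (1 + \<bar>x\<bar> powr p)" by (simp only: mult_ac)
      also have "\<dots> \<le> y" using True by (simp add: K_set_def)
      finally show ?thesis by (simp add: cone_def)
    qed (simp add: cone_def)
  qed
  finally show ?thesis using c(2) y by blast
qed

end

theorem theorem2p4:
  fixes M :: "'w measure"
    and a b :: "'w \<Rightarrow> real"
    and A B :: "nat \<Rightarrow> 'w \<Rightarrow> real"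
    and \<alpha> :: real
  assumes "prob_space M"
    and "a \<in> borel_measurable M" and "b \<in> borel_measurable M"
    and "iid_copies M a b A B"
    and "\<alpha> > 2"
    and "integrable M (\<lambda>w. \<bar>a w\<bar> powr \<alpha>)" and "(\<integral>w. \<bar>a w\<bar> powr \<alpha> \<partial>M) < 1"
    and "integrable M (\<lambda>w. \<bar>b w\<bar> powr \<alpha>)"
    and "\<P>(w in M. b w \<noteq> 0) > 0"
    and "(\<integral>w. b w \<partial>M) = 0"
    and "((\<integral>w. a w \<partial>M) \<ge> 0 \<and>
            (\<forall>x y. y > 0 \<longrightarrow> \<P>(w in M. exit_time A B x y w > 1) > 0))
         \<or> (\<forall>x y. y > 0 \<longrightarrow> (\<exists>p\<^sub>0. 2 < p\<^sub>0 \<and> p\<^sub>0 < \<alpha> \<and> (\<forall>c>0. \<exists>n\<^sub>0\<ge>1.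
              \<P>(w in M. (affine_chain A B x n\<^sub>0 w, y + affine_walk A B x n\<^sub>0 w) \<in> K_set p\<^sub>0 c
                        \<and> exit_time A B x y w > enat n\<^sub>0) > 0)))"
  shows "\<forall>x y t. y > 0 \<longrightarrow> t > 0 \<longrightarrow>
           (\<lambda>n. \<P>(w in M. (y + affine_walk A B x n w) / (affine_sigma M a b * sqrt (real n)) \<le> t
                        \<bar> exit_time A B x y w > enat n))
           \<longlonglongrightarrow> rayleigh_cdf t"
proof (intro allI impI)
  fix x y t :: real
  assume y: "y > 0" and t: "t > 0"
  interpret prob_space M by fact
  note [measurable] = assms(2,3)
  \<comment> \<open>Lowering the exponent to at most 3 preserves the moment assumptions: in
    \<open>powr_le_affine\<close> the coefficients sum to 1, so a moment of \<open>a\<close> below 1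
    stays below 1.\<close>
  define \<beta> where "\<beta> = min \<alpha> 3"
  have \<beta>: "2 < \<beta>" "\<beta> \<le> 3" "\<beta> \<le> \<alpha>" using assms(5) by (auto simp: \<beta>_def)
  have le: "\<bar>s\<bar> powr \<beta> \<le> \<beta> / \<alpha> * \<bar>s\<bar> powr \<alpha> + (1 - \<beta> / \<alpha>)" for s :: real
    using \<beta> by (intro powr_le_affine) auto
  have int: "integrable M (\<lambda>w. \<bar>f w\<bar> powr \<beta>)"
    if [measurable]: "f \<in> borel_measurable M" and f: "integrable M (\<lambda>w. \<bar>f w\<bar> powr \<alpha>)" for f :: "'w \<Rightarrow> real"
  proof (rule Bochner_Integration.integrable_bound)
    show "integrable M (\<lambda>w. \<beta> / \<alpha> * \<bar>f w\<bar> powr \<alpha> + (1 - \<beta> / \<alpha>))" using f by simp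
    show "AE w in M. norm (\<bar>f w\<bar> powr \<beta>) \<le> norm (\<beta> / \<alpha> * \<bar>f w\<bar> powr \<alpha> + (1 - \<beta> / \<alpha>))"
      using order_trans[OF le abs_ge_self] by (intro AE_I2) simp
  qed measurable
  have "(\<integral>w. \<bar>a w\<bar> powr \<beta> \<partial>M) \<le> (\<integral>w. \<beta> / \<alpha> * \<bar>a w\<bar> powr \<alpha> + (1 - \<beta> / \<alpha>) \<partial>M)"
    using int[OF assms(2,6)] assms(6) le by (intro integral_mono) auto
  also have "\<dots> = \<beta> / \<alpha> * (\<integral>w. \<bar>a w\<bar> powr \<alpha> \<partial>M) + (1 - \<beta> / \<alpha>)"
    using assms(6) by (simp add: prob_space)
  also have "\<dots> < \<beta> / \<alpha> * 1 + (1 - \<beta> / \<alpha>)"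
    using assms(7) \<beta> by (intro add_strict_right_mono mult_strict_left_mono) auto
  finally have mom: "(\<integral>w. \<bar>a w\<bar> powr \<beta> \<partial>M) < 1" by simp
  interpret affine_law M a b \<beta>
    using assms(2,3,9,10) \<beta> int[OF assms(2,6)] int[OF assms(3,8)] mom by unfold_locales auto
  have "0 < V x y"
    using assms(11)
  proof
    assume *: "(\<integral>w. a w \<partial>M) \<ge> 0 \<and> (\<forall>x y. y > 0 \<longrightarrow> \<P>(w in M. exit_time A B x y w > 1) > 0)"
    show ?thesis by (rule V_pos_drift[OF assms(4) conjunct1[OF *] conjunct2[OF *] y])
  next
    assume "\<forall>x y. y > 0 \<longrightarrow> (\<exists>p\<^sub>0. 2 < p\<^sub>0 \<and> p\<^sub>0 < \<alpha> \<and> (\<forall>c>0. \<exists>n\<^sub>0\<ge>1.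
              \<P>(w in M. (affine_chain A B x n\<^sub>0 w, y + affine_walk A B x n\<^sub>0 w) \<in> K_set p\<^sub>0 c
                        \<and> exit_time A B x y w > enat n\<^sub>0) > 0))"
    with y obtain p where "2 < p" "\<forall>c>0. \<exists>n\<^sub>0\<ge>1.
              \<P>(w in M. (affine_chain A B x n\<^sub>0 w, y + affine_walk A B x n\<^sub>0 w) \<in> K_set p c
                        \<and> exit_time A B x y w > enat n\<^sub>0) > 0" by blast
    then show ?thesis by (intro V_pos_reach[OF assms(4) _ y])
  qed
  then show "(\<lambda>n. \<P>(w in M. (y + affine_walk A B x n w) / (affine_sigma M a b * sqrt (real n)) \<le> t
                        \<bar> exit_time A B x y w > enat n)) \<longlonglongrightarrow> rayleigh_cdf t"
    by (rule conditional_rayleigh[OF assms(4) y t])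
qed

end
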